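(* Let $0<\alpha<1$, let $s$ be the shift parameter, let $h=t/n$ with $n$ a positive integer, and write $t_n=nh=t$, $y_k=y(kh)$. Each of the four shifted approximations $$\frac{c_\alpha}{h^\alpha}\sum_{k=0}^{n-1}w_k^{(\alpha)}y_{n-k}\approx y^{(\alpha)}_{n-s}$$ of the Caputo derivative, with the constants $c_\alpha$ and weights $w_k^{(\alpha)}$ listed in (1)–(4) below, has order $2-\alpha$, that is, $$\frac{c_\alpha}{h^\alpha}\sum_{k=0}^{n-1}w_k^{(\alpha)}y_{n-k}=y^{(\alpha)}_{n-s}+O\left(h^{2-\alpha}\right),$$ when $y\in C^2[0,t_n]$ and $y(0)=y'(0)=0$, and has second order accuracy (error $O(h^2)$) at its optimal shift value, which is $s=S_2(\alpha)$ for (1), $s=S_3(\alpha)$ for (2), $s=S_4(\alpha)$ for (3) and $s=S_5(\alpha)$ for (4). (1) $c_\alpha=\frac{1}{\Gamma(-\alpha)}$, $w_0^{(\alpha)}=\zeta(\alpha)+((\alpha+1)s-1)\zeta(\alpha+1)-(\alpha+1)s\,\zeta(\alpha+2)$, $w_1^{(\alpha)}=1+(\alpha+1)s-\zeta(\alpha)-(\alpha+1)s\,\zeta(\alpha+1)$, $w_k^{(\alpha)}=\frac{1}{k^{1+\alpha}}+\frac{s(1+\alpha)}{k^{2+\alpha}}$ for $2\le k\le n$; $$S_2(\alpha)=\frac{\zeta(\alpha)-\zeta(\alpha-1)}{(1+\alpha)(\zeta(\alpha)-\zeta(1+\alpha))}.$$ (2) $c_\alpha=\frac{1}{\Gamma(2-\alpha)}$,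 $w_0^{(\alpha)}=1+s(\alpha-1)$, $w_1^{(\alpha)}=2^{1-\alpha}+s(\alpha-1)2^{-\alpha}-2(s(\alpha-1)+1)$, $w_k^{(\alpha)}=(k+1)^{1-\alpha}-2k^{1-\alpha}+(k-1)^{1-\alpha}+s(\alpha-1)\left((k+1)^{-\alpha}-2k^{-\alpha}+(k-1)^{-\alpha}\right)$ for $2\le k\le n-1$, and $w_n^{(\alpha)}=(n-1)^{1-\alpha}-n^{1-\alpha}+s(\alpha-1)\left((n-1)^{-\alpha}-n^{-\alpha}\right)$; $$S_3(\alpha)=\frac{\zeta(\alpha-1)}{(1-\alpha)\zeta(\alpha)}.$$ (3) $c_\alpha=\frac{1}{2\Gamma(1-\alpha)}$, $w_0^{(\alpha)}=1+\alpha s-2\alpha s\,\zeta(\alpha+1)-2\zeta(\alpha)$, $w_1^{(\alpha)}=\frac{1}{2^\alpha}+\frac{\alpha s}{2^{\alpha+1}}+2\alpha s\,\zeta(\alpha+1)+2\zeta(\alpha)$, $w_k^{(\alpha)}=\frac{1}{(k+1)^\alpha}-\frac{1}{(k-1)^\alpha}+\frac{\alpha s}{(k+1)^{\alpha+1}}-\frac{\alpha s}{(k-1)^{\alpha+1}}$ for $2\le k\le n$; $$S_4(\alpha)=\frac{2\zeta(\alpha-1)-\zeta(\alpha)}{\alpha(\zeta(\alpha+1)-2\zeta(\alpha))}.$$ (4) $c_\alpha=\frac{1}{\Gamma(1-\alpha)}$, $w_0^{(\alpha)}=2^\alpha(2\alpha s+1)-\alpha s(2^{\alpha+1}-1)\zeta(\alpha+1)-(2^\alpha-1)\zeta(\alpha)$,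 $w_1^{(\alpha)}=2^\alpha\left(2\alpha s(3^{-\alpha-1}-1)+3^{-\alpha}-1\right)+\alpha s(2^{\alpha+1}-1)\zeta(\alpha+1)+(2^\alpha-1)\zeta(\alpha)$, $w_k^{(\alpha)}=2^\alpha\left(\frac{1}{(2k+1)^\alpha}-\frac{1}{(2k-1)^\alpha}+\frac{2\alpha s}{(2k+1)^{\alpha+1}}-\frac{2\alpha s}{(2k-1)^{\alpha+1}}\right)$ for $2\le k\le n$; $$S_5(\alpha)=\frac{(2^\alpha-1)\zeta(\alpha)-(2^\alpha-2)\zeta(\alpha-1)}{\alpha\left((2^{\alpha+1}-2)\zeta(\alpha)-(2^{\alpha+1}-1)\zeta(\alpha+1)\right)}.$$
   Context: $\zeta$ is the Riemann zeta function. $y^{(\alpha)}(t)=\frac{1}{\Gamma(1-\alpha)}\int_0^t \frac{y'(x)}{(t-x)^\alpha}\,dx$ is the Caputo derivative of order $\alpha$, and $y^{(\alpha)}_{n-s}=y^{(\alpha)}((n-s)h)=y^{(\alpha)}(t-sh)$. The weight $w_n^{(\alpha)}$ would multiply $y_0=y(0)=0$, so it plays no role in the sums above, which run to $n-1$.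
   Formalization: The second order claim at the optimal shifts is stated for y in C^3[0,t] with y(0)=y'(0)=0, since it fails for some y that is only C^2; for s<0, y is taken C^2 on a slightly larger interval [0,T], T>t, so that the Caputo derivative at t-sh is defined. *)

theory Defs
  imports "HOL-Complex_Analysis.Complex_Analysis" "HOL-Library.Landau_Symbols"
begin

text \<open>The analytic continuation of the Dirichlet series is unique on the connected set
  \<open>\<complex> - {1}\<close>; only the value at the pole is left unspecified.\<close>

definition riemann_zeta :: "complex \<Rightarrow> complex" where
  "riemann_zeta = (SOME f. f holomorphic_on (- {1}) \<and>
     (\<forall>z. Re z > 1 \<longrightarrow> (\<lambda>n. 1 / of_nat (Suc n) powr z) sums f z))"

definition zeta :: "real \<Rightarrow> real" where
  "zeta x = Re (riemann_zeta (of_real x))"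

text \<open>Derivatives are taken within \<open>S\<close>, hence are one-sided at the end points of a closed
  interval.\<close>

definition C_k_on :: "nat \<Rightarrow> (real \<Rightarrow> real) \<Rightarrow> real set \<Rightarrow> bool" where
  "C_k_on k f S \<longleftrightarrow> (\<exists>D :: nat \<Rightarrow> real \<Rightarrow> real.
     (\<forall>x\<in>S. D 0 x = f x) \<and>
     (\<forall>i<k. \<forall>x\<in>S. (D i has_real_derivative D (Suc i) x) (at x within S)) \<and>
     continuous_on S (D k))"

text \<open>\<open>deriv\<close> is two-sided, so it may be meaningless at the end points of \<open>{0..t}\<close>, which do not
  affect the integral.\<close>

definition caputo :: "real \<Rightarrow> (real \<Rightarrow> real) \<Rightarrow> real \<Rightarrow> real" where
  "caputo \<alpha> y t = 1 / Gamma (1 - \<alpha>) * integral {0..t} (\<lambda>x. deriv y x / (t - x) powr \<alpha>)"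

text \<open>The number \<open>t\<close> is fixed and the error is estimated as \<open>n \<rightarrow> \<infinity>\<close>, that is, as \<open>h = t / n\<close> tends
  to 0. The weights \<open>w n k\<close> may depend on the number \<open>n\<close> of steps.\<close>

definition approximates_caputo_with_order ::
  "real \<Rightarrow> (nat \<Rightarrow> nat \<Rightarrow> real) \<Rightarrow> real \<Rightarrow> real \<Rightarrow> (real \<Rightarrow> real) \<Rightarrow> real \<Rightarrow> real \<Rightarrow> bool" where
  "approximates_caputo_with_order c w \<alpha> s y t p \<longleftrightarrow>
     (\<lambda>n. let h = t / real n in
        c / h powr \<alpha> * (\<Sum>k=0..<n. w n k * y (real (n - k) * h))
          - caputo \<alpha> y ((real n - s) * h))
     \<in> O(\<lambda>n. (t / real n) powr p)"

definition c_trapezoid :: "real \<Rightarrow> real" where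
  "c_trapezoid \<alpha> = 1 / Gamma (- \<alpha>)"

definition w_trapezoid :: "real \<Rightarrow> real \<Rightarrow> nat \<Rightarrow> nat \<Rightarrow> real" where
  "w_trapezoid \<alpha> s n k =
    (if k = 0 then
       zeta \<alpha> + ((\<alpha> + 1) * s - 1) * zeta (\<alpha> + 1) - (\<alpha> + 1) * s * zeta (\<alpha> + 2)
     else if k = 1 then
       1 + (\<alpha> + 1) * s - zeta \<alpha> - (\<alpha> + 1) * s * zeta (\<alpha> + 1)
     else
       1 / real k powr (1 + \<alpha>) + s * (1 + \<alpha>) / real k powr (2 + \<alpha>))"

definition shift_trapezoid :: "real \<Rightarrow> real" where
  "shift_trapezoid \<alpha> =
     (zeta \<alpha> - zeta (\<alpha> - 1)) / ((1 + \<alpha>) * (zeta \<alpha> - zeta (1 + \<alpha>)))"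

definition c_L1 :: "real \<Rightarrow> real" where
  "c_L1 \<alpha> = 1 / Gamma (2 - \<alpha>)"

definition w_L1 :: "real \<Rightarrow> real \<Rightarrow> nat \<Rightarrow> nat \<Rightarrow> real" where
  "w_L1 \<alpha> s n k =
    (if k = 0 then
       1 + s * (\<alpha> - 1)
     else if k = 1 then
       2 powr (1 - \<alpha>) + s * (\<alpha> - 1) * 2 powr (- \<alpha>) - 2 * (s * (\<alpha> - 1) + 1)
     else if k < n then
       (real k + 1) powr (1 - \<alpha>) - 2 * real k powr (1 - \<alpha>) + (real k - 1) powr (1 - \<alpha>)
       + s * (\<alpha> - 1) *
         ((real k + 1) powr (- \<alpha>) - 2 * real k powr (- \<alpha>) + (real k - 1) powr (- \<alpha>))
     else
       (real n - 1) powr (1 - \<alpha>) - real n powr (1 - \<alpha>)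
       + s * (\<alpha> - 1) * ((real n - 1) powr (- \<alpha>) - real n powr (- \<alpha>)))"

definition shift_L1 :: "real \<Rightarrow> real" where
  "shift_L1 \<alpha> = zeta (\<alpha> - 1) / ((1 - \<alpha>) * zeta \<alpha>)"

definition c_central :: "real \<Rightarrow> real" where
  "c_central \<alpha> = 1 / (2 * Gamma (1 - \<alpha>))"

definition w_central :: "real \<Rightarrow> real \<Rightarrow> nat \<Rightarrow> nat \<Rightarrow> real" where
  "w_central \<alpha> s n k =
    (if k = 0 then
       1 + \<alpha> * s - 2 * \<alpha> * s * zeta (\<alpha> + 1) - 2 * zeta \<alpha>
     else if k = 1 then
       1 / 2 powr \<alpha> + \<alpha> * s / 2 powr (\<alpha> + 1) + 2 * \<alpha> * s * zeta (\<alpha> + 1) + 2 * zeta \<alpha>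
     else
       1 / (real k + 1) powr \<alpha> - 1 / (real k - 1) powr \<alpha>
       + \<alpha> * s / (real k + 1) powr (\<alpha> + 1) - \<alpha> * s / (real k - 1) powr (\<alpha> + 1))"

definition shift_central :: "real \<Rightarrow> real" where
  "shift_central \<alpha> =
     (2 * zeta (\<alpha> - 1) - zeta \<alpha>) / (\<alpha> * (zeta (\<alpha> + 1) - 2 * zeta \<alpha>))"

definition c_midpoint :: "real \<Rightarrow> real" where
  "c_midpoint \<alpha> = 1 / Gamma (1 - \<alpha>)"

definition w_midpoint :: "real \<Rightarrow> real \<Rightarrow> nat \<Rightarrow> nat \<Rightarrow> real" where
  "w_midpoint \<alpha> s n k =
    (if k = 0 then
       2 powr \<alpha> * (2 * \<alpha> * s + 1) - \<alpha> * s * (2 powr (\<alpha> + 1) - 1) * zeta (\<alpha> + 1)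
       - (2 powr \<alpha> - 1) * zeta \<alpha>
     else if k = 1 then
       2 powr \<alpha> * (2 * \<alpha> * s * (3 powr (- \<alpha> - 1) - 1) + 3 powr (- \<alpha>) - 1)
       + \<alpha> * s * (2 powr (\<alpha> + 1) - 1) * zeta (\<alpha> + 1) + (2 powr \<alpha> - 1) * zeta \<alpha>
     else
       2 powr \<alpha> *
         (1 / (2 * real k + 1) powr \<alpha> - 1 / (2 * real k - 1) powr \<alpha>
          + 2 * \<alpha> * s / (2 * real k + 1) powr (\<alpha> + 1)
          - 2 * \<alpha> * s / (2 * real k - 1) powr (\<alpha> + 1)))"

definition shift_midpoint :: "real \<Rightarrow> real" where
  "shift_midpoint \<alpha> =
     ((2 powr \<alpha> - 1) * zeta \<alpha> - (2 powr \<alpha> - 2) * zeta (\<alpha> - 1)) /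
     (\<alpha> * ((2 powr (\<alpha> + 1) - 2) * zeta \<alpha> - (2 powr (\<alpha> + 1) - 1) * zeta (\<alpha> + 1)))"

end

(*
Since y(0) = y'(0) = 0, both y(x) and the Caputo derivative of y are integrals of y'' against
truncated powers, so the error at step size h is h^(1-\<alpha>) times the integral of
\<kappa>((t-z)/h) y''(z), with a Peano kernel \<kappa> that does not depend on h. Up to the factor c,
the discrete part of \<kappa> interpolates linearly the values W(m) of the second antidifference W of
the weights. For L1, W is an explicit combination of powers; in the other schemes it is a
combination of partial sums of k^-p, and the zeta values in w_0 and w_1 cancel the constant
terms of their asymptotic expansions; hence
c W(m) = m^(1-\<alpha>)/\<Gamma>(2-\<alpha>) - s m^-\<alpha>/\<Gamma>(1-\<alpha>) + O(m^(-1-\<alpha>)), \<kappa>(v) = O(v^(-1-\<alpha>)) is integrable,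
and the error is O(h^(2-\<alpha>)). For y of class C^3 the coefficient of h^(2-\<alpha>) is
y''(t) times the integral of \<kappa>, which vanishes exactly at the optimal shift.
*)
theory Submission
  imports Defs "HOL-Real_Asymp.Real_Asymp"
begin

section \<open>Analytic continuation of the zeta function\<close>

text \<open>The choice operator in \<open>riemann_zeta\<close> says nothing until a holomorphic
  continuation is known to exist, so one has to be constructed. Afterwards only the half-plane Re p
  > -1 matters, since \<alpha> - 1 is the leftmost argument that occurs, and there the zeta values
  are recovered as the constant terms of partial sums. The integral of the kernel is never evaluated
  directly. The function z^2 / 2 has second derivative 1, so its scheme error is that integral up to
  a power of h, and this error is a discrete sum minus an explicit power. The discrete sum grows by
  the mean of two neighbouring values of W. A closed form Q with the same growth and no constant
  term at infinity exists for every shift; that it starts with the right value,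
  \<open>Q 1 = W 1 / 2\<close>, is one linear equation in s, and its solution is the optimal shift.
  The optimal shifts must also be shown to be well defined and nonnegative, which needs explicit
  bounds for zeta at \<alpha> - 1, \<alpha> and \<alpha> + 1.\<close>

definition powr_taylor_rem :: "nat \<Rightarrow> complex \<Rightarrow> nat \<Rightarrow> complex" where
  "powr_taylor_rem M w n = of_nat (Suc n) powr (-w)
     - (\<Sum>k<M. (-1) ^ k * pochhammer w k / fact k * of_nat n powr (-w - of_nat k))"

text \<open>Up to sign the M-th derivative of x^-w is \<open>pochhammer w M\<close> times x^(-w -
  M), and on [n, n + 1] its norm is largest at n because Re w + M \<ge> 0. The expansion takes place
  on a segment of the positive real axis, away from the branch cut.\<close>

lemma norm_powr_taylor_rem_le:
  assumes n: "n > 0" and re: "Re w + real M \<ge> 0"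
  shows "norm (powr_taylor_rem M w n) \<le> norm (pochhammer w M) * real n powr (-(Re w + real M))"
proof (cases M)
  \<comment> \<open>\<open>field_Taylor\<close> always has at least one Taylor term, so the
    expansion without terms is treated separately, by monotonicity of the power.\<close>
  case 0
  have "real (Suc n) powr - Re w \<le> real n powr - Re w"
    using n re 0 by (intro powr_mono2') auto
  then show ?thesis
    using 0 by (simp add: powr_taylor_rem_def norm_powr_real_powr del: of_nat_Suc)
next
  case (Suc N)
  define f where "f = (\<lambda>i x :: complex. (-1) ^ i * pochhammer w i * x powr (-w - of_nat i))"
  define S where "S = closed_segment (of_nat n :: complex) (of_nat (Suc n))"
  have S: "x \<in> \<real> \<and> Re x \<ge> real n" if "x \<in> S" for x
  proof -
    have "S = of_real ` closed_segment (real n) (real (Suc n))"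
      unfolding S_def by (metis closed_segment_of_real of_real_of_nat_eq)
    with that obtain u where "x = of_real u" "u \<in> closed_segment (real n) (real (Suc n))"
      by blast
    then show ?thesis by (auto simp: closed_segment_eq_real_ivl)
  qed
  have "norm (f 0 (of_nat (Suc n)) - (\<Sum>i\<le>N. f i (of_nat n) * (of_nat (Suc n) - of_nat n) ^ i / fact i))
     \<le> norm (pochhammer w M) * real n powr (-(Re w + real M)) *
        norm (of_nat (Suc n) - of_nat n :: complex) ^ Suc N / fact N"
  proof (rule field_Taylor[where S = S])
    show "convex S" by (simp add: S_def)
    show "(f i has_field_derivative f (Suc i) x) (at x within S)" if "x \<in> S" for i x
    proof -
      have "x \<notin> \<real>\<^sub>\<le>\<^sub>0"
        using S[OF that] n by (auto simp: complex_nonpos_Reals_iff)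
      then have "(f i has_field_derivative
          (-1) ^ i * pochhammer w i * ((-w - of_nat i) * x powr (-w - of_nat i - 1))) (at x)"
        unfolding f_def by (intro DERIV_cmult has_field_derivative_powr)
      also have "(-1) ^ i * pochhammer w i * ((-w - of_nat i) * x powr (-w - of_nat i - 1)) = f (Suc i) x"
        by (simp add: f_def pochhammer_Suc algebra_simps)
      finally show ?thesis by (rule has_field_derivative_at_within)
    qed
    show "norm (f (Suc N) x) \<le> norm (pochhammer w M) * real n powr (-(Re w + real M))" if "x \<in> S" for x
    proof -
      have "Re x powr (-(Re w + real M)) \<le> real n powr (-(Re w + real M))"
        using S[OF that] n re by (intro powr_mono2') auto
      moreover have "norm (f (Suc N) x) = norm (pochhammer w M) * Re x powr (-(Re w + real M))"
      proof -
        have "norm (x powr (-w - of_nat (Suc N))) = Re x powr Re (-w - of_nat (Suc N))"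
          using S[OF that] n by (intro norm_powr_real_powr) auto
        also have "Re (-w - of_nat (Suc N)) = -(Re w + real M)" by (simp add: Suc)
        finally show ?thesis
          unfolding f_def norm_mult norm_power Suc by simp
      qed
      ultimately show ?thesis by (simp add: mult_left_mono)
    qed
  qed (auto simp: S_def)
  also have "\<dots> \<le> norm (pochhammer w M) * real n powr (-(Re w + real M)) / 1"
    by (simp only: of_nat_Suc, intro divide_mono) (auto simp: fact_ge_1)
  also have "f 0 (of_nat (Suc n)) - (\<Sum>i\<le>N. f i (of_nat n) * (of_nat (Suc n) - of_nat n) ^ i / fact i)
     = powr_taylor_rem M w n"
    by (simp add: powr_taylor_rem_def f_def Suc lessThan_Suc_atMost mult_ac)
  finally show ?thesis by simp
qed

lemma holomorphic_powr_taylor_rem [holomorphic_intros]: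
  assumes "n > 0" "f holomorphic_on A"
  shows "(\<lambda>z. powr_taylor_rem M (f z) n) holomorphic_on A"
  unfolding powr_taylor_rem_def using assms
  by (intro holomorphic_intros) auto

text \<open>The radius d is half the distance from z to the line Re w + M = 1. On the disc
  \<open>pochhammer w M\<close> is bounded by compactness and the exponents stay above 1 + d, so the
  M-test applies.\<close>

lemma uniform_limit_powr_taylor_rem:
  assumes z: "Re z + real M > 1"
  shows "\<exists>d>0. cball z d \<subseteq> {z. Re z + real M > 1} \<and>
     uniform_limit (cball z d) (\<lambda>N w. \<Sum>n<N. powr_taylor_rem M w (Suc n))
       (\<lambda>w. \<Sum>n. powr_taylor_rem M w (Suc n)) sequentially"
proof -
  define d where "d = (Re z + real M - 1) / 2"
  have d: "d > 0" using z by (simp add: d_def)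
  have re: "Re w + real M \<ge> 1 + d" if "w \<in> cball z d" for w
  proof -
    have "\<bar>Re (z - w)\<bar> \<le> d"
      using that abs_Re_le_cmod[of "z - w"] by (simp add: dist_norm)
    then have "Re w \<ge> Re z - d" by simp
    then show ?thesis unfolding d_def by (simp add: field_simps)
  qed
  have "compact ((\<lambda>w. pochhammer w M) ` cball z d)"
    by (intro compact_continuous_image holomorphic_on_imp_continuous_on
          holomorphic_pochhammer holomorphic_on_ident compact_cball)
  then obtain B where B: "\<And>w. w \<in> cball z d \<Longrightarrow> norm (pochhammer w M) \<le> B"
    by (meson compact_imp_bounded bounded_iff imageI)
  have "uniform_limit (cball z d) (\<lambda>N w. \<Sum>n<N. powr_taylor_rem M w (Suc n))
       (\<lambda>w. \<Sum>n. powr_taylor_rem M w (Suc n)) sequentially"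
  proof (rule Weierstrass_m_test)
    fix n w assume w: "w \<in> cball z d"
    have "norm (powr_taylor_rem M w (Suc n)) \<le> norm (pochhammer w M) * real (Suc n) powr (-(Re w + real M))"
      using re[OF w] d by (intro norm_powr_taylor_rem_le) auto
    also have "\<dots> \<le> B * real (Suc n) powr (- (1 + d))"
      using re[OF w] B[OF w] by (intro mult_mono powr_mono order.trans[OF norm_ge_zero B[OF w]]) auto
    finally show "norm (powr_taylor_rem M w (Suc n)) \<le> B * real (Suc n) powr (- (1 + d))" .
  next
    have "summable (\<lambda>n. real n powr (- (1 + d)))"
      using d by (subst summable_real_powr_iff) auto
    then show "summable (\<lambda>n. B * real (Suc n) powr (- (1 + d)))"
      by (intro summable_mult) (subst summable_Suc_iff)
  qed
  moreover have "cball z d \<subseteq> {z. Re z + real M > 1}"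
    using re d by force
  ultimately show ?thesis using d by blast
qed

lemma open_Re_halfspace: "open {z. Re z + c > d}"
proof -
  have "{z. Re z + c > d} = {z. Re z > d - c}" by auto
  then show ?thesis by (simp add: open_halfspace_Re_gt)
qed

lemma holomorphic_suminf_powr_taylor_rem:
  "(\<lambda>w. \<Sum>n. powr_taylor_rem M w (Suc n)) holomorphic_on {z. Re z + real M > 1}"
  by (rule holomorphic_uniform_sequence[OF open_Re_halfspace
        _ uniform_limit_powr_taylor_rem])
     (auto intro!: holomorphic_intros)

lemma summable_powr_taylor_rem:
  assumes "Re w + real M > 1"
  shows "summable (\<lambda>n. powr_taylor_rem M w (Suc n))"
proof -
  obtain d where "d > 0" and u: "uniform_limit (cball w d) (\<lambda>N w. \<Sum>n<N. powr_taylor_rem M w (Suc n))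
       (\<lambda>w. \<Sum>n. powr_taylor_rem M w (Suc n)) sequentially"
    using uniform_limit_powr_taylor_rem[OF assms] by blast
  have "(\<lambda>N. \<Sum>n<N. powr_taylor_rem M w (Suc n)) \<longlonglongrightarrow> (\<Sum>n. powr_taylor_rem M w (Suc n))"
    using \<open>d > 0\<close> by (intro tendsto_uniform_limitI[OF u]) auto
  then show ?thesis by (auto simp: sums_def summable_def)
qed

lemma tendsto_of_nat_powr_0:
  assumes "Re w < 0"
  shows "(\<lambda>n. of_nat (Suc n) powr w :: complex) \<longlonglongrightarrow> 0"
proof (rule tendsto_norm_zero_cancel)
  have "(\<lambda>n. real n powr Re w) \<longlonglongrightarrow> 0"
    using assms by real_asymp
  then have "(\<lambda>n. real (Suc n) powr Re w) \<longlonglongrightarrow> 0"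
    by (rule LIMSEQ_Suc)
  then show "(\<lambda>n. norm (of_nat (Suc n) powr w :: complex)) \<longlonglongrightarrow> 0"
    by (simp add: norm_powr_real_powr del: of_nat_Suc)
qed

text \<open>The function \<open>(z - 1) \<zeta>(z)\<close> is continued strip by strip. Summing the Taylor expansion of
  \<open>(n + 1)\<^sup>-\<^sup>w\<close> about \<open>n\<close> over all \<open>n\<close> expresses \<open>w \<zeta>(w + 1)\<close> by the values
  \<open>\<zeta>(w + 2), \<zeta>(w + 3), \<dots>\<close> and a convergent series of remainders.\<close>

lemma zeta_strip_continuation:
  "\<exists>\<xi>. \<xi> holomorphic_on {z. Re z + real K > 1} \<and>
     (\<forall>z. Re z > 1 \<longrightarrow> (\<lambda>n. 1 / of_nat (Suc n) powr z) sums (\<xi> z / (z - 1)))"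
proof (induction K)
  case 0
  \<comment> \<open>\<open>powr_taylor_rem 0 z n\<close> is just (n + 1)^-z. The series therefore
    starts with the integer 2, and the summand 1 is the first term of the Dirichlet series.\<close>
  define \<xi> where "\<xi> = (\<lambda>z. (z - 1) * (1 + (\<Sum>n. powr_taylor_rem 0 z (Suc n))))"
  have "\<xi> holomorphic_on {z. Re z + real 0 > 1}"
    unfolding \<xi>_def by (intro holomorphic_intros holomorphic_suminf_powr_taylor_rem)
  moreover have "(\<lambda>n. 1 / of_nat (Suc n) powr z) sums (\<xi> z / (z - 1))" if "Re z > 1" for z
  proof -
    have "(\<lambda>n. powr_taylor_rem 0 z (Suc n)) sums (\<Sum>n. powr_taylor_rem 0 z (Suc n))"
      using that by (intro summable_sums summable_powr_taylor_rem) auto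
    then have "(\<lambda>n. 1 / of_nat (Suc (Suc n)) powr z) sums (\<Sum>n. powr_taylor_rem 0 z (Suc n))"
      by (simp add: powr_taylor_rem_def powr_minus_divide)
    then have "(\<lambda>n. 1 / of_nat (Suc n) powr z) sums ((\<Sum>n. powr_taylor_rem 0 z (Suc n)) + 1)"
      by (subst (asm) sums_Suc_iff) simp
    moreover have "z \<noteq> 1" using that by auto
    ultimately show ?thesis by (simp add: \<xi>_def add_ac)
  qed
  ultimately show ?case by blast
next
  case (Suc K)
  then obtain \<xi> where hol: "\<xi> holomorphic_on {z. Re z + real K > 1}"
    and \<xi>: "\<And>z. Re z > 1 \<Longrightarrow> (\<lambda>n. 1 / of_nat (Suc n) powr z) sums (\<xi> z / (z - 1))"
    by blast
  \<comment> \<open>On the next strip Re (z - 1) + M > 2, so the series of remainders at z - 1 is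
    holomorphic there.\<close>
  define M where "M = K + 3"
  define c where "c = (\<lambda>k w :: complex. (-1) ^ k * pochhammer w k / fact k)"
  \<comment> \<open>This is the summed expansion solved for its term k = 1, whose coefficient -w
    turns \<xi>(w + 1) / w into -\<xi>(z). For k \<ge> 2 the last factor z + k - 2 of
    \<open>pochhammer (z - 1) k\<close> cancels the denominator of \<xi>(z - 1 + k) / (z + k - 2),
    so no division is left that could create a pole.\<close>
  define \<xi>' where "\<xi>' = (\<lambda>z. 1
      + (\<Sum>k=2..<M. (-1) ^ k * pochhammer (z - 1) (k - 1) / fact k * \<xi> (z - 1 + of_nat k))
      + (\<Sum>n. powr_taylor_rem M (z - 1) (Suc n)))"
  have "((\<lambda>w. \<Sum>n. powr_taylor_rem M w (Suc n)) \<circ> (\<lambda>z. z - 1))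
          holomorphic_on {z. Re z + real (Suc K) > 1}"
    by (intro holomorphic_on_compose_gen[OF _ holomorphic_suminf_powr_taylor_rem] holomorphic_intros)
       (auto simp: M_def)
  moreover have "(\<xi> \<circ> (\<lambda>z. z - 1 + of_nat k)) holomorphic_on {z. Re z + real (Suc K) > 1}"
    if "k \<in> {2..<M}" for k
    using that by (intro holomorphic_on_compose_gen[OF _ hol] holomorphic_intros) auto
  ultimately have "\<xi>' holomorphic_on {z. Re z + real (Suc K) > 1}"
    unfolding \<xi>'_def o_def by (intro holomorphic_intros) auto
  moreover have "(\<lambda>n. 1 / of_nat (Suc n) powr z) sums (\<xi>' z / (z - 1))" if z: "Re z > 1" for z
  proof -
    define w where "w = z - 1"
    have w: "Re w > 0" "w \<noteq> 0" using z by (auto simp: w_def)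
    have "(\<lambda>n. of_nat (Suc n) powr (-w) :: complex) \<longlonglongrightarrow> 0"
      using w by (intro tendsto_of_nat_powr_0) simp
    then have "(\<lambda>n. of_nat (Suc (Suc n)) powr (-w) - of_nat (Suc n) powr (-w)) sums (0 - of_nat (Suc 0) powr (-w))"
      by (rule telescope_sums)
    moreover have "(\<lambda>n. c k w * of_nat (Suc n) powr (-w - of_nat k)) sums (c k w * (\<xi> (w + of_nat k) / (w + of_nat k - 1)))"
      if "k \<ge> 1" for k
    proof -
      have "(\<lambda>n. 1 / of_nat (Suc n) powr (w + of_nat k)) sums (\<xi> (w + of_nat k) / (w + of_nat k - 1))"
        using w that by (intro \<xi>) auto
      moreover have "1 / of_nat (Suc n) powr (w + of_nat k) = (of_nat (Suc n) :: complex) powr (-w - of_nat k)" for n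
        by (simp add: powr_minus_divide[symmetric] del: of_nat_Suc)
      ultimately show ?thesis by (intro sums_mult) simp
    qed
    then have "(\<lambda>n. (\<Sum>k=1..<M. c k w * of_nat (Suc n) powr (-w - of_nat k))) sums (\<Sum>k=1..<M. c k w * (\<xi> (w + of_nat k) / (w + of_nat k - 1)))"
      by (intro sums_sum) auto
    ultimately have "(\<lambda>n. of_nat (Suc (Suc n)) powr (-w) - of_nat (Suc n) powr (-w)
        - (\<Sum>k=1..<M. c k w * of_nat (Suc n) powr (-w - of_nat k))) sums
        (0 - of_nat (Suc 0) powr (-w) - (\<Sum>k=1..<M. c k w * (\<xi> (w + of_nat k) / (w + of_nat k - 1))))"
      by (rule sums_diff)
    moreover have "of_nat (Suc (Suc n)) powr (-w) - of_nat (Suc n) powr (-w)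
        - (\<Sum>k=1..<M. c k w * of_nat (Suc n) powr (-w - of_nat k)) = powr_taylor_rem M w (Suc n)" for n
    proof -
      have "{..<M} = insert 0 {1..<M}" by (auto simp: M_def)
      then show ?thesis by (simp add: powr_taylor_rem_def c_def)
    qed
    moreover have "(\<lambda>n. powr_taylor_rem M w (Suc n)) sums (\<Sum>n. powr_taylor_rem M w (Suc n))"
      using w by (intro summable_sums summable_powr_taylor_rem) (auto simp: M_def)
    ultimately have eq: "(\<Sum>n. powr_taylor_rem M w (Suc n))
        = - 1 - (\<Sum>k=1..<M. c k w * (\<xi> (w + of_nat k) / (w + of_nat k - 1)))"
      by (simp add: sums_unique2)
    have "(\<Sum>k=1..<M. c k w * (\<xi> (w + of_nat k) / (w + of_nat k - 1)))
        = c 1 w * (\<xi> (w + 1) / w) + (\<Sum>k=2..<M. c k w * (\<xi> (w + of_nat k) / (w + of_nat k - 1)))"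
      by (subst sum.atLeast_Suc_lessThan) (auto simp: M_def numeral_2_eq_2)
    also have "c 1 w * (\<xi> (w + 1) / w) = - \<xi> z"
      using w(2) by (simp add: c_def) (simp add: w_def)
    also have "(\<Sum>k=2..<M. c k w * (\<xi> (w + of_nat k) / (w + of_nat k - 1)))
       = (\<Sum>k=2..<M. (-1) ^ k * pochhammer w (k - 1) / fact k * \<xi> (w + of_nat k))"
    proof (intro sum.cong refl)
      fix k assume "k \<in> {2..<M}"
      then obtain j where j: "k = Suc j" "j \<ge> 1" by (cases k) auto
      have "w + of_nat j \<noteq> 0"
        using w j by (auto simp: complex_eq_iff)
      then show "c k w * (\<xi> (w + of_nat k) / (w + of_nat k - 1))
        = (-1) ^ k * pochhammer w (k - 1) / fact k * \<xi> (w + of_nat k)"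
        using j by (simp add: c_def pochhammer_Suc del: fact_Suc)
    qed
    finally have "\<xi> z = \<xi>' z"
      using eq by (simp add: \<xi>'_def w_def)
    then show ?thesis using \<xi>[OF z] by simp
  qed
  ultimately show ?case by blast
qed

text \<open>The continuations to different strips agree for Re z > 1, hence on their common domain,
  and glue to a function on the plane without 1. Its existence is what makes the choice in the
  definition of \<open>riemann_zeta\<close> usable.\<close>

lemma riemann_zeta_properties:
  shows holomorphic_riemann_zeta: "riemann_zeta holomorphic_on (- {1})"
    and sums_riemann_zeta: "Re z > 1 \<Longrightarrow> (\<lambda>n. 1 / of_nat (Suc n) powr z) sums riemann_zeta z"
proof -
  obtain \<xi> where hol: "\<And>K. \<xi> K holomorphic_on {z. Re z + real K > 1}"
    and \<xi>: "\<And>K z. Re z > 1 \<Longrightarrow> (\<lambda>n. 1 / of_nat (Suc n) powr z) sums (\<xi> K z / (z - 1))"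
    using zeta_strip_continuation by metis
  have mono: "\<xi> K z = \<xi> L z" if "K \<le> L" "Re z + real K > 1" for K L z
  proof (rule analytic_continuation_open[where f = "\<xi> K" and g = "\<xi> L" and s = "{z. Re z > 1}" and s' = "{z. Re z + real K > 1}"])
    show "connected {z. Re z + real K > 1}"
    proof -
      have "{z. Re z + real K > 1} = {z. Re z > 1 - real K}" by auto
      then show ?thesis by (simp add: convex_connected convex_halfspace_Re_gt)
    qed
    show "\<xi> L holomorphic_on {z. Re z + real K > 1}"
      using that by (intro holomorphic_on_subset[OF hol]) auto
    show "\<xi> K z = \<xi> L z" if "z \<in> {z. Re z > 1}" for z
    proof -
      have "z \<noteq> 1" using that by auto
      then show ?thesis
        using sums_unique2[OF \<xi>[of z K] \<xi>[of z L]] that by simp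
    qed
    show "({z. Re z > 1} :: complex set) \<noteq> {}" by (auto intro: exI[of _ 2])
  qed (use that in \<open>auto simp: open_halfspace_Re_gt open_Re_halfspace hol\<close>)
  \<comment> \<open>With this strip index, Re z plus the index is at least 2, so z lies inside the
    strip that is used for it.\<close>
  define F where "F = (\<lambda>z. \<xi> (nat \<lceil>2 - Re z\<rceil>) z / (z - 1))"
  have F: "F z = \<xi> K z / (z - 1)" if "Re z + real K > 1" for z K
  proof -
    have "Re z + real (nat \<lceil>2 - Re z\<rceil>) > 1" by linarith
    then show ?thesis
      using mono[of K "nat \<lceil>2 - Re z\<rceil>" z] mono[of "nat \<lceil>2 - Re z\<rceil>" K z] that
      unfolding F_def by (metis le_cases)
  qed
  have "F holomorphic_on (\<Union>K. {z. Re z + real K > 1} - {1})"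
  proof (rule holomorphic_on_UN_open)
    fix K
    have "(\<lambda>z. \<xi> K z / (z - 1)) holomorphic_on {z. Re z + real K > 1} - {1}"
      by (intro holomorphic_intros holomorphic_on_subset[OF hol]) auto
    then show "F holomorphic_on {z. Re z + real K > 1} - {1}"
      by (rule holomorphic_transform) (auto simp: F)
  qed (auto intro: open_Re_halfspace)
  moreover have "(\<Union>K. {z. Re z + real K > 1} - {1}) = - {1}"
  proof -
    have "\<exists>K. Re z + real K > 1" for z
      using reals_Archimedean2[of "1 - Re z"] by (auto simp: algebra_simps)
    then show ?thesis by auto
  qed
  ultimately have "F holomorphic_on (- {1})" by simp
  moreover have "(\<lambda>n. 1 / of_nat (Suc n) powr z) sums F z" if "Re z > 1" for z
    using \<xi>[OF that, of 0] F[of z 0] that by simp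
  ultimately have "\<exists>f. f holomorphic_on (- {1}) \<and>
     (\<forall>z. Re z > 1 \<longrightarrow> (\<lambda>n. 1 / of_nat (Suc n) powr z) sums f z)"
    by blast
  from someI_ex[OF this] show "riemann_zeta holomorphic_on (- {1})"
    "Re z > 1 \<Longrightarrow> (\<lambda>n. 1 / of_nat (Suc n) powr z) sums riemann_zeta z"
    by (auto simp: riemann_zeta_def)
qed

section \<open>The zeta function as a limit of regularized power sums\<close>

text \<open>The excess of the trapezoidal value over the integral of a convex function is bounded by
  an increment of f', a bound that telescopes when unit intervals are put together.\<close>

lemma trapezoid_rule_convex:
  fixes G f f1 f2 :: "real \<Rightarrow> real"
  assumes G: "\<And>x. a \<le> x \<Longrightarrow> x \<le> a + 1 \<Longrightarrow> (G has_real_derivative f x) (at x)"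
    and f: "\<And>x. a \<le> x \<Longrightarrow> x \<le> a + 1 \<Longrightarrow> (f has_real_derivative f1 x) (at x)"
    and f1: "\<And>x. a \<le> x \<Longrightarrow> x \<le> a + 1 \<Longrightarrow> (f1 has_real_derivative f2 x) (at x)"
    and nn: "\<And>x. a \<le> x \<Longrightarrow> x \<le> a + 1 \<Longrightarrow> f2 x \<ge> 0"
  shows "G (a + 1) - G a \<le> (f a + f (a + 1)) / 2"
    and "(f a + f (a + 1)) / 2 \<le> G (a + 1) - G a + (f1 (a + 1) - f1 a) / 8"
proof -
  define F where "F = (\<lambda>x. (x - a) * (f a + f x) / 2 - (G x - G a))"
  have "F a \<le> F (a + 1)"
  proof (rule DERIV_nonneg_imp_nondecreasing[where f = F])
    fix x assume x: "a \<le> x" "x \<le> a + 1"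
    have "(F has_real_derivative (f a - f x + (x - a) * f1 x) / 2) (at x)"
      unfolding F_def by (rule derivative_eq_intros G f x refl | simp add: field_simps)+
    \<comment> \<open>A convex function lies above its tangent at x; the tangent is evaluated at
      a.\<close>
    moreover have "f a - f x + (x - a) * f1 x \<ge> 0"
    proof (cases "x = a")
      case False
      then have "\<exists>t>a. t < x \<and> f a = (\<Sum>m<2. (if m = 0 then f else if m = Suc 0 then f1 else f2) x / fact m * (a - x) ^ m)
          + (if (2::nat) = 0 then f else if (2::nat) = Suc 0 then f1 else f2) t / fact 2 * (a - x) ^ 2"
        using x f f1
        by (intro Taylor_down[where b = x and f = f
              and diff = "\<lambda>m. if m = 0 then f else if m = Suc 0 then f1 else f2"])
           (auto simp: less_2_cases_iff)
      then obtain t where t: "t > a" "t < x" and "f a = f x + f1 x * (a - x) + f2 t / 2 * (a - x) ^ 2"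
        by (auto simp: numeral_2_eq_2)
      moreover have "f2 t / 2 * (a - x) ^ 2 \<ge> 0" using nn[of t] t x by simp
      ultimately show ?thesis by (simp add: algebra_simps)
    qed auto
    ultimately show "\<exists>y. DERIV F x :> y \<and> 0 \<le> y"
      by (intro exI[of _ "(f a - f x + (x - a) * f1 x) / 2"]) auto
  qed simp
  then show "G (a + 1) - G a \<le> (f a + f (a + 1)) / 2" by (simp add: F_def)
  \<comment> \<open>For the other bound G is expanded to third order from both ends, and the two
    expressions for its value at the midpoint are compared. The f' terms carry the factor (1/2)^2 /
    2 = 1/8, and both cubic remainders have the favourable sign.\<close>
  define D where "D = (\<lambda>m :: nat. if m = 0 then G else if m = 1 then f else if m = 2 then f1 else f2)"
  have D: "(D m has_real_derivative D (Suc m) x) (at x)" if "m < 3" "a \<le> x" "x \<le> a + 1" for m x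
  proof -
    have "m = 0 \<or> m = 1 \<or> m = 2" using that by linarith
    then show ?thesis using that G f f1 by (auto simp: D_def)
  qed
  have D0: "D 0 = G" by (simp add: D_def)
  have sum: "(\<Sum>m<3. D m x / fact m * y ^ m) = G x + f x * y + f1 x / 2 * y ^ 2" for x y
    by (simp add: D_def numeral_3_eq_3 numeral_2_eq_2)
  have "\<exists>t>a. t < a + 1 / 2 \<and> G (a + 1 / 2) =
      (\<Sum>m<3. D m a / fact m * (a + 1 / 2 - a) ^ m) + D 3 t / fact 3 * (a + 1 / 2 - a) ^ 3"
    by (rule Taylor_up[where a = a]) (auto intro!: D simp: D0)
  then obtain t where t: "t > a" "t < a + 1 / 2" and 1: "G (a + 1 / 2) =
      G a + f a * (1 / 2) + f1 a / 2 * (1 / 2) ^ 2 + f2 t / fact 3 * (1 / 2) ^ 3"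
    unfolding sum by (auto simp: D_def)
  have "\<exists>t>a + 1 / 2. t < a + 1 \<and> G (a + 1 / 2) =
      (\<Sum>m<3. D m (a + 1) / fact m * (a + 1 / 2 - (a + 1)) ^ m) + D 3 t / fact 3 * (a + 1 / 2 - (a + 1)) ^ 3"
    by (rule Taylor_down[where b = "a + 1"]) (auto intro!: D simp: D0)
  then obtain u where u: "u > a + 1 / 2" "u < a + 1" and 2: "G (a + 1 / 2) =
      G (a + 1) + f (a + 1) * (- 1 / 2) + f1 (a + 1) / 2 * (- 1 / 2) ^ 2 + f2 u / fact 3 * (- 1 / 2) ^ 3"
    unfolding sum by (auto simp: D_def)
  have "G (a + 1) - G a = (f a + f (a + 1)) / 2 - (f1 (a + 1) - f1 a) / 8 + (f2 t + f2 u) / 48"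
    using 1 2 by (simp add: eval_nat_numeral field_simps)
  moreover have "f2 t \<ge> 0" "f2 u \<ge> 0" using t u by (auto intro!: nn)
  ultimately show "(f a + f (a + 1)) / 2 \<le> G (a + 1) - G a + (f1 (a + 1) - f1 a) / 8" by simp
qed

text \<open>For p \<noteq> 1 this is the trapezoidal rule for x^-p on [n, n + 1] minus the exact
  integral. Written with Taylor remainders of x^-p and of its antiderivative, it inherits
  summability and holomorphic sums for Re p > -1.\<close>

definition powr_trapezoid_error :: "complex \<Rightarrow> nat \<Rightarrow> complex" where
  "powr_trapezoid_error p n = powr_taylor_rem 2 p n / 2 - powr_taylor_rem 3 (p - 1) n / (1 - p)"

lemma powr_trapezoid_error_eq:
  assumes "p \<noteq> 1"
  shows "powr_trapezoid_error p n = (of_nat n powr (-p) + of_nat (Suc n) powr (-p)) / 2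
     - (of_nat (Suc n) powr (1 - p) - of_nat n powr (1 - p)) / (1 - p)"
proof -
  have e: "- (p - 1) - of_nat (Suc 0) = - p" "- (p - 1) - of_nat 2 = - p - 1" "- (p - 1) = 1 - p"
    "- p - of_nat (Suc 0) = - p - 1"
    by auto
  define A B C D E where ABC: "A = (of_nat n :: complex) powr (- p)" "B = (of_nat n :: complex) powr (1 - p)"
    "C = (of_nat n :: complex) powr (- p - 1)" "D = (of_nat (Suc n) :: complex) powr (- p)"
    "E = (of_nat (Suc n) :: complex) powr (1 - p)"
  have "powr_taylor_rem 2 p n = D - A + p * C"
    unfolding powr_taylor_rem_def ABC
    by (simp add: numeral_2_eq_2 del: of_nat_Suc) (simp add: e del: of_nat_Suc, simp)
  moreover have "powr_taylor_rem 3 (p - 1) n = E - B + (p - 1) * A - (p - 1) * p / 2 * C"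
  proof -
    have s3: "(\<Sum>k<3. g k) = g 0 + g 1 + g (2::nat)" for g :: "nat \<Rightarrow> complex"
      by (simp add: eval_nat_numeral)
    have e': "- (p - 1) - of_nat 0 = 1 - p" "- (p - 1) - of_nat 1 = - p" by auto
    have t: "of_nat n powr (- (p - 1) - of_nat 0) = B" "of_nat n powr (- (p - 1) - of_nat 1) = A"
      "of_nat n powr (- (p - 1) - of_nat 2) = C" "of_nat (Suc n) powr (- (p - 1)) = E"
      unfolding ABC e' e(2) by (simp_all only: e(3))
    have "pochhammer (p - 1) 2 = (p - 1) * p"
      by (simp add: numeral_2_eq_2 pochhammer_Suc)
    then show ?thesis
      unfolding powr_taylor_rem_def s3 t by simp (simp add: algebra_simps)
  qed
  moreover have "(D - A + p * C) / 2 - (E - B + (p - 1) * A - (p - 1) * p / 2 * C) / (1 - p)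
      = (A + D) / 2 - (E - B) / (1 - p)"
  proof -
    have "(E - B + (p - 1) * A - (p - 1) * p / 2 * C) / (1 - p) = (E - B) / (1 - p) - A + p / 2 * C"
      using assms by (simp add: field_simps)
    moreover have "(D - A + p * C) / 2 - (q - A + p / 2 * C) = (A + D) / 2 - q" for q
      by (simp add: field_simps)
    ultimately show ?thesis by (simp only:)
  qed
  ultimately show ?thesis
    unfolding powr_trapezoid_error_def ABC[symmetric] by simp
qed

lemma sum_powr_trapezoid_error:
  assumes "p \<noteq> 1"
  shows "(\<Sum>n<N. powr_trapezoid_error p (Suc n)) =
     (\<Sum>n<Suc N. of_nat (Suc n) powr (-p)) - of_nat (Suc N) powr (1 - p) / (1 - p)
       - of_nat (Suc N) powr (-p) / 2 - (1 / 2 - 1 / (1 - p))"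
proof (induction N)
  case (Suc N)
  show ?case
    unfolding sum.lessThan_Suc[of _ N] Suc.IH
    unfolding powr_trapezoid_error_eq[OF assms] sum.lessThan_Suc[of _ "Suc N"]
    by (simp add: diff_divide_distrib add_divide_distrib del: of_nat_Suc)
qed auto

lemma summable_powr_trapezoid_error:
  assumes "Re p > -1"
  shows "summable (\<lambda>n. powr_trapezoid_error p (Suc n))"
  using assms unfolding powr_trapezoid_error_def
  by (intro summable_diff summable_divide summable_powr_taylor_rem) auto

text \<open>For Re p > 1 the boundary terms of the telescoped sum tend to 0 and the formula is the
  Dirichlet series. Both sides are holomorphic for Re p > -1 away from 1, so the identity theorem
  carries it to the left.\<close>

lemma riemann_zeta_eq_suminf:
  assumes "Re p > -1" "p \<noteq> 1"
  shows "riemann_zeta p = 1 / 2 - 1 / (1 - p) + (\<Sum>n. powr_trapezoid_error p (Suc n))"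
proof (rule analytic_continuation_open[where s = "{z. Re z > 1}" and s' = "{z. Re z > -1} - {1}" and f = riemann_zeta])
  show "connected ({z. Re z > -1} - {1 :: complex})"
    by (intro connected_open_delete convex_connected convex_halfspace_Re_gt open_halfspace_Re_gt) auto
  show "({z. Re z > 1} :: complex set) \<noteq> {}" by (auto intro: exI[of _ 2])
  show "riemann_zeta holomorphic_on {z. Re z > -1} - {1}"
    by (rule holomorphic_on_subset[OF holomorphic_riemann_zeta]) auto
  have sub: "(\<lambda>w. \<Sum>n. powr_taylor_rem 2 w (Suc n)) holomorphic_on {z. Re z > -1} - {1}"
    by (rule holomorphic_on_subset[OF holomorphic_suminf_powr_taylor_rem]) auto
  have "((\<lambda>w. \<Sum>n. powr_taylor_rem 3 w (Suc n)) \<circ> (\<lambda>z. z - 1)) holomorphic_on {z. Re z > -1} - {1}"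
    by (intro holomorphic_on_compose_gen[OF _ holomorphic_suminf_powr_taylor_rem] holomorphic_intros) auto
  with sub have "(\<lambda>p. 1 / 2 - 1 / (1 - p) + ((\<Sum>n. powr_taylor_rem 2 p (Suc n)) / 2
      - (\<Sum>n. powr_taylor_rem 3 (p - 1) (Suc n)) / (1 - p))) holomorphic_on {z. Re z > -1} - {1}"
    unfolding o_def by (intro holomorphic_intros) auto
  then show "(\<lambda>p. 1 / 2 - 1 / (1 - p) + (\<Sum>n. powr_trapezoid_error p (Suc n)))
      holomorphic_on {z. Re z > -1} - {1}"
  proof (rule holomorphic_transform)
    fix p :: complex assume p: "p \<in> {z. Re z > -1} - {1}"
    then have "summable (\<lambda>n. powr_taylor_rem 2 p (Suc n))" "summable (\<lambda>n. powr_taylor_rem 3 (p - 1) (Suc n))"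
      by (auto intro!: summable_powr_taylor_rem)
    then show "1 / 2 - 1 / (1 - p) + ((\<Sum>n. powr_taylor_rem 2 p (Suc n)) / 2
      - (\<Sum>n. powr_taylor_rem 3 (p - 1) (Suc n)) / (1 - p))
      = 1 / 2 - 1 / (1 - p) + (\<Sum>n. powr_trapezoid_error p (Suc n))"
      by (simp add: powr_trapezoid_error_def suminf_diff[symmetric] suminf_divide summable_divide)
  qed
  fix z :: complex assume "z \<in> {z. Re z > 1}"
  then have z: "Re z > 1" "z \<noteq> 1" by auto
  have "(\<lambda>n. of_nat (Suc n) powr (-z)) sums riemann_zeta z"
    using sums_riemann_zeta[OF z(1)] by (simp add: powr_minus_divide)
  then have "(\<lambda>N. \<Sum>n<Suc N. of_nat (Suc n) powr (-z)) \<longlonglongrightarrow> riemann_zeta z"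
    unfolding sums_def by (rule LIMSEQ_Suc)
  then have "(\<lambda>N. (\<Sum>n<Suc N. of_nat (Suc n) powr (-z)) - of_nat (Suc N) powr (1 - z) / (1 - z)
       - of_nat (Suc N) powr (-z) / 2 - (1 / 2 - 1 / (1 - z))) \<longlonglongrightarrow>
       riemann_zeta z - 0 / (1 - z) - 0 / 2 - (1 / 2 - 1 / (1 - z))"
    using z by (intro tendsto_intros tendsto_of_nat_powr_0) auto
  then have "(\<lambda>n. powr_trapezoid_error z (Suc n)) sums (riemann_zeta z - (1 / 2 - 1 / (1 - z)))"
    unfolding sums_def sum_powr_trapezoid_error[OF z(2)] by simp
  then show "riemann_zeta z = 1 / 2 - 1 / (1 - z) + (\<Sum>n. powr_trapezoid_error z (Suc n))"
    by (simp add: sums_iff)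
qed (use assms in \<open>auto simp: open_halfspace_Re_gt intro!: open_delete\<close>)

text \<open>The last term of the sum is taken with weight \<open>1/2\<close>, so that the increments in \<open>m\<close> are
  trapezoidal rules for \<open>x\<^sup>-\<^sup>p\<close>.\<close>

definition zeta_remainder :: "real \<Rightarrow> nat \<Rightarrow> real" where
  "zeta_remainder p m = (\<Sum>k=1..m. real k powr (-p)) - zeta p - real m powr (-p) / 2"

lemma zeta_remainder_Suc:
  assumes "m > 0"
  shows "zeta_remainder p (Suc m) = zeta_remainder p m + (real m powr (-p) + real (Suc m) powr (-p)) / 2"
  by (simp add: zeta_remainder_def add_divide_distrib)

text \<open>The zeta value is the constant term of the expansion of the partial sums of k^-p, also
  where the series diverges. Halving the last summand absorbs the m^-p term, so that for p > -1 only
  the power m^(1 - p) has to be subtracted.\<close>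

lemma zeta_remainder_tendsto:
  assumes p: "p > -1" "p \<noteq> 1"
  shows "(\<lambda>m. zeta_remainder p m - real m powr (1 - p) / (1 - p)) \<longlonglongrightarrow> 0"
proof (rule LIMSEQ_imp_Suc)
  have p': "Re (of_real p) > -1" "complex_of_real p \<noteq> 1" using p by auto
  have "(\<lambda>N. \<Sum>n<N. powr_trapezoid_error (of_real p) (Suc n)) \<longlonglongrightarrow> (\<Sum>n. powr_trapezoid_error (of_real p) (Suc n))"
    using summable_powr_trapezoid_error[OF p'(1)] by (rule summable_LIMSEQ)
  then have "(\<lambda>N. (\<Sum>n<N. powr_trapezoid_error (of_real p) (Suc n)) + (1 / 2 - 1 / (1 - of_real p))
       - riemann_zeta (of_real p)) \<longlonglongrightarrow>
       (\<Sum>n. powr_trapezoid_error (of_real p) (Suc n)) + (1 / 2 - 1 / (1 - of_real p))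
       - riemann_zeta (of_real p)"
    by (intro tendsto_intros)
  moreover have "(\<Sum>n<N. powr_trapezoid_error (of_real p) (Suc n)) + (1 / 2 - 1 / (1 - of_real p))
       - riemann_zeta (of_real p) =
     of_real ((\<Sum>k=1..Suc N. real k powr (-p)) - real (Suc N) powr (-p) / 2
       - real (Suc N) powr (1 - p) / (1 - p)) - riemann_zeta (of_real p)" for N
  proof -
    have e: "of_nat (Suc n) powr (of_real q) = complex_of_real (real (Suc n) powr q)" for n q
      by (metis of_nat_0_le_iff of_real_of_nat_eq powr_of_real)
    have s: "(\<Sum>n<Suc N. of_nat (Suc n) powr (- complex_of_real p)) = of_real (\<Sum>k=1..Suc N. real k powr (-p))"
      unfolding of_real_sum using e[of _ "-p"]
      by (intro sum.reindex_bij_witness[of _ "\<lambda>k. k - 1" Suc]) auto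
    show ?thesis
      unfolding sum_powr_trapezoid_error[OF p'(2)] s
      using e[of N "-p"] e[of N "1 - p"] by (simp del: of_nat_Suc)
  qed
  ultimately have "(\<lambda>N. of_real ((\<Sum>k=1..Suc N. real k powr (-p)) - real (Suc N) powr (-p) / 2
       - real (Suc N) powr (1 - p) / (1 - p)) - riemann_zeta (of_real p)) \<longlonglongrightarrow> 0"
    by (simp only: riemann_zeta_eq_suminf[OF p'] add.commute diff_self)
  from tendsto_Re[OF this]
  have "(\<lambda>N. (\<Sum>k=1..Suc N. real k powr (-p)) - real (Suc N) powr (-p) / 2
       - real (Suc N) powr (1 - p) / (1 - p) - zeta p) \<longlonglongrightarrow> 0"
    by (simp only: zeta_def minus_complex.sel Re_complex_of_real zero_complex.sel)
  moreover have "(\<Sum>k=1..Suc N. real k powr (-p)) - real (Suc N) powr (-p) / 2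
       - real (Suc N) powr (1 - p) / (1 - p) - zeta p
     = zeta_remainder p (Suc N) - real (Suc N) powr (1 - p) / (1 - p)" for N
    by (simp add: zeta_remainder_def)
  ultimately show "(\<lambda>N. zeta_remainder p (Suc N) - real (Suc N) powr (1 - p) / (1 - p)) \<longlonglongrightarrow> 0"
    by (simp only:)
qed

section \<open>Two-sided bounds for regularized power sums and for zeta\<close>

text \<open>The step from m to m + 1 is the trapezoidal error of x^-p. Whether x^-p is convex or
  concave is decided by the sign of p * (p + 1), and the concave case is the convex one for
  -x^-p.\<close>

lemma zeta_remainder_step_bounds:
  assumes p: "p \<noteq> 1" and m: "m > 0"
  defines "u \<equiv> \<lambda>m. zeta_remainder p m - real m powr (1 - p) / (1 - p)"
  shows "p * (p + 1) \<ge> 0 \<Longrightarrow> u m \<le> u (Suc m)"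
    and "p * (p + 1) \<ge> 0 \<Longrightarrow> u (Suc m) \<le> u m + p / 8 * (real m powr (-p - 1) - real (Suc m) powr (-p - 1))"
    and "p * (p + 1) \<le> 0 \<Longrightarrow> u (Suc m) \<le> u m"
    and "p * (p + 1) \<le> 0 \<Longrightarrow> u m + p / 8 * (real m powr (-p - 1) - real (Suc m) powr (-p - 1)) \<le> u (Suc m)"
proof -
  have u: "u (Suc m) = u m + (real m powr (-p) + real (Suc m) powr (-p)) / 2
      - (real (Suc m) powr (1 - p) / (1 - p) - real m powr (1 - p) / (1 - p))"
    using m by (simp add: u_def zeta_remainder_Suc)
  \<comment> \<open>The factor c stands for a sign, 1 in the convex and -1 in the concave case, so
    that one derivation serves both.\<close>
  have d: "((\<lambda>x. c * (x powr (1 - p) / (1 - p))) has_real_derivative c * x powr (-p)) (at x)"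
    "((\<lambda>x. c * x powr (-p)) has_real_derivative c * (-p * x powr (-p - 1))) (at x)"
    "((\<lambda>x. c * (-p * x powr (-p - 1))) has_real_derivative c * (p * (p + 1) * x powr (-p - 2))) (at x)"
    if "x \<ge> real m" for c x
  proof -
    have x: "x > 0" using that m by linarith
    have "((\<lambda>x. c * (x powr (1 - p) / (1 - p))) has_real_derivative
        c * ((1 - p) * x powr (1 - p - 1) / (1 - p))) (at x)"
      "((\<lambda>x. c * x powr (-p)) has_real_derivative c * (-p * x powr (-p - 1))) (at x)"
      "((\<lambda>x. c * (-p * x powr (-p - 1))) has_real_derivative c * (-p * ((-p - 1) * x powr (-p - 1 - 1)))) (at x)"
      by (intro DERIV_cmult DERIV_cdivide has_real_derivative_powr x)+
    moreover have "-p - 1 - 1 = -p - 2" "- p * ((- p - 1) * x powr (- p - 2)) = p * (p + 1) * x powr (-p - 2)"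
      "(1 - p) * x powr (1 - p - 1) / (1 - p) = x powr (-p)"
      using p by (simp_all add: algebra_simps) (simp add: field_simps)
    ultimately show "((\<lambda>x. c * (x powr (1 - p) / (1 - p))) has_real_derivative c * x powr (-p)) (at x)"
      "((\<lambda>x. c * x powr (-p)) has_real_derivative c * (-p * x powr (-p - 1))) (at x)"
      "((\<lambda>x. c * (-p * x powr (-p - 1))) has_real_derivative c * (p * (p + 1) * x powr (-p - 2))) (at x)"
      by (simp_all only:)
  qed
  have *: "c * (real (Suc m) powr (1 - p) / (1 - p)) - c * (real m powr (1 - p) / (1 - p))
      \<le> (c * real m powr (-p) + c * real (Suc m) powr (-p)) / 2"
    "(c * real m powr (-p) + c * real (Suc m) powr (-p)) / 2 \<le> c * (real (Suc m) powr (1 - p) / (1 - p))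
        - c * (real m powr (1 - p) / (1 - p)) + (c * (-p * real (Suc m) powr (-p - 1)) - c * (-p * real m powr (-p - 1))) / 8"
    if c: "c * (p * (p + 1)) \<ge> 0" for c
  proof -
    have nn: "c * (p * (p + 1) * x powr (-p - 2)) \<ge> 0" for x
      using mult_nonneg_nonneg[OF c powr_ge_zero[of x "-p - 2"]] by (simp add: mult_ac)
    show "c * (real (Suc m) powr (1 - p) / (1 - p)) - c * (real m powr (1 - p) / (1 - p))
      \<le> (c * real m powr (-p) + c * real (Suc m) powr (-p)) / 2"
    "(c * real m powr (-p) + c * real (Suc m) powr (-p)) / 2 \<le> c * (real (Suc m) powr (1 - p) / (1 - p))
        - c * (real m powr (1 - p) / (1 - p)) + (c * (-p * real (Suc m) powr (-p - 1)) - c * (-p * real m powr (-p - 1))) / 8"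
      using trapezoid_rule_convex[of "real m", OF d(1)[of _ c] d(2)[of _ c] d(3)[of _ c] nn] by (simp_all add: add.commute)
  qed
  have up: "U + x - (y - z) \<le> U + p / 8 * (a - b)" if "x \<le> y - z + (-p * b - -p * a) / 8" for U x y z a b
    using that by (simp add: right_diff_distrib diff_divide_distrib)
  have down: "U + p / 8 * (a - b) \<le> U + (x1 + x2) / 2 - (y - z)"
    if "(-1 * x1 + -1 * x2) / 2 \<le> -1 * y - -1 * z + (-1 * (-p * b) - -1 * (-p * a)) / 8" for U x1 x2 y z a b
    using that by (simp add: right_diff_distrib add_divide_distrib diff_divide_distrib)
  have down0: "U + (x1 + x2) / 2 - (y - z) \<le> U" if "-1 * y - -1 * z \<le> (-1 * x1 + -1 * x2) / 2"
    for U x1 x2 y z :: real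
    using that by (simp add: field_simps)
  have neg: "-1 * (p * (p + 1)) \<ge> 0" if "p * (p + 1) \<le> 0"
    using that by simp
  show "u m \<le> u (Suc m)" if "p * (p + 1) \<ge> 0"
    using *(1)[of 1, unfolded mult_1, OF that] unfolding u by linarith
  show "u (Suc m) \<le> u m + p / 8 * (real m powr (-p - 1) - real (Suc m) powr (-p - 1))" if "p * (p + 1) \<ge> 0"
    unfolding u by (rule up[OF *(2)[of 1, unfolded mult_1, OF that]])
  show "u (Suc m) \<le> u m" if "p * (p + 1) \<le> 0"
    unfolding u by (rule down0[OF *(1)[OF neg[OF that]]])
  show "u m + p / 8 * (real m powr (-p - 1) - real (Suc m) powr (-p - 1)) \<le> u (Suc m)" if "p * (p + 1) \<le> 0"
    unfolding u by (rule down[OF *(2)[OF neg[OF that]]])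
qed

text \<open>For p \<ge> 0 the sequence \<open>u\<close> increases to 0, while \<open>u\<close> plus
  p / 8 * m^(-p - 1) decreases to 0; this encloses \<open>u\<close>. For -1 < p \<le> 0 both
  directions are reversed.\<close>

lemma zeta_remainder_bounds:
  assumes p: "p > -1" "p \<noteq> 1" and m: "m > 0"
  defines "u \<equiv> \<lambda>m. zeta_remainder p m - real m powr (1 - p) / (1 - p)"
  shows "p \<ge> 0 \<Longrightarrow> u m \<le> 0" "p \<ge> 0 \<Longrightarrow> - (p / 8 * real m powr (-p - 1)) \<le> u m"
    and "p \<le> 0 \<Longrightarrow> u m \<ge> 0" "p \<le> 0 \<Longrightarrow> u m \<le> - (p / 8 * real m powr (-p - 1))"
proof -
  define v where "v = (\<lambda>m. u m + p / 8 * real m powr (-p - 1))"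
  have u: "(\<lambda>n. u (Suc n)) \<longlonglongrightarrow> 0"
    unfolding u_def by (rule LIMSEQ_Suc[OF zeta_remainder_tendsto[OF p]])
  have "(\<lambda>n. real n powr (-p - 1)) \<longlonglongrightarrow> 0"
    using p by real_asymp
  then have "(\<lambda>n. p / 8 * real (Suc n) powr (-p - 1)) \<longlonglongrightarrow> p / 8 * 0"
    by (intro tendsto_intros LIMSEQ_Suc)
  from tendsto_add[OF u this] have v: "(\<lambda>n. v (Suc n)) \<longlonglongrightarrow> 0"
    by (simp add: v_def)
  obtain k where k: "m = Suc k" using m by (cases m) auto
  have u_eq: "u m = zeta_remainder p m - real m powr (1 - p) / (1 - p)" for m
    by (simp add: u_def)
  note steps = zeta_remainder_step_bounds[OF p(2), folded u_eq]
  {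
    assume "p \<ge> 0"
    then have "p * (p + 1) \<ge> 0" by simp
    note s = steps(1,2)[OF _ this]
    have "incseq (\<lambda>n. u (Suc n))" "decseq (\<lambda>n. v (Suc n))"
      using s by (auto intro!: incseq_SucI decseq_SucI simp: v_def algebra_simps simp del: of_nat_Suc)
    then show "u m \<le> 0" "- (p / 8 * real m powr (-p - 1)) \<le> u m"
      using incseq_le[OF _ u, of k] decseq_ge[OF _ v, of k] by (auto simp: k v_def)
  }
  {
    assume "p \<le> 0"
    then have "p * (p + 1) \<le> 0" using p by (simp add: mult_nonpos_nonneg)
    note s = steps(3,4)[OF _ this]
    have "decseq (\<lambda>n. u (Suc n))" "incseq (\<lambda>n. v (Suc n))"
      using s by (auto intro!: incseq_SucI decseq_SucI simp: v_def algebra_simps simp del: of_nat_Suc)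
    then show "u m \<ge> 0" "u m \<le> - (p / 8 * real m powr (-p - 1))"
      using decseq_ge[OF _ u, of k] incseq_le[OF _ v, of k] by (auto simp: k v_def)
  }
qed

lemma zeta_remainder_bigo:
  assumes "p > -1" "p \<noteq> 1"
  shows "(\<lambda>m. zeta_remainder p m - real m powr (1 - p) / (1 - p)) \<in> O(\<lambda>m. real m powr (-p - 1))"
proof (rule bigoI[where c = "\<bar>p\<bar> / 8"])
  have "norm (zeta_remainder p m - real m powr (1 - p) / (1 - p)) \<le> \<bar>p\<bar> / 8 * norm (real m powr (-p - 1))"
    if "m > 0" for m
    using zeta_remainder_bounds[OF assms that] by (cases "p \<ge> 0") (auto simp: abs_if)
  then show "\<forall>\<^sub>F m in sequentially. norm (zeta_remainder p m - real m powr (1 - p) / (1 - p)) \<le> \<bar>p\<bar> / 8 * norm (real m powr (-p - 1))"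
    using eventually_gt_at_top[of 0] by (rule eventually_mono[rotated])
qed

text \<open>This is the case m = 1, where the remainder is 1/2 - \<zeta>(p). The explicit bounds
  later decide the signs of the zeta values in the optimal shifts.\<close>

lemma zeta_bounds:
  assumes "p > -1" "p \<noteq> 1"
  shows "p \<ge> 0 \<Longrightarrow> zeta p \<ge> 1 / 2 - 1 / (1 - p)" "p \<ge> 0 \<Longrightarrow> zeta p \<le> 1 / 2 - 1 / (1 - p) + p / 8"
    and "p \<le> 0 \<Longrightarrow> zeta p \<le> 1 / 2 - 1 / (1 - p)" "p \<le> 0 \<Longrightarrow> zeta p \<ge> 1 / 2 - 1 / (1 - p) + p / 8"
  using zeta_remainder_bounds[OF assms, of 1] by (auto simp: zeta_remainder_def)

section \<open>Peano kernels\<close>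

lemma Gamma_shifts:
  fixes \<alpha> :: real
  assumes "0 < \<alpha>" "\<alpha> < 1"
  shows "Gamma (1 - \<alpha>) > 0" "Gamma (2 - \<alpha>) > 0"
    and "Gamma (1 - \<alpha>) = - \<alpha> * Gamma (- \<alpha>)"
    and "Gamma (2 - \<alpha>) = (1 - \<alpha>) * Gamma (1 - \<alpha>)"
    and "Gamma (3 - \<alpha>) = (2 - \<alpha>) * Gamma (2 - \<alpha>)"
proof -
  have "1 - \<alpha> \<notin> \<int>\<^sub>\<le>\<^sub>0" "2 - \<alpha> \<notin> \<int>\<^sub>\<le>\<^sub>0"
    using assms nonpos_Ints_nonpos[of "1 - \<alpha>"] nonpos_Ints_nonpos[of "2 - \<alpha>"] by linarith+
  moreover have "- \<alpha> \<notin> \<int>\<^sub>\<le>\<^sub>0"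
  proof
    assume "- \<alpha> \<in> \<int>\<^sub>\<le>\<^sub>0"
    then obtain k where "- \<alpha> = of_int k" by (auto elim!: nonpos_Ints_cases)
    then have "real_of_int (-1) < of_int k" "of_int k < real_of_int 0" using assms by auto
    then have "-1 < k" "k < 0" by (simp_all only: of_int_less_iff)
    then show False by linarith
  qed
  ultimately show "Gamma (1 - \<alpha>) = - \<alpha> * Gamma (- \<alpha>)" "Gamma (2 - \<alpha>) = (1 - \<alpha>) * Gamma (1 - \<alpha>)"
    "Gamma (3 - \<alpha>) = (2 - \<alpha>) * Gamma (2 - \<alpha>)"
    using Gamma_plus1[of "- \<alpha>"] Gamma_plus1[of "1 - \<alpha>"] Gamma_plus1[of "2 - \<alpha>"]
    by (simp_all add: add.commute)
  show "Gamma (1 - \<alpha>) > 0" "Gamma (2 - \<alpha>) > 0"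
    by (rule Gamma_real_pos; use assms in linarith)+
qed

section \<open>Integral representations of y and of its Caputo derivative\<close>

lemma has_integral_extend_by_zero:
  fixes f :: "real \<Rightarrow> real"
  assumes "(f has_integral I) {0..x}" "0 \<le> x" "x \<le> U" "\<And>z. x \<le> z \<Longrightarrow> z \<le> U \<Longrightarrow> f z = 0"
  shows "(f has_integral I) {0..U}"
  using has_integral_combine[OF assms(2,3,1) has_integral_is_0[of "{x..U}" f]] assms(4) by simp

text \<open>The end T may lie beyond the time t of a scheme: for a negative shift the Caputo
  derivative is evaluated to the right of t.\<close>

locale vanishing_C2 =
  fixes y y1 y2 :: "real \<Rightarrow> real" and T :: real
  assumes y_deriv: "\<And>x. x \<in> {0..T} \<Longrightarrow> (y has_real_derivative y1 x) (at x within {0..T})"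
    and y1_deriv: "\<And>x. x \<in> {0..T} \<Longrightarrow> (y1 has_real_derivative y2 x) (at x within {0..T})"
    and y2_cont: "continuous_on {0..T} y2"
    and y_0: "y 0 = 0" and y1_0: "y1 0 = 0"
begin

text \<open>Taylor's formula at 0 with integral remainder, whose polynomial part vanishes by the
  initial conditions. The truncated factor extends the integral to a common interval [0, U], so that
  all nodes can be combined under one integral.\<close>

lemma has_integral_taylor_kernel:
  assumes "0 \<le> x" "x \<le> U" "U \<le> T"
  shows "((\<lambda>z. max 0 (x - z) * y2 z) has_integral y x) {0..U}"
proof (rule has_integral_extend_by_zero)
  have "((\<lambda>z. (x - z) * y2 z) has_integral ((x - x) * y1 x + y x) - ((x - 0) * y1 0 + y 0)) {0..x}"
  proof (rule fundamental_theorem_of_calculus)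
    fix z assume z: "z \<in> {0..x}"
    have "((\<lambda>z. (x - z) * y1 z + y z) has_real_derivative (x - z) * y2 z) (at z within {0..T})"
      using z assms y_deriv[of z] y1_deriv[of z]
      by (auto intro!: derivative_eq_intros)
    then have "((\<lambda>z. (x - z) * y1 z + y z) has_real_derivative (x - z) * y2 z) (at z within {0..x})"
      by (rule DERIV_subset) (use assms in auto)
    then show "((\<lambda>z. (x - z) * y1 z + y z) has_vector_derivative (x - z) * y2 z) (at z within {0..x})"
      by (simp add: has_real_derivative_iff_has_vector_derivative)
  qed fact
  then have "((\<lambda>z. (x - z) * y2 z) has_integral y x) {0..x}" by (simp add: y_0 y1_0)
  then show "((\<lambda>z. max 0 (x - z) * y2 z) has_integral y x) {0..x}"
    by (rule has_integral_eq[rotated]) auto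
qed (use assms in auto)

lemma y1_cont: "continuous_on {0..T} y1"
  using y1_deriv DERIV_continuous_on by blast

lemma deriv_eq:
  assumes "0 < x" "x < T"
  shows "deriv y x = y1 x"
  using y_deriv[of x] assms by (intro DERIV_imp_deriv) (auto simp: at_within_Icc_at)

text \<open>Integration by parts against (\<tau> - z)^(1 - \<alpha>): the boundary term vanishes at
  \<tau> because the exponent is positive, and at 0 because \<open>y1 0 = 0\<close>. Integrability
  of the singular integrand is a by-product, since it is a difference of two integrable
  functions.\<close>

lemma has_integral_caputo_kernel:
  assumes \<alpha>: "0 < \<alpha>" "\<alpha> < 1" and \<tau>: "0 \<le> \<tau>" "\<tau> \<le> U" "U \<le> T"
  shows "((\<lambda>z. max 0 (\<tau> - z) powr (1 - \<alpha>) * y2 z) has_integral Gamma (2 - \<alpha>) * caputo \<alpha> y \<tau>) {0..U}"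
proof (rule has_integral_extend_by_zero)
  have sub: "{0..\<tau>} \<subseteq> {0..T}" using \<tau> by auto
  have cont: "continuous_on {0..\<tau>} (\<lambda>z. (\<tau> - z) powr (1 - \<alpha>))"
    using \<alpha> by (intro continuous_on_powr' continuous_intros) auto
  define J where "J = integral {0..\<tau>} (\<lambda>z. (\<tau> - z) powr (1 - \<alpha>) * y2 z)"
  have J: "((\<lambda>z. (\<tau> - z) powr (1 - \<alpha>) * y2 z) has_integral J) {0..\<tau>}"
    unfolding J_def
    by (intro integrable_integral integrable_continuous_interval continuous_on_mult cont
          continuous_on_subset[OF y2_cont sub])
  have "((\<lambda>z. (\<tau> - z) powr (1 - \<alpha>) * y2 z - (1 - \<alpha>) * (y1 z / (\<tau> - z) powr \<alpha>))
     has_integral (\<tau> - \<tau>) powr (1 - \<alpha>) * y1 \<tau> - (\<tau> - 0) powr (1 - \<alpha>) * y1 0) {0..\<tau>}"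
  \<comment> \<open>At \<tau> the antiderivative is continuous but need not be differentiable, so
    derivatives are used in the interior only.\<close>
  proof (rule fundamental_theorem_of_calculus_interior)
    show "continuous_on {0..\<tau>} (\<lambda>z. (\<tau> - z) powr (1 - \<alpha>) * y1 z)"
      by (intro continuous_on_mult cont continuous_on_subset[OF y1_cont sub])
    fix z assume z: "z \<in> {0<..<\<tau>}"
    then have "(y1 has_real_derivative y2 z) (at z)"
      using y1_deriv[of z] \<tau> by (auto simp: at_within_Icc_at)
    moreover have "((\<lambda>z. (\<tau> - z) powr (1 - \<alpha>)) has_real_derivative - ((1 - \<alpha>) / (\<tau> - z) powr \<alpha>)) (at z)"
    proof -
      have "((\<lambda>u. (\<tau> - u) powr (1 - \<alpha>)) has_real_derivative (1 - \<alpha>) * (\<tau> - z) powr (1 - \<alpha> - 1) * (0 - 1)) (at z)"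
        by (rule DERIV_chain2[OF has_real_derivative_powr]) (use z in \<open>auto intro!: derivative_eq_intros\<close>)
      then show ?thesis by (simp add: powr_minus_divide)
    qed
    ultimately have "((\<lambda>z. (\<tau> - z) powr (1 - \<alpha>) * y1 z) has_real_derivative
        - ((1 - \<alpha>) / (\<tau> - z) powr \<alpha>) * y1 z + y2 z * (\<tau> - z) powr (1 - \<alpha>)) (at z)"
      by (intro DERIV_mult)
    then show "((\<lambda>z. (\<tau> - z) powr (1 - \<alpha>) * y1 z) has_vector_derivative
       (\<tau> - z) powr (1 - \<alpha>) * y2 z - (1 - \<alpha>) * (y1 z / (\<tau> - z) powr \<alpha>)) (at z)"
      by (simp add: has_real_derivative_iff_has_vector_derivative mult_ac)
  qed fact
  from has_integral_diff[OF J this] have "((\<lambda>z. (1 - \<alpha>) * (y1 z / (\<tau> - z) powr \<alpha>)) has_integral J) {0..\<tau>}"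
    using \<alpha> by (simp add: y1_0)
  from has_integral_mult_right[OF this, of "1 / (1 - \<alpha>)"] have
    "((\<lambda>z. y1 z / (\<tau> - z) powr \<alpha>) has_integral J / (1 - \<alpha>)) {0..\<tau>}"
    using \<alpha> by simp
  \<comment> \<open>The two-sided \<open>deriv y\<close> may differ from \<open>y1\<close> at the
    two end points.\<close>
  moreover have "((\<lambda>z. deriv y z / (\<tau> - z) powr \<alpha>) has_integral J / (1 - \<alpha>)) {0..\<tau>} \<longleftrightarrow>
    ((\<lambda>z. y1 z / (\<tau> - z) powr \<alpha>) has_integral J / (1 - \<alpha>)) {0..\<tau>}"
    using \<tau> by (intro has_integral_spike_finite_eq[of "{0, \<tau>}"]) (auto simp: deriv_eq)
  ultimately have "caputo \<alpha> y \<tau> = 1 / Gamma (1 - \<alpha>) * (J / (1 - \<alpha>))"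
    unfolding caputo_def by (simp add: integral_unique)
  then have "Gamma (2 - \<alpha>) * caputo \<alpha> y \<tau> = J"
    using \<alpha> Gamma_shifts(4)[OF \<alpha>] less_imp_neq[OF Gamma_shifts(1)[OF \<alpha>]] by simp
  then have "((\<lambda>z. (\<tau> - z) powr (1 - \<alpha>) * y2 z) has_integral Gamma (2 - \<alpha>) * caputo \<alpha> y \<tau>) {0..\<tau>}"
    using J by simp
  then show "((\<lambda>z. max 0 (\<tau> - z) powr (1 - \<alpha>) * y2 z) has_integral Gamma (2 - \<alpha>) * caputo \<alpha> y \<tau>) {0..\<tau>}"
    by (rule has_integral_eq[rotated]) auto
qed (use \<alpha> \<tau> in auto)

end

text \<open>The kernel is written in units of the step size, \<open>v = (t - z) / h\<close>; for \<open>v \<le> n\<close> it does not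
  depend on \<open>n\<close>.\<close>

definition peano_kernel :: "real \<Rightarrow> real \<Rightarrow> real \<Rightarrow> (nat \<Rightarrow> real) \<Rightarrow> nat \<Rightarrow> real \<Rightarrow> real" where
  "peano_kernel \<alpha> c s \<omega> n v =
     c * (\<Sum>k<n. \<omega> k * max 0 (v - real k)) - max 0 (v - s) powr (1 - \<alpha>) / Gamma (2 - \<alpha>)"

text \<open>In the variable v every truncated power gives a factor h, which turns h^-\<alpha> into
  h^(1 - \<alpha>), and the Caputo kernel gives the same h^(1 - \<alpha>). The interval has to reach
  both n h and the shifted point (n - s) h.\<close>

lemma (in vanishing_C2) has_integral_peano_kernel:
  assumes \<alpha>: "0 < \<alpha>" "\<alpha> < 1" and h: "h > 0"
    and \<tau>: "0 \<le> (real n - s) * h" "(real n - s) * h \<le> U" "real n * h \<le> U" "U \<le> T"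
  shows "((\<lambda>z. h powr (1 - \<alpha>) * peano_kernel \<alpha> c s \<omega> n ((real n * h - z) / h) * y2 z) has_integral
     c / h powr \<alpha> * (\<Sum>k<n. \<omega> k * y (real (n - k) * h)) - caputo \<alpha> y ((real n - s) * h)) {0..U}"
proof -
  define \<tau> where "\<tau> = (real n - s) * h"
  have G: "Gamma (2 - \<alpha>) \<noteq> 0" using Gamma_shifts(2)[OF \<alpha>] by simp
  have "((\<lambda>z. max 0 (real (n - k) * h - z) * y2 z) has_integral y (real (n - k) * h)) {0..U}" if "k < n" for k
  proof (rule has_integral_taylor_kernel)
    have "real (n - k) * h \<le> real n * h"
      using h by (intro mult_right_mono) auto
    then show "real (n - k) * h \<le> U" using \<tau>(3) by (rule order.trans)
  qed (use assms in auto)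
  then have "((\<lambda>z. \<Sum>k<n. \<omega> k * (max 0 (real (n - k) * h - z) * y2 z)) has_integral
      (\<Sum>k<n. \<omega> k * y (real (n - k) * h))) {0..U}"
    by (intro has_integral_sum has_integral_mult_right) auto
  moreover have "((\<lambda>z. max 0 (\<tau> - z) powr (1 - \<alpha>) * y2 z) has_integral Gamma (2 - \<alpha>) * caputo \<alpha> y \<tau>) {0..U}"
    using assms by (intro has_integral_caputo_kernel) (auto simp: \<tau>_def)
  ultimately have "((\<lambda>z. c / h powr \<alpha> * (\<Sum>k<n. \<omega> k * (max 0 (real (n - k) * h - z) * y2 z))
       - 1 / Gamma (2 - \<alpha>) * (max 0 (\<tau> - z) powr (1 - \<alpha>) * y2 z))
     has_integral c / h powr \<alpha> * (\<Sum>k<n. \<omega> k * y (real (n - k) * h))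
       - 1 / Gamma (2 - \<alpha>) * (Gamma (2 - \<alpha>) * caputo \<alpha> y \<tau>)) {0..U}"
    by (intro has_integral_diff has_integral_mult_right)
  moreover have "c / h powr \<alpha> * (\<Sum>k<n. \<omega> k * (max 0 (real (n - k) * h - z) * y2 z))
       - 1 / Gamma (2 - \<alpha>) * (max 0 (\<tau> - z) powr (1 - \<alpha>) * y2 z)
     = h powr (1 - \<alpha>) * peano_kernel \<alpha> c s \<omega> n ((real n * h - z) / h) * y2 z" for z
  proof -
    have hmax: "max 0 (h * x) = h * max 0 x" for x
      using h by (simp add: max_mult_distrib_left)
    have "max 0 (real (n - k) * h - z) = h * max 0 ((real n * h - z) / h - real k)" if "k < n" for k
    proof -
      have "real (n - k) * h - z = h * ((real n * h - z) / h - real k)"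
        using h that by (simp add: field_simps of_nat_diff)
      then show ?thesis by (simp only: hmax)
    qed
    then have "(\<Sum>k<n. \<omega> k * (max 0 (real (n - k) * h - z) * y2 z)) =
        h * y2 z * (\<Sum>k<n. \<omega> k * max 0 ((real n * h - z) / h - real k))"
      by (simp add: sum_distrib_left mult_ac)
    moreover have "max 0 (\<tau> - z) powr (1 - \<alpha>) = h powr (1 - \<alpha>) * max 0 ((real n * h - z) / h - s) powr (1 - \<alpha>)"
    proof -
      have "\<tau> - z = h * ((real n * h - z) / h - s)"
        using h by (simp add: \<tau>_def field_simps)
      then show ?thesis by (simp only: hmax powr_mult)
    qed
    moreover have "h powr (1 - \<alpha>) = h / h powr \<alpha>"
      using h by (simp add: powr_diff)
    ultimately show ?thesis
      unfolding peano_kernel_def by (simp add: algebra_simps)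
  qed
  ultimately show ?thesis using G by (simp add: \<tau>_def)
qed

section \<open>Decay of the kernel and the order 2 - \<alpha>\<close>

lemma peano_kernel_mono_neutral:
  assumes "v \<le> real n" "v \<le> real m"
  shows "peano_kernel \<alpha> c s \<omega> n v = peano_kernel \<alpha> c s \<omega> m v"
proof -
  have *: "(\<Sum>k<min n m. \<omega> k * max 0 (v - real k)) = (\<Sum>k<j. \<omega> k * max 0 (v - real k))"
    if "j = n \<or> j = m" for j
    using that assms by (intro sum.mono_neutral_left) auto
  show ?thesis
    unfolding peano_kernel_def *[of n, OF disjI1[OF refl], symmetric] *[of m, OF disjI2[OF refl], symmetric] ..
qed

text \<open>Both end values are expanded to first order about the interior point a + v. In the
  convex combination the linear terms cancel, and the quadratic remainders add up to at most K * v *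
  (1 - v) with K = a^(q - 2).\<close>

lemma powr_interpolation_error:
  fixes a q v :: real
  assumes a: "a > 0" and q: "0 \<le> q" "q \<le> 1" and v: "0 \<le> v" "v \<le> 1"
  shows "\<bar>(1 - v) * a powr q + v * (a + 1) powr q - (a + v) powr q\<bar> \<le> a powr (q - 2)"
proof -
  define f where "f = (\<lambda>i x. (if i = 0 then x powr q else if i = Suc 0 then q * x powr (q - 1)
      else q * ((q - 1) * x powr (q - 1 - 1)) :: real))"
  have *: "\<bar>x powr q - ((a + v) powr q + q * (a + v) powr (q - 1) * (x - (a + v)))\<bar>
      \<le> a powr (q - 2) * \<bar>x - (a + v)\<bar> ^ 2" if "x \<in> {a..a + 1}" for x
  proof -
    have "norm (f 0 x - (\<Sum>i\<le>1. f i (a + v) * (x - (a + v)) ^ i / fact i))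
        \<le> a powr (q - 2) * norm (x - (a + v)) ^ Suc 1 / fact 1"
    proof (rule field_Taylor[where S = "{a..a + 1}"])
      fix i x assume x: "x \<in> {a..a + 1}" and i: "i \<le> (1 :: nat)"
      then have "x > 0" using a by auto
      then have "((\<lambda>x. x powr q) has_real_derivative q * x powr (q - 1)) (at x)"
        "((\<lambda>x. q * x powr (q - 1)) has_real_derivative q * ((q - 1) * x powr (q - 1 - 1))) (at x)"
        by (intro has_real_derivative_powr DERIV_cmult; simp)+
      then have "(f i has_real_derivative f (Suc i) x) (at x)"
        using i by (cases i) (auto simp: f_def)
      then show "(f i has_real_derivative f (Suc i) x) (at x within {a..a + 1})"
        by (rule has_field_derivative_at_within)
    next
      fix x assume x: "x \<in> {a..a + 1}"
      have "norm (f (Suc 1) x) = (q * (1 - q)) * x powr (q - 2)"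
        using q by (simp add: f_def abs_mult)
      also have "\<dots> \<le> 1 * a powr (q - 2)"
        using q x a by (intro mult_mono powr_mono2') (auto intro: mult_le_one)
      finally show "norm (f (Suc 1) x) \<le> a powr (q - 2)" by simp
    qed (use that v in auto)
    then show ?thesis by (simp add: f_def numeral_2_eq_2)
  qed
  define A B C D where "A = a powr q" and "B = (a + 1) powr q" and "C = (a + v) powr q"
    and "D = q * (a + v) powr (q - 1)"
  define K where "K = a powr (q - 2)"
  have "\<bar>A - (C - D * v)\<bar> \<le> K * v ^ 2" "\<bar>B - (C + D * (1 - v))\<bar> \<le> K * (1 - v) ^ 2"
    using *[of a] *[of "a + 1"] v unfolding A_def B_def C_def D_def K_def by auto
  then have "\<bar>(1 - v) * (A - (C - D * v))\<bar> \<le> (1 - v) * (K * v ^ 2)"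
    "\<bar>v * (B - (C + D * (1 - v)))\<bar> \<le> v * (K * (1 - v) ^ 2)"
    using v by (auto simp: abs_mult intro!: mult_left_mono)
  moreover have "(1 - v) * A + v * B - C = (1 - v) * (A - (C - D * v)) + v * (B - (C + D * (1 - v)))"
    by (simp add: algebra_simps)
  ultimately have "\<bar>(1 - v) * A + v * B - C\<bar> \<le> (1 - v) * (K * v ^ 2) + v * (K * (1 - v) ^ 2)"
    by linarith
  also have "\<dots> = K * (v * (1 - v))" by (simp add: power2_eq_square algebra_simps)
  also have "\<dots> \<le> K * 1"
    using v by (intro mult_left_mono) (auto simp: K_def intro: mult_le_one)
  finally show ?thesis by (simp add: A_def B_def C_def K_def)
qed

lemma powr_shift_bigo:
  fixes q s :: real
  shows "(\<lambda>n. (real n - s) powr q - (real n powr q - s * q * real n powr (q - 1))) \<in> O(\<lambda>n. real n powr (q - 2))"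
proof -
  have "(\<lambda>x::real. (x - s) powr q - (x powr q - s * q * x powr (q - 1))) \<in> O(\<lambda>x. x powr (q - 2))"
    by real_asymp
  from landau_o.big.compose[OF this filterlim_real_sequentially] show ?thesis .
qed

text \<open>For large v the kernel consists of interpolated errors from the asymptotic hypothesis
  and of the interpolation error of (x - s)^(1 - \<alpha>), all of order v^(-1 - \<alpha>); for
  small v it is merely bounded. The base 1 + v - min 0 s is at least 1 on the whole range, including
  the negative v that occur when s < 0.\<close>

lemma peano_kernel_bound:
  assumes \<alpha>: "0 < \<alpha>" "\<alpha> < 1"
    and asym: "(\<lambda>m. c * (\<Sum>k<m. \<omega> k * (real m - real k))
      - (real m powr (1 - \<alpha>) / Gamma (2 - \<alpha>) - s * real m powr (- \<alpha>) / Gamma (1 - \<alpha>)))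
      \<in> O(\<lambda>m. real m powr (-1 - \<alpha>))"
  obtains C where "C \<ge> 0" "\<And>n v. min 0 s \<le> v \<Longrightarrow> v \<le> real n \<Longrightarrow>
     \<bar>peano_kernel \<alpha> c s \<omega> n v\<bar> \<le> C * (1 + v - min 0 s) powr (-1 - \<alpha>)"
proof -
  define G where "G = Gamma (2 - \<alpha>)"
  have G: "G > 0" using Gamma_shifts(2)[OF \<alpha>] by (simp add: G_def)
  define W where "W = (\<lambda>m. \<Sum>k<m. \<omega> k * (real m - real k))"
  define \<Phi> where "\<Phi> = (\<lambda>x. (x - s) powr (1 - \<alpha>) / G)"
  define v0 where "v0 = min 0 s"
  have v0: "v0 \<le> 0" "v0 \<le> s" "- v0 \<le> \<bar>s\<bar>" by (auto simp: v0_def)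
  have "(\<lambda>m. (c * W m - (real m powr (1 - \<alpha>) / G - s * real m powr (- \<alpha>) / Gamma (1 - \<alpha>)))
      - 1 / G * ((real m - s) powr (1 - \<alpha>) - (real m powr (1 - \<alpha>) - s * (1 - \<alpha>) * real m powr (1 - \<alpha> - 1))))
      \<in> O(\<lambda>m. real m powr (-1 - \<alpha>))"
  proof (rule sum_in_bigo(2))
    show "(\<lambda>m. c * W m - (real m powr (1 - \<alpha>) / G - s * real m powr (- \<alpha>) / Gamma (1 - \<alpha>)))
        \<in> O(\<lambda>m. real m powr (-1 - \<alpha>))"
      using asym by (simp only: W_def G_def)
    have e: "1 - \<alpha> - 2 = -1 - \<alpha>" by simp
    show "(\<lambda>m. 1 / G * ((real m - s) powr (1 - \<alpha>) - (real m powr (1 - \<alpha>)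
        - s * (1 - \<alpha>) * real m powr (1 - \<alpha> - 1)))) \<in> O(\<lambda>m. real m powr (-1 - \<alpha>))"
      using powr_shift_bigo[of s "1 - \<alpha>"] G unfolding e
      by (subst landau_o.big.cmult_in_iff) auto
  qed
  moreover have "(c * W m - (real m powr (1 - \<alpha>) / G - s * real m powr (- \<alpha>) / Gamma (1 - \<alpha>)))
      - 1 / G * ((real m - s) powr (1 - \<alpha>) - (real m powr (1 - \<alpha>) - s * (1 - \<alpha>) * real m powr (1 - \<alpha> - 1)))
      = c * W m - \<Phi> (real m)" for m
  proof -
    have "X - (P / (a * g) - s * A / g) - 1 / (a * g) * (S - (P - s * a * A)) = X - S / (a * g)"
      if "a \<noteq> 0" "g \<noteq> 0" for X P A S a g :: real
      using that by (simp add: field_simps)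
    moreover have "1 - \<alpha> \<noteq> 0" "Gamma (1 - \<alpha>) \<noteq> 0" "1 - \<alpha> - 1 = - \<alpha>"
      using \<alpha> less_imp_neq[OF Gamma_shifts(1)[OF \<alpha>]] by auto
    ultimately show ?thesis
      by (simp only: \<Phi>_def G_def Gamma_shifts(4)[OF \<alpha>] not_False_eq_True)
  qed
  ultimately have "(\<lambda>m. c * W m - \<Phi> (real m)) \<in> O(\<lambda>m. real m powr (-1 - \<alpha>))"
    by (simp only:)
  then obtain C1 where C1: "C1 > 0"
    "eventually (\<lambda>m. norm (c * W m - \<Phi> (real m)) \<le> C1 * norm (real m powr (-1 - \<alpha>))) sequentially"
    by (rule landau_o.bigE)
  then obtain N1 where N1: "\<And>m. m \<ge> N1 \<Longrightarrow> \<bar>c * W m - \<Phi> (real m)\<bar> \<le> C1 * real m powr (-1 - \<alpha>)"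
    by (auto simp: eventually_sequentially)
  \<comment> \<open>For m \<ge> N this gives m - s \<ge> m / 2 > 0, so the shifted power can be
    interpolated, and 1 + v - v0 \<le> 2 m for v in [m, m + 1], which accounts for the bases 2 and 4
    in \<open>C2\<close>.\<close>
  define N where "N = max N1 (nat \<lceil>2 * \<bar>s\<bar>\<rceil> + 2)"
  have N: "N \<ge> N1" "real N \<ge> 2 * \<bar>s\<bar> + 2" unfolding N_def by linarith+
  define C2 where "C2 = 2 * C1 * 2 powr (1 + \<alpha>) + 4 powr (1 + \<alpha>) / G"
  define C3 where "C3 = \<bar>c\<bar> * (\<Sum>k<N. \<bar>\<omega> k\<bar> * real N) + (real N + \<bar>s\<bar>) powr (1 - \<alpha>) / G"
  \<comment> \<open>The least value of the decay function on [v0, N]; dividing by it turns the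
    constant bound \<open>C3\<close> into a multiple of that function.\<close>
  define e0 where "e0 = (1 + real N - v0) powr (-1 - \<alpha>)"
  have e0: "e0 > 0" using v0 by (auto simp: e0_def)
  have C2: "C2 \<ge> 0" using C1 G by (auto simp: C2_def)
  have C3: "C3 \<ge> 0" using G unfolding C3_def by (auto intro!: add_nonneg_nonneg mult_nonneg_nonneg sum_nonneg)
  have large: "\<bar>peano_kernel \<alpha> c s \<omega> n v\<bar> \<le> C2 * (1 + v - v0) powr (-1 - \<alpha>)"
    if v: "real N \<le> v" "v \<le> real n" for n v
  proof -
    define m where "m = nat \<lfloor>v\<rfloor>"
    define x where "x = v - real m"
    have m: "real m \<le> v" "v \<le> real m + 1" "m \<ge> N" unfolding m_def using v by linarith+
    have x: "0 \<le> x" "x \<le> 1" using m by (auto simp: x_def)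
    have m2: "real m \<ge> real N" using m by simp
    have a: "real m - s \<ge> real m / 2" "real m / 2 > 0" using N m2 by linarith+
    \<comment> \<open>The zero term k = m is added to the first sum, so that both sums run over the
      same nodes.\<close>
    have Wm: "W m = (\<Sum>k<Suc m. \<omega> k * (real m - real k))"
      "W (Suc m) = (\<Sum>k<Suc m. \<omega> k * (real (Suc m) - real k))"
      by (simp_all add: W_def)
    have "(1 - x) * W m + x * W (Suc m) =
      (\<Sum>k<Suc m. (1 - x) * (\<omega> k * (real m - real k)) + x * (\<omega> k * (real (Suc m) - real k)))"
      by (simp only: sum_distrib_left sum.distrib Wm)
    also have "\<dots> = (\<Sum>k<Suc m. \<omega> k * max 0 (v - real k))"
      using m by (intro sum.cong refl) (auto simp: x_def max_def algebra_simps)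
    finally have sum: "(\<Sum>k<Suc m. \<omega> k * max 0 (v - real k)) = (1 - x) * W m + x * W (Suc m)" ..
    \<comment> \<open>Nodes k \<ge> v contribute 0, so the number of nodes may be any number that is
      at least v.\<close>
    have "peano_kernel \<alpha> c s \<omega> n v = peano_kernel \<alpha> c s \<omega> (Suc m) v"
      using v m by (intro peano_kernel_mono_neutral) auto
    also have "\<dots> = c * ((1 - x) * W m + x * W (Suc m)) - \<Phi> v"
      using a m unfolding peano_kernel_def sum by (simp add: \<Phi>_def G_def)
    also have "\<dots> = (1 - x) * (c * W m - \<Phi> (real m)) + x * (c * W (Suc m) - \<Phi> (real (Suc m)))
        + ((1 - x) * \<Phi> (real m) + x * \<Phi> (real (Suc m)) - \<Phi> v)"
      by (simp add: algebra_simps)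
    finally have eq: "peano_kernel \<alpha> c s \<omega> n v = \<dots>" .
    have "\<bar>(1 - x) * (c * W m - \<Phi> (real m))\<bar> \<le> 1 * (C1 * real m powr (-1 - \<alpha>))"
      unfolding abs_mult using x N1[of m] m N by (intro mult_mono) auto
    moreover have "\<bar>x * (c * W (Suc m) - \<Phi> (real (Suc m)))\<bar> \<le> 1 * (C1 * real m powr (-1 - \<alpha>))"
      unfolding abs_mult
    proof (intro mult_mono)
      have "\<bar>c * W (Suc m) - \<Phi> (real (Suc m))\<bar> \<le> C1 * real (Suc m) powr (-1 - \<alpha>)"
        using m N by (intro N1) auto
      also have "\<dots> \<le> C1 * real m powr (-1 - \<alpha>)"
        using C1 \<alpha> a by (intro mult_left_mono powr_mono2') auto
      finally show "\<bar>c * W (Suc m) - \<Phi> (real (Suc m))\<bar> \<le> C1 * real m powr (-1 - \<alpha>)" .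
    qed (use x C1 in auto)
    moreover have "\<bar>(1 - x) * \<Phi> (real m) + x * \<Phi> (real (Suc m)) - \<Phi> v\<bar> \<le> (real m / 2) powr (-1 - \<alpha>) / G"
    proof -
      have "\<bar>(1 - x) * (real m - s) powr (1 - \<alpha>) + x * (real m - s + 1) powr (1 - \<alpha>) - (real m - s + x) powr (1 - \<alpha>)\<bar>
          \<le> (real m - s) powr (1 - \<alpha> - 2)"
        using a x \<alpha> by (intro powr_interpolation_error) auto
      also have "\<dots> \<le> (real m / 2) powr (1 - \<alpha> - 2)"
        using a \<alpha> by (intro powr_mono2') auto
      finally have "\<bar>(1 - x) * (real m - s) powr (1 - \<alpha>) + x * (real m - s + 1) powr (1 - \<alpha>) - (real m - s + x) powr (1 - \<alpha>)\<bar> / G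
         \<le> (real m / 2) powr (1 - \<alpha> - 2) / G"
        using G by (intro divide_right_mono) auto
      moreover have "(1 - x) * \<Phi> (real m) + x * \<Phi> (real (Suc m)) - \<Phi> v =
         ((1 - x) * (real m - s) powr (1 - \<alpha>) + x * (real m - s + 1) powr (1 - \<alpha>) - (real m - s + x) powr (1 - \<alpha>)) / G"
      proof -
        have e: "real m - s + 1 = real (Suc m) - s" "real m - s + x = v - s" by (auto simp: x_def)
        show ?thesis
          unfolding e \<Phi>_def by (simp add: add_divide_distrib diff_divide_distrib del: of_nat_Suc)
      qed
      ultimately show ?thesis using G by (simp add: abs_divide)
    qed
    ultimately have "\<bar>peano_kernel \<alpha> c s \<omega> n v\<bar> \<le>
        2 * C1 * real m powr (-1 - \<alpha>) + (real m / 2) powr (-1 - \<alpha>) / G"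
      unfolding eq by linarith
    also have "\<dots> \<le> 2 * C1 * ((1 + v - v0) / 2) powr (-1 - \<alpha>) + ((1 + v - v0) / 4) powr (-1 - \<alpha>) / G"
    proof (intro add_mono mult_left_mono divide_right_mono powr_mono2')
      have "1 + v - v0 \<le> 2 * real m" using m(2) m2 N(2) v0(3) by linarith
      then show "(1 + v - v0) / 2 \<le> real m" "(1 + v - v0) / 4 \<le> real m / 2" by simp_all
      have "0 < 1 + v - v0" using v(1) v0(1) by linarith
      then show "0 < (1 + v - v0) / 2" "0 < (1 + v - v0) / 4" by simp_all
    qed (use \<alpha> C1 G in auto)
    also have "\<dots> = C2 * (1 + v - v0) powr (-1 - \<alpha>)"
    proof -
      have "((1 + v - v0) / b) powr (-1 - \<alpha>) = b powr (1 + \<alpha>) * (1 + v - v0) powr (-1 - \<alpha>)" if "b > 0" for b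
      proof -
        have "b powr (-1 - \<alpha>) = 1 / b powr (1 + \<alpha>)"
          using powr_minus_divide[of b "1 + \<alpha>"] by simp
        then show ?thesis using that v v0 N by (simp add: powr_divide)
      qed
      then show ?thesis by (simp add: C2_def algebra_simps)
    qed
    finally show ?thesis .
  qed
  have small: "\<bar>peano_kernel \<alpha> c s \<omega> n v\<bar> \<le> C3 / e0 * (1 + v - v0) powr (-1 - \<alpha>)"
    if v: "v0 \<le> v" "v \<le> real N" "v \<le> real n" for n v
  proof -
    have "peano_kernel \<alpha> c s \<omega> n v = peano_kernel \<alpha> c s \<omega> N v"
      using v by (intro peano_kernel_mono_neutral) auto
    also have "\<bar>\<dots>\<bar> \<le> \<bar>c * (\<Sum>k<N. \<omega> k * max 0 (v - real k))\<bar> + \<bar>max 0 (v - s) powr (1 - \<alpha>) / G\<bar>"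
      unfolding peano_kernel_def G_def by (rule abs_triangle_ineq4)
    also have "\<dots> \<le> C3"
      unfolding C3_def
    proof (intro add_mono)
      have "\<bar>\<Sum>k<N. \<omega> k * max 0 (v - real k)\<bar> \<le> (\<Sum>k<N. \<bar>\<omega> k\<bar> * real N)"
        using v by (intro order.trans[OF sum_abs] sum_mono) (auto simp: abs_mult intro!: mult_left_mono)
      then show "\<bar>c * (\<Sum>k<N. \<omega> k * max 0 (v - real k))\<bar> \<le> \<bar>c\<bar> * (\<Sum>k<N. \<bar>\<omega> k\<bar> * real N)"
        by (simp add: abs_mult mult_left_mono)
      have "max 0 (v - s) powr (1 - \<alpha>) \<le> (real N + \<bar>s\<bar>) powr (1 - \<alpha>)"
        using v \<alpha> by (intro powr_mono2) auto
      then show "\<bar>max 0 (v - s) powr (1 - \<alpha>) / G\<bar> \<le> (real N + \<bar>s\<bar>) powr (1 - \<alpha>) / G"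
        using G by (simp add: abs_divide divide_right_mono)
    qed
    also have "C3 = C3 / e0 * e0" using e0 by simp
    also have "\<dots> \<le> C3 / e0 * (1 + v - v0) powr (-1 - \<alpha>)"
      unfolding e0_def using C3 v v0 \<alpha> by (intro mult_left_mono powr_mono2') auto
    finally show ?thesis .
  qed
  show ?thesis
  proof (rule that[of "C2 + C3 / e0"])
    show "C2 + C3 / e0 \<ge> 0" using C2 C3 e0 by auto
    fix n v assume v: "min 0 s \<le> v" "v \<le> real n"
    have nn: "0 \<le> C2 * (1 + v - v0) powr (-1 - \<alpha>)" "0 \<le> C3 / e0 * (1 + v - v0) powr (-1 - \<alpha>)"
      using C2 C3 e0 by auto
    show "\<bar>peano_kernel \<alpha> c s \<omega> n v\<bar> \<le> (C2 + C3 / e0) * (1 + v - min 0 s) powr (-1 - \<alpha>)"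
      unfolding v0_def[symmetric] ring_distribs
      using nn large[of v n] small[of v n] v v0_def by (cases "real N \<le> v") (auto intro: add_increasing add_increasing2)
  qed
qed

lemma has_integral_affine_powr:
  fixes b h r U :: real
  assumes "h > 0" "U \<ge> 0" "b - U / h > 0" "r \<noteq> -1"
  shows "((\<lambda>z. (b - z / h) powr r) has_integral h / (r + 1) * (b powr (r + 1) - (b - U / h) powr (r + 1))) {0..U}"
proof -
  have "((\<lambda>z. (b - z / h) powr r) has_integral
     - h / (r + 1) * (b - U / h) powr (r + 1) - - h / (r + 1) * (b - 0 / h) powr (r + 1)) {0..U}"
  proof (rule fundamental_theorem_of_calculus[OF assms(2)])
    fix z assume z: "z \<in> {0..U}"
    have "z / h \<le> U / h" using z assms by (intro divide_right_mono) auto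
    then have "b - z / h > 0" using assms by linarith
    have "((\<lambda>u. (b - u / h) powr (r + 1)) has_real_derivative (r + 1) * (b - z / h) powr (r + 1 - 1) * (0 - 1 / h)) (at z)"
      by (rule DERIV_chain2[OF has_real_derivative_powr])
         (use \<open>b - z / h > 0\<close> assms in \<open>auto intro!: derivative_eq_intros\<close>)
    then have "((\<lambda>u. - h / (r + 1) * (b - u / h) powr (r + 1)) has_real_derivative
        - h / (r + 1) * ((r + 1) * (b - z / h) powr (r + 1 - 1) * (0 - 1 / h))) (at z)"
      by (rule DERIV_cmult)
    moreover have "- h / (r + 1) * ((r + 1) * (b - z / h) powr (r + 1 - 1) * (0 - 1 / h)) = (b - z / h) powr r"
    proof -
      have "- h / k * (k * P * (0 - 1 / h)) = P" if "k \<noteq> 0" for k P :: real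
        using that assms(1) by (simp add: field_simps)
      from this[of "r + 1" "(b - z / h) powr (r + 1 - 1)"] show ?thesis
        using assms(4) by (simp add: add_eq_0_iff)
    qed
    ultimately have "((\<lambda>u. - h / (r + 1) * (b - u / h) powr (r + 1)) has_real_derivative (b - z / h) powr r) (at z)"
      by (simp only:)
    then show "((\<lambda>u. - h / (r + 1) * (b - u / h) powr (r + 1)) has_vector_derivative (b - z / h) powr r) (at z within {0..U})"
      by (simp add: has_real_derivative_iff_has_vector_derivative has_vector_derivative_at_within)
  qed
  moreover have "- h / (r + 1) * (b - U / h) powr (r + 1) - - h / (r + 1) * (b - 0 / h) powr (r + 1)
     = h / (r + 1) * (b powr (r + 1) - (b - U / h) powr (r + 1))"
    by (simp add: right_diff_distrib)
  ultimately show ?thesis by (simp only:)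
qed

lemma has_integral_abs_le:
  fixes f g :: "real \<Rightarrow> real"
  assumes "(f has_integral I) S" "(g has_integral J) S" "\<And>x. x \<in> S \<Longrightarrow> \<bar>f x\<bar> \<le> g x"
  shows "\<bar>I\<bar> \<le> J"
  using integral_norm_bound_integral[of f S g] assms by (auto simp: has_integral_iff)

context vanishing_C2
begin

text \<open>The supremum of |y''| is taken out of the integral. What remains is h^(1 - \<alpha>)
  times the integral of the kernel bound, and that bound integrates to at most C / \<alpha> in v,
  that is, to C * h / \<alpha> in z.\<close>

lemma approximates_caputo_order_2_minus_alpha:
  assumes \<alpha>: "0 < \<alpha>" "\<alpha> < 1" and t: "0 < t" "t \<le> T" "s < 0 \<longrightarrow> t < T"
    and asym: "(\<lambda>m. c * (\<Sum>k<m. \<omega> k * (real m - real k))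
      - (real m powr (1 - \<alpha>) / Gamma (2 - \<alpha>) - s * real m powr (- \<alpha>) / Gamma (1 - \<alpha>)))
      \<in> O(\<lambda>m. real m powr (-1 - \<alpha>))"
    and w: "\<And>n k. k < n \<Longrightarrow> w n k = \<omega> k"
  shows "approximates_caputo_with_order c w \<alpha> s y t (2 - \<alpha>)"
proof -
  obtain C where C: "C \<ge> 0" "\<And>n v. min 0 s \<le> v \<Longrightarrow> v \<le> real n \<Longrightarrow>
     \<bar>peano_kernel \<alpha> c s \<omega> n v\<bar> \<le> C * (1 + v - min 0 s) powr (-1 - \<alpha>)"
    using peano_kernel_bound[OF \<alpha> asym] by blast
  have "bounded (y2 ` {0..T})"
    by (intro compact_imp_bounded compact_continuous_image y2_cont compact_Icc)
  then obtain M where M: "\<And>x. x \<in> {0..T} \<Longrightarrow> \<bar>y2 x\<bar> \<le> M"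
    unfolding bounded_iff by (metis imageI real_norm_def)
  have M0: "M \<ge> 0" using M[of 0] t by auto
  define v0 where "v0 = min 0 s"
  have bound: "\<bar>c / (t / real n) powr \<alpha> * (\<Sum>k=0..<n. w n k * y (real (n - k) * (t / real n)))
          - caputo \<alpha> y ((real n - s) * (t / real n))\<bar> \<le> C * M / \<alpha> * (t / real n) powr (2 - \<alpha>)"
    if n: "n > 0" "real n \<ge> s" "t - v0 * (t / real n) \<le> T" for n
  proof -
    define h where "h = t / real n"
    \<comment> \<open>U is the larger of t and t - s * h, and v = v0 is its image in units of the
      step size.\<close>
    define U where "U = t - v0 * h"
    have h: "h > 0" "real n * h = t" using n t by (auto simp: h_def)
    have "v0 * h \<le> 0" using h by (intro mult_nonpos_nonneg) (auto simp: v0_def)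
    then have U: "t \<le> U" "U \<le> T" using n by (auto simp: U_def h_def)
    have "s * h \<ge> v0 * h" using h by (intro mult_right_mono) (auto simp: v0_def)
    then have \<tau>U: "(real n - s) * h \<le> U" using h by (simp add: U_def left_diff_distrib)
    have "((\<lambda>z. h powr (1 - \<alpha>) * peano_kernel \<alpha> c s \<omega> n ((real n * h - z) / h) * y2 z) has_integral
       c / h powr \<alpha> * (\<Sum>k<n. \<omega> k * y (real (n - k) * h)) - caputo \<alpha> y ((real n - s) * h)) {0..U}"
      using n h U \<tau>U by (intro has_integral_peano_kernel \<alpha>) auto
    moreover have "((\<lambda>z. h powr (1 - \<alpha>) * C * M * (1 + t / h - v0 - z / h) powr (-1 - \<alpha>)) has_integral
        h powr (1 - \<alpha>) * C * M * (h / (-1 - \<alpha> + 1) * ((1 + t / h - v0) powr (-1 - \<alpha> + 1)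
          - (1 + t / h - v0 - U / h) powr (-1 - \<alpha> + 1)))) {0..U}"
      using h t U \<alpha> by (intro has_integral_mult_right has_integral_affine_powr) (auto simp: U_def diff_divide_distrib)
    moreover have "\<bar>h powr (1 - \<alpha>) * peano_kernel \<alpha> c s \<omega> n ((real n * h - z) / h) * y2 z\<bar>
        \<le> h powr (1 - \<alpha>) * C * M * (1 + t / h - v0 - z / h) powr (-1 - \<alpha>)" if z: "z \<in> {0..U}" for z
    proof -
      have "(t - z) / h \<ge> v0"
        using z h by (simp add: field_simps U_def)
      moreover have "(t - z) / h \<le> real n" using z h by (simp add: field_simps)
      ultimately have "\<bar>peano_kernel \<alpha> c s \<omega> n ((t - z) / h)\<bar> \<le> C * (1 + (t - z) / h - v0) powr (-1 - \<alpha>)"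
        unfolding v0_def by (intro C)
      moreover have "\<bar>y2 z\<bar> \<le> M" using z U by (intro M) auto
      ultimately have "\<bar>peano_kernel \<alpha> c s \<omega> n ((t - z) / h)\<bar> * \<bar>y2 z\<bar> \<le> C * (1 + (t - z) / h - v0) powr (-1 - \<alpha>) * M"
        using C by (intro mult_mono) auto
      then have "h powr (1 - \<alpha>) * (\<bar>peano_kernel \<alpha> c s \<omega> n ((t - z) / h)\<bar> * \<bar>y2 z\<bar>)
          \<le> h powr (1 - \<alpha>) * (C * (1 + (t - z) / h - v0) powr (-1 - \<alpha>) * M)"
        by (intro mult_left_mono) auto
      moreover have "1 + (t - z) / h - v0 = 1 + t / h - v0 - z / h" by (simp add: diff_divide_distrib)
      ultimately show ?thesis using h by (simp add: abs_mult mult_ac)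
    qed
    ultimately have "\<bar>c / h powr \<alpha> * (\<Sum>k<n. \<omega> k * y (real (n - k) * h)) - caputo \<alpha> y ((real n - s) * h)\<bar>
      \<le> h powr (1 - \<alpha>) * C * M * (h / (-1 - \<alpha> + 1) * ((1 + t / h - v0) powr (-1 - \<alpha> + 1)
          - (1 + t / h - v0 - U / h) powr (-1 - \<alpha> + 1)))"
      by (rule has_integral_abs_le)
    also have "\<dots> \<le> h powr (1 - \<alpha>) * C * M * (h / \<alpha>)"
    proof (intro mult_left_mono)
      have "1 + t / h - v0 - U / h = 1" using h by (simp add: U_def diff_divide_distrib)
      moreover have "h * (1 + t / h - v0) powr - \<alpha> \<ge> 0" using h by auto
      ultimately show "h / (-1 - \<alpha> + 1) * ((1 + t / h - v0) powr (-1 - \<alpha> + 1)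
          - (1 + t / h - v0 - U / h) powr (-1 - \<alpha> + 1)) \<le> h / \<alpha>"
        using \<alpha> h by (simp add: field_simps)
    qed (use C M0 in auto)
    also have "\<dots> = C * M / \<alpha> * h powr (2 - \<alpha>)"
    proof -
      have "h powr (1 - \<alpha>) * h = h powr (2 - \<alpha>)"
        using h powr_add[of h "1 - \<alpha>" 1] by (simp add: algebra_simps)
      then show ?thesis by (simp add: mult_ac)
    qed
    also have "(\<Sum>k<n. \<omega> k * y (real (n - k) * h)) = (\<Sum>k=0..<n. w n k * y (real (n - k) * h))"
      by (auto simp: w lessThan_atLeast0 intro!: sum.cong)
    finally show ?thesis by (simp only: h_def)
  qed
  \<comment> \<open>The condition \<open>real n \<ge> s\<close> makes the shifted point nonnegative.
    The last one keeps the interval of integration inside [0, T]; for s < 0 it holds eventually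
    because t < T.\<close>
  have "eventually (\<lambda>n. n > 0 \<and> real n \<ge> s \<and> t - v0 * (t / real n) \<le> T) sequentially"
  proof (intro eventually_conj)
    show "eventually (\<lambda>n. real n \<ge> s) sequentially" by real_asymp
    show "eventually (\<lambda>n. t - v0 * (t / real n) \<le> T) sequentially"
    proof (cases "s < 0")
      case True
      have "(\<lambda>n. t - v0 * (t / real n)) \<longlonglongrightarrow> t - v0 * 0"
        by (intro tendsto_intros tendsto_divide_0[OF tendsto_const] filterlim_at_top_imp_at_infinity filterlim_real_sequentially)
      moreover have "t - v0 * 0 < T" using True t by simp
      ultimately have "eventually (\<lambda>n. t - v0 * (t / real n) < T) sequentially"
        by (rule order_tendstoD)
      then show ?thesis by (rule eventually_mono) simp
    qed (use t in \<open>auto simp: v0_def\<close>)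
  qed (rule eventually_gt_at_top)
  then show ?thesis
    unfolding approximates_caputo_with_order_def Let_def
    by (intro bigoI[where c = "C * M / \<alpha>"]) (auto elim!: eventually_mono dest: bound)
qed

end

section \<open>The half square as test function and the order 2\<close>

text \<open>The scheme error of z^2 / 2 is h^(1 - \<alpha>) times the integral of the kernel itself,
  so this closed form makes that integral accessible through sums of weights.\<close>

lemma caputo_half_square:
  assumes \<alpha>: "0 < \<alpha>" "\<alpha> < 1" and \<tau>: "0 \<le> \<tau>"
  shows "caputo \<alpha> (\<lambda>z. z ^ 2 / 2) \<tau> = \<tau> powr (2 - \<alpha>) / Gamma (3 - \<alpha>)"
proof -
  interpret q: vanishing_C2 "\<lambda>z. z ^ 2 / 2" "\<lambda>z. z" "\<lambda>_. 1" \<tau>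
    by unfold_locales (auto intro!: derivative_eq_intros)
  have "((\<lambda>z. (\<tau> - z) powr (1 - \<alpha>)) has_integral
     - ((\<tau> - \<tau>) powr (2 - \<alpha>) / (2 - \<alpha>)) - - ((\<tau> - 0) powr (2 - \<alpha>) / (2 - \<alpha>))) {0..\<tau>}"
  proof (rule fundamental_theorem_of_calculus_interior)
    show "continuous_on {0..\<tau>} (\<lambda>z. - ((\<tau> - z) powr (2 - \<alpha>) / (2 - \<alpha>)))"
      using \<alpha> by (intro continuous_on_minus continuous_on_divide continuous_on_powr' continuous_on_diff
            continuous_on_const continuous_on_id) auto
    fix z assume z: "z \<in> {0<..<\<tau>}"
    have "((\<lambda>u. (\<tau> - u) powr (2 - \<alpha>)) has_real_derivative (2 - \<alpha>) * (\<tau> - z) powr (2 - \<alpha> - 1) * (0 - 1)) (at z)"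
      by (rule DERIV_chain2[OF has_real_derivative_powr]) (use z in \<open>auto intro!: derivative_eq_intros\<close>)
    then have "((\<lambda>u. - ((\<tau> - u) powr (2 - \<alpha>) / (2 - \<alpha>))) has_real_derivative
        - ((2 - \<alpha>) * (\<tau> - z) powr (2 - \<alpha> - 1) * (0 - 1) / (2 - \<alpha>))) (at z)"
      by (intro DERIV_minus DERIV_cdivide)
    moreover have "- ((2 - \<alpha>) * (\<tau> - z) powr (2 - \<alpha> - 1) * (0 - 1) / (2 - \<alpha>)) = (\<tau> - z) powr (1 - \<alpha>)"
    proof -
      have "- (a * P * (0 - 1) / a) = P" if "a \<noteq> 0" for a P :: real
        using that by simp
      from this[of "2 - \<alpha>" "(\<tau> - z) powr (2 - \<alpha> - 1)"] show ?thesis using \<alpha> by simp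
    qed
    ultimately show "((\<lambda>u. - ((\<tau> - u) powr (2 - \<alpha>) / (2 - \<alpha>))) has_vector_derivative (\<tau> - z) powr (1 - \<alpha>)) (at z)"
      by (simp only: has_real_derivative_iff_has_vector_derivative)
  qed fact
  then have "((\<lambda>z. max 0 (\<tau> - z) powr (1 - \<alpha>) * 1) has_integral
     - ((\<tau> - \<tau>) powr (2 - \<alpha>) / (2 - \<alpha>)) - - ((\<tau> - 0) powr (2 - \<alpha>) / (2 - \<alpha>))) {0..\<tau>}"
    by (rule has_integral_eq[rotated]) auto
  from has_integral_unique[OF q.has_integral_caputo_kernel[OF \<alpha> \<tau> order.refl order.refl] this]
  have "Gamma (2 - \<alpha>) * caputo \<alpha> (\<lambda>z. z ^ 2 / 2) \<tau> = \<tau> powr (2 - \<alpha>) / (2 - \<alpha>)"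
    by simp
  then show ?thesis
    using \<alpha> less_imp_neq[OF Gamma_shifts(2)[OF \<alpha>]] unfolding Gamma_shifts(5)[OF \<alpha>]
    by (simp add: field_simps)
qed

text \<open>The power (n - s)^(2 - \<alpha>) agrees with the first two terms of its binomial
  expansion up to O(n^-\<alpha>). A bound that tends to 0 leaves no room for a constant term, which
  is how the vanishing of the integral of the kernel is expressed.\<close>

lemma half_square_error_bigo:
  assumes \<alpha>: "0 < \<alpha>" "\<alpha> < 1"
    and asym: "(\<lambda>m. c * (\<Sum>k<m. \<omega> k * ((real m - real k) ^ 2 / 2))
      - (real m powr (2 - \<alpha>) / Gamma (3 - \<alpha>) - s * real m powr (1 - \<alpha>) / Gamma (2 - \<alpha>)))
      \<in> O(\<lambda>m. real m powr (- \<alpha>))"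
  shows "(\<lambda>n. c * (\<Sum>k<n. \<omega> k * ((real n - real k) ^ 2 / 2)) - (real n - s) powr (2 - \<alpha>) / Gamma (3 - \<alpha>))
    \<in> O(\<lambda>n. real n powr (- \<alpha>))"
proof -
  define G where "G = Gamma (3 - \<alpha>)"
  define Q where "Q = (\<lambda>m. \<Sum>k<m. \<omega> k * ((real m - real k) ^ 2 / 2))"
  have g: "2 - \<alpha> \<noteq> 0" "Gamma (2 - \<alpha>) \<noteq> 0" "2 - \<alpha> - 1 = 1 - \<alpha>"
    using \<alpha> less_imp_neq[OF Gamma_shifts(2)[OF \<alpha>]] by auto
  then have G: "G \<noteq> 0" unfolding G_def Gamma_shifts(5)[OF \<alpha>] by simp
  have "(\<lambda>m. (c * Q m - (real m powr (2 - \<alpha>) / G - s * real m powr (1 - \<alpha>) / Gamma (2 - \<alpha>)))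
      - 1 / G * ((real m - s) powr (2 - \<alpha>) - (real m powr (2 - \<alpha>) - s * (2 - \<alpha>) * real m powr (2 - \<alpha> - 1))))
      \<in> O(\<lambda>m. real m powr (- \<alpha>))"
  proof (rule sum_in_bigo(2))
    show "(\<lambda>m. c * Q m - (real m powr (2 - \<alpha>) / G - s * real m powr (1 - \<alpha>) / Gamma (2 - \<alpha>)))
        \<in> O(\<lambda>m. real m powr (- \<alpha>))"
      using asym by (simp only: Q_def G_def)
    have e: "2 - \<alpha> - 2 = - \<alpha>" by simp
    show "(\<lambda>m. 1 / G * ((real m - s) powr (2 - \<alpha>) - (real m powr (2 - \<alpha>)
        - s * (2 - \<alpha>) * real m powr (2 - \<alpha> - 1)))) \<in> O(\<lambda>m. real m powr (- \<alpha>))"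
      using powr_shift_bigo[of s "2 - \<alpha>"] G unfolding e
      by (subst landau_o.big.cmult_in_iff) auto
  qed
  moreover have "(c * Q m - (real m powr (2 - \<alpha>) / G - s * real m powr (1 - \<alpha>) / Gamma (2 - \<alpha>)))
      - 1 / G * ((real m - s) powr (2 - \<alpha>) - (real m powr (2 - \<alpha>) - s * (2 - \<alpha>) * real m powr (2 - \<alpha> - 1)))
      = c * Q m - (real m - s) powr (2 - \<alpha>) / G" for m
  proof -
    have "X - (P / (a * g) - s * A / g) - 1 / (a * g) * (S - (P - s * a * A)) = X - S / (a * g)"
      if "a \<noteq> 0" "g \<noteq> 0" for X P A S a g :: real
      using that by (simp add: field_simps)
    then show ?thesis
      by (simp only: G_def Gamma_shifts(5)[OF \<alpha>] g not_False_eq_True)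
  qed
  ultimately show ?thesis by (simp only: Q_def G_def)
qed

text \<open>The error is split into y''(T) times the error of z^2 / 2 and the integral of the kernel
  against y'' - y''(T). By Lipschitz continuity that difference is at most L * h * v, so the
  integrand decays only like v^-\<alpha> and its integral grows like n^(1 - \<alpha>); but h^(1 -
  \<alpha>) * n^(1 - \<alpha>) is the constant T^(1 - \<alpha>), and a factor h^2 is left.\<close>

lemma (in vanishing_C2) approximates_caputo_order_2:
  assumes \<alpha>: "0 < \<alpha>" "\<alpha> < 1" and T: "0 < T" and s: "s \<ge> 0"
    and y2_deriv: "\<And>x. x \<in> {0..T} \<Longrightarrow> (y2 has_real_derivative y3 x) (at x within {0..T})"
    and y3_cont: "continuous_on {0..T} y3"
    and asym1: "(\<lambda>m. c * (\<Sum>k<m. \<omega> k * (real m - real k))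
      - (real m powr (1 - \<alpha>) / Gamma (2 - \<alpha>) - s * real m powr (- \<alpha>) / Gamma (1 - \<alpha>)))
      \<in> O(\<lambda>m. real m powr (-1 - \<alpha>))"
    and asym2: "(\<lambda>m. c * (\<Sum>k<m. \<omega> k * ((real m - real k) ^ 2 / 2))
      - (real m powr (2 - \<alpha>) / Gamma (3 - \<alpha>) - s * real m powr (1 - \<alpha>) / Gamma (2 - \<alpha>)))
      \<in> O(\<lambda>m. real m powr (- \<alpha>))"
    and w: "\<And>n k. k < n \<Longrightarrow> w n k = \<omega> k"
  shows "approximates_caputo_with_order c w \<alpha> s y T 2"
proof -
  obtain C where C: "C \<ge> 0" "\<And>n v. min 0 s \<le> v \<Longrightarrow> v \<le> real n \<Longrightarrow>
     \<bar>peano_kernel \<alpha> c s \<omega> n v\<bar> \<le> C * (1 + v - min 0 s) powr (-1 - \<alpha>)"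
    using peano_kernel_bound[OF \<alpha> asym1] by blast
  have "bounded (y3 ` {0..T})"
    by (intro compact_imp_bounded compact_continuous_image y3_cont compact_Icc)
  then obtain L where L: "\<And>x. x \<in> {0..T} \<Longrightarrow> \<bar>y3 x\<bar> \<le> L"
    unfolding bounded_iff by (metis imageI real_norm_def)
  have L0: "L \<ge> 0" using L[of 0] T by auto
  have lip: "\<bar>y2 z - y2 T\<bar> \<le> L * (T - z)" if "z \<in> {0..T}" for z
  proof -
    have "norm (y2 z - y2 T) \<le> L * norm (z - T)"
      by (rule field_differentiable_bound[where S = "{0..T}" and f' = y3])
         (use that L y2_deriv T in auto)
    then show ?thesis using that by auto
  qed
  define Q where "Q = (\<lambda>n. c * (\<Sum>k<n. \<omega> k * ((real n - real k) ^ 2 / 2)) - (real n - s) powr (2 - \<alpha>) / Gamma (3 - \<alpha>))"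
  from half_square_error_bigo[OF \<alpha> asym2, folded Q_def] obtain K where K: "K > 0"
    "eventually (\<lambda>n. norm (Q n) \<le> K * norm (real n powr (- \<alpha>))) sequentially"
    by (rule landau_o.bigE)
  interpret q: vanishing_C2 "\<lambda>z. z ^ 2 / 2" "\<lambda>z. z" "\<lambda>_. 1" T
    by unfold_locales (auto intro!: derivative_eq_intros)
  \<comment> \<open>The first summand bounds the part with y'' frozen at T, the second one the
    Lipschitz part.\<close>
  define B where "B = \<bar>y2 T\<bar> * K * T powr (- \<alpha>) + C * L / (1 - \<alpha>) * (2 powr (1 - \<alpha>) * T powr (1 - \<alpha>))"
  have bound: "\<bar>c / (T / real n) powr \<alpha> * (\<Sum>k=0..<n. w n k * y (real (n - k) * (T / real n)))
          - caputo \<alpha> y ((real n - s) * (T / real n))\<bar> \<le> B * (T / real n) powr 2"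
    if n: "n > 0" "real n \<ge> s" and Qn: "\<bar>Q n\<bar> \<le> K * real n powr (- \<alpha>)" for n
  proof -
    define h where "h = T / real n"
    have h: "h > 0" "real n * h = T" using n(1) T by (simp_all add: h_def)
    have \<tau>: "(real n - s) * h \<le> T" "0 \<le> (real n - s) * h"
      using h s n by (auto simp: left_diff_distrib)
    define E where "E = c / h powr \<alpha> * (\<Sum>k<n. \<omega> k * y (real (n - k) * h)) - caputo \<alpha> y ((real n - s) * h)"
    define E2 where "E2 = c / h powr \<alpha> * (\<Sum>k<n. \<omega> k * ((real (n - k) * h) ^ 2 / 2)) - caputo \<alpha> (\<lambda>z. z ^ 2 / 2) ((real n - s) * h)"
    define \<kappa> where "\<kappa> = (\<lambda>z. h powr (1 - \<alpha>) * peano_kernel \<alpha> c s \<omega> n ((real n * h - z) / h))"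
    have E: "((\<lambda>z. \<kappa> z * y2 z) has_integral E) {0..T}"
      unfolding E_def \<kappa>_def using h \<tau> by (intro has_integral_peano_kernel \<alpha>) auto
    have "((\<lambda>z. \<kappa> z * 1) has_integral E2) {0..T}"
      unfolding E2_def \<kappa>_def using h \<tau> by (intro q.has_integral_peano_kernel \<alpha>) auto
    from has_integral_diff[OF E has_integral_mult_right[OF this, of "y2 T"]]
    have diff: "((\<lambda>z. \<kappa> z * (y2 z - y2 T)) has_integral E - y2 T * E2) {0..T}"
      by (simp add: algebra_simps)
    have hh: "h powr (1 - \<alpha>) * h = h powr (2 - \<alpha>)" "h powr (2 - \<alpha>) * h powr \<alpha> = h powr 2"
      using h powr_add[of h "1 - \<alpha>" 1] powr_add[of h "2 - \<alpha>" \<alpha>] by (simp_all add: algebra_simps)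
    have nh: "real n powr r = T powr r * h powr (- r)" for r
    proof -
      have "T powr r = real n powr r * h powr r" using h by (metis powr_mult)
      then show ?thesis using h by (simp add: powr_minus)
    qed
    have "E2 = h powr (2 - \<alpha>) * Q n"
    proof -
      have "(\<Sum>k<n. \<omega> k * ((real (n - k) * h) ^ 2 / 2)) = h powr 2 * (\<Sum>k<n. \<omega> k * ((real n - real k) ^ 2 / 2))"
        using h by (auto simp: sum_distrib_left power_mult_distrib of_nat_diff mult_ac intro!: sum.cong)
      moreover have "((real n - s) * h) powr (2 - \<alpha>) = (real n - s) powr (2 - \<alpha>) * h powr (2 - \<alpha>)"
        by (simp add: powr_mult)
      moreover have "c / h powr \<alpha> * (h powr 2 * S) = h powr (2 - \<alpha>) * (c * S)" for S
      proof -
        have e: "h powr (2 - \<alpha>) = h powr 2 / h powr \<alpha>" by (rule powr_diff)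
        show ?thesis unfolding e by simp
      qed
      ultimately show ?thesis
        unfolding E2_def Q_def caputo_half_square[OF \<alpha> \<tau>(2)] right_diff_distrib
        by (simp only: times_divide_eq_right) (simp add: mult.commute)
    qed
    then have "\<bar>E2\<bar> \<le> h powr (2 - \<alpha>) * (K * real n powr (- \<alpha>))"
      using Qn by (simp add: abs_mult mult_left_mono)
    also have "\<dots> = K * T powr (- \<alpha>) * h powr 2"
      unfolding nh hh(2)[symmetric] by simp
    finally have "\<bar>y2 T * E2\<bar> \<le> \<bar>y2 T\<bar> * (K * T powr (- \<alpha>) * h powr 2)"
      unfolding abs_mult by (intro mult_left_mono) auto
    moreover have "\<bar>E - y2 T * E2\<bar> \<le> C * L / (1 - \<alpha>) * (2 powr (1 - \<alpha>) * T powr (1 - \<alpha>)) * h powr 2"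
    proof -
      have "((\<lambda>z. h powr (1 - \<alpha>) * C * L * h * (1 + T / h - z / h) powr (- \<alpha>)) has_integral
          h powr (1 - \<alpha>) * C * L * h * (h / (- \<alpha> + 1) * ((1 + T / h) powr (- \<alpha> + 1)
          - (1 + T / h - T / h) powr (- \<alpha> + 1)))) {0..T}"
        using h T \<alpha> by (intro has_integral_mult_right has_integral_affine_powr) auto
      moreover have "\<bar>\<kappa> z * (y2 z - y2 T)\<bar> \<le> h powr (1 - \<alpha>) * C * L * h * (1 + T / h - z / h) powr (- \<alpha>)"
        if z: "z \<in> {0..T}" for z
      proof -
        define v where "v = (T - z) / h"
        have v: "0 \<le> v" "v \<le> real n" "T - z = h * v" using z h by (auto simp: v_def field_simps)
        have "\<bar>peano_kernel \<alpha> c s \<omega> n v\<bar> \<le> C * (1 + v - min 0 s) powr (-1 - \<alpha>)"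
          using v s by (intro C) auto
        then have "\<bar>peano_kernel \<alpha> c s \<omega> n v\<bar> * \<bar>y2 z - y2 T\<bar> \<le> C * (1 + v) powr (-1 - \<alpha>) * (L * (h * (1 + v)))"
        proof (intro mult_mono)
          have "\<bar>y2 z - y2 T\<bar> \<le> L * (h * v)" using lip[OF z] by (simp only: v)
          \<comment> \<open>Enlarging v to 1 + v lets this factor merge with (1 + v)^(-1 -
            \<alpha>).\<close>
          also have "\<dots> \<le> L * (h * (1 + v))" using L0 h by (intro mult_left_mono) auto
          finally show "\<bar>y2 z - y2 T\<bar> \<le> L * (h * (1 + v))" .
        qed (use s C in auto)
        also have "\<dots> = C * L * h * ((1 + v) powr (-1 - \<alpha>) * (1 + v) powr 1)"
          using v by simp
        also have "(1 + v) powr (-1 - \<alpha>) * (1 + v) powr 1 = (1 + v) powr (- \<alpha>)"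
          by (subst powr_add[symmetric]) simp
        also have "1 + v = 1 + T / h - z / h" by (simp add: v_def diff_divide_distrib)
        finally have "h powr (1 - \<alpha>) * (\<bar>peano_kernel \<alpha> c s \<omega> n v\<bar> * \<bar>y2 z - y2 T\<bar>)
            \<le> h powr (1 - \<alpha>) * (C * L * h * (1 + T / h - z / h) powr (- \<alpha>))"
          by (intro mult_left_mono) auto
        then show ?thesis using h by (simp add: \<kappa>_def v_def abs_mult mult_ac)
      qed
      ultimately have "\<bar>E - y2 T * E2\<bar> \<le> h powr (1 - \<alpha>) * C * L * h * (h / (- \<alpha> + 1) * ((1 + T / h) powr (- \<alpha> + 1)
          - (1 + T / h - T / h) powr (- \<alpha> + 1)))"
        by (rule has_integral_abs_le[OF diff])
      also have "\<dots> \<le> h powr (1 - \<alpha>) * C * L * h * (h / (1 - \<alpha>) * (2 powr (1 - \<alpha>) * real n powr (1 - \<alpha>)))"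
      proof (intro mult_left_mono)
        have "T / h = real n" using h by (simp add: field_simps)
        moreover have "(1 + real n) powr (1 - \<alpha>) \<le> (2 * real n) powr (1 - \<alpha>)"
          using n \<alpha> by (intro powr_mono2) auto
        ultimately have "(1 + T / h) powr (- \<alpha> + 1) - (1 + T / h - T / h) powr (- \<alpha> + 1) \<le> 2 powr (1 - \<alpha>) * real n powr (1 - \<alpha>)"
          by (simp add: powr_mult)
        then have "h / (1 - \<alpha>) * ((1 + T / h) powr (- \<alpha> + 1) - (1 + T / h - T / h) powr (- \<alpha> + 1))
          \<le> h / (1 - \<alpha>) * (2 powr (1 - \<alpha>) * real n powr (1 - \<alpha>))"
          using h \<alpha> by (intro mult_left_mono) auto
        then show "h / (- \<alpha> + 1) * ((1 + T / h) powr (- \<alpha> + 1) - (1 + T / h - T / h) powr (- \<alpha> + 1))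
          \<le> h / (1 - \<alpha>) * (2 powr (1 - \<alpha>) * real n powr (1 - \<alpha>))" by simp
      qed (use C L0 h in auto)
      also have "\<dots> = C * L / (1 - \<alpha>) * (2 powr (1 - \<alpha>) * T powr (1 - \<alpha>)) * (h powr (1 - \<alpha>) * h powr (- (1 - \<alpha>)) * (h * h))"
        unfolding nh by (simp add: mult_ac)
      also have "h powr (1 - \<alpha>) * h powr (- (1 - \<alpha>)) * (h * h) = h powr 2"
        using h by (simp add: powr_add[symmetric] power2_eq_square)
      finally show ?thesis .
    qed
    ultimately have "\<bar>E\<bar> \<le> B * h powr 2"
      unfolding B_def ring_distribs by (simp only: mult.assoc)
    moreover have "(\<Sum>k<n. \<omega> k * y (real (n - k) * h)) = (\<Sum>k=0..<n. w n k * y (real (n - k) * h))"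
      by (auto simp: w lessThan_atLeast0 intro!: sum.cong)
    ultimately show ?thesis by (simp only: h_def E_def)
  qed
  have "eventually (\<lambda>n. real n \<ge> s) sequentially" by real_asymp
  then have "eventually (\<lambda>n. n > 0 \<and> real n \<ge> s \<and> \<bar>Q n\<bar> \<le> K * real n powr (- \<alpha>)) sequentially"
    using eventually_gt_at_top[of 0] K(2) by eventually_elim auto
  then show ?thesis
    unfolding approximates_caputo_with_order_def Let_def
    by (intro bigoI[where c = B]) (auto elim!: eventually_mono dest: bound)
qed

section \<open>Schemes given by second differences\<close>

text \<open>The first two weights are the second differences obtained when W is taken to be 0 at 0
  and below. The closed forms substituted for W need not vanish at 0, hence the separate conditions
  and the restriction to positive indices. The half square sum grows by W m plus half of W (m + 1) -
  W m, which is the mean of the two values.\<close>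

lemma weighted_sums_of_second_differences:
  fixes \<omega> W Q :: "nat \<Rightarrow> real"
  assumes \<omega>: "\<omega> 0 = W 1" "\<omega> 1 = W 2 - 2 * W 1"
    "\<And>k. k > 0 \<Longrightarrow> \<omega> (Suc k) = W (Suc (Suc k)) - 2 * W (Suc k) + W k"
  shows "m > 0 \<Longrightarrow> (\<Sum>k<m. \<omega> k * (real m - real k)) = W m"
    and "Q 1 = W 1 / 2 \<Longrightarrow> (\<And>m. m > 0 \<Longrightarrow> Q (Suc m) = Q m + (W m + W (Suc m)) / 2) \<Longrightarrow>
      m > 0 \<Longrightarrow> (\<Sum>k<m. \<omega> k * ((real m - real k) ^ 2 / 2)) = Q m"
proof -
  have V: "(\<Sum>k<Suc m. \<omega> k) = W (Suc m) - W m" if "m > 0" for m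
    using that
  proof (induction m rule: nat_induct_non_zero)
    case 1
    show ?case using \<omega> by (simp add: numeral_2_eq_2)
  next
    case (Suc m)
    then show ?case using \<omega>(3)[of m] by simp
  qed
  have step: "(\<Sum>k<Suc m. \<omega> k * (real (Suc m) - real k)) = (\<Sum>k<m. \<omega> k * (real m - real k)) + (\<Sum>k<Suc m. \<omega> k)" for m
    by (simp add: sum.distrib[symmetric] algebra_simps)
  show W: "(\<Sum>k<m. \<omega> k * (real m - real k)) = W m" if "m > 0" for m
    using that
  proof (induction m rule: nat_induct_non_zero)
    case 1
    show ?case using \<omega> by simp
  next
    case (Suc m)
    then show ?case using V[of m] unfolding step by simp
  qed
  have step2: "(\<Sum>k<Suc m. \<omega> k * ((real (Suc m) - real k) ^ 2 / 2)) = (\<Sum>k<m. \<omega> k * ((real m - real k) ^ 2 / 2))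
      + (\<Sum>k<m. \<omega> k * (real m - real k)) + (\<Sum>k<Suc m. \<omega> k) / 2" for m
  proof -
    have "\<omega> k * ((real (Suc m) - real k) ^ 2 / 2) =
        \<omega> k * ((real m - real k) ^ 2 / 2) + \<omega> k * (real m - real k) + \<omega> k / 2" for k
      by (simp add: power2_eq_square field_simps)
    then show ?thesis by (simp add: sum.distrib sum_divide_distrib add_divide_distrib)
  qed
  show "(\<Sum>k<m. \<omega> k * ((real m - real k) ^ 2 / 2)) = Q m"
    if "Q 1 = W 1 / 2" "\<And>m. m > 0 \<Longrightarrow> Q (Suc m) = Q m + (W m + W (Suc m)) / 2" "m > 0" for m
    using that(3)
  proof (induction m rule: nat_induct_non_zero)
    case 1
    show ?case using \<omega> that by simp
  next
    case (Suc m)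
    then show ?case using V[of m] W[of m] that(2)[of m] unfolding step2 by (simp add: field_simps)
  qed
qed

text \<open>\<open>w (Suc k) k\<close> represents the weight of index k, because Suc k is the least
  n whose sum contains it. In the applications the recurrence for \<open>Q\<close> is an identity in
  the shift, and the condition on \<open>Q 1\<close> is the equation that singles out the optimal
  one.\<close>

lemma (in vanishing_C2) second_difference_scheme:
  assumes \<alpha>: "0 < \<alpha>" "\<alpha> < 1"
    and \<omega>: "w 1 0 = W 1" "w 2 1 = W 2 - 2 * W 1"
      "\<And>k. k > 0 \<Longrightarrow> w (Suc (Suc k)) (Suc k) = W (Suc (Suc k)) - 2 * W (Suc k) + W k"
    and w: "\<And>n k. k < n \<Longrightarrow> w n k = w (Suc k) k"
    and W: "(\<lambda>m. c * W m - (real m powr (1 - \<alpha>) / Gamma (2 - \<alpha>) - s * real m powr (- \<alpha>) / Gamma (1 - \<alpha>)))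
      \<in> O(\<lambda>m. real m powr (-1 - \<alpha>))"
  shows second_difference_scheme_order_2_minus_alpha:
      "0 < t \<Longrightarrow> t \<le> T \<Longrightarrow> s < 0 \<longrightarrow> t < T \<Longrightarrow> approximates_caputo_with_order c w \<alpha> s y t (2 - \<alpha>)"
    and second_difference_scheme_order_2:
      "0 < T \<Longrightarrow> s \<ge> 0 \<Longrightarrow>
       (\<And>x. x \<in> {0..T} \<Longrightarrow> (y2 has_real_derivative y3 x) (at x within {0..T})) \<Longrightarrow>
       continuous_on {0..T} y3 \<Longrightarrow>
       Q 1 = W 1 / 2 \<Longrightarrow> (\<And>m. m > 0 \<Longrightarrow> Q (Suc m) = Q m + (W m + W (Suc m)) / 2) \<Longrightarrow>
       (\<lambda>m. c * Q m - (real m powr (2 - \<alpha>) / Gamma (3 - \<alpha>) - s * real m powr (1 - \<alpha>) / Gamma (2 - \<alpha>)))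
         \<in> O(\<lambda>m. real m powr (- \<alpha>)) \<Longrightarrow>
       approximates_caputo_with_order c w \<alpha> s y T 2"
proof -
  define \<omega> where "\<omega> = (\<lambda>k. w (Suc k) k)"
  have s1: "(\<Sum>k<m. \<omega> k * (real m - real k)) = W m" if "m > 0" for m
    using weighted_sums_of_second_differences(1)[of \<omega> W m] \<omega> that by (simp add: \<omega>_def numeral_2_eq_2)
  have W': "(\<lambda>m. c * (\<Sum>k<m. \<omega> k * (real m - real k)) - (real m powr (1 - \<alpha>) / Gamma (2 - \<alpha>) - s * real m powr (- \<alpha>) / Gamma (1 - \<alpha>)))
      \<in> O(\<lambda>m. real m powr (-1 - \<alpha>))"
    by (rule iffD2[OF landau_o.big.in_cong W])
       (use eventually_gt_at_top[of "0 :: nat"] in \<open>eventually_elim, simp add: s1\<close>)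
  show "approximates_caputo_with_order c w \<alpha> s y t (2 - \<alpha>)" if "0 < t" "t \<le> T" "s < 0 \<longrightarrow> t < T"
    by (rule approximates_caputo_order_2_minus_alpha[OF \<alpha> that W']) (unfold \<omega>_def, rule w)
  show "approximates_caputo_with_order c w \<alpha> s y T 2"
    if T: "0 < T" "s \<ge> 0" "\<And>x. x \<in> {0..T} \<Longrightarrow> (y2 has_real_derivative y3 x) (at x within {0..T})"
       "continuous_on {0..T} y3"
       and Q: "Q 1 = W 1 / 2" "\<And>m. m > 0 \<Longrightarrow> Q (Suc m) = Q m + (W m + W (Suc m)) / 2"
       and Q': "(\<lambda>m. c * Q m - (real m powr (2 - \<alpha>) / Gamma (3 - \<alpha>) - s * real m powr (1 - \<alpha>) / Gamma (2 - \<alpha>)))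
         \<in> O(\<lambda>m. real m powr (- \<alpha>))"
  proof -
    have s2: "(\<Sum>k<m. \<omega> k * ((real m - real k) ^ 2 / 2)) = Q m" if "m > 0" for m
      using \<omega> Q that
      by (intro weighted_sums_of_second_differences(2)[of \<omega> W]) (simp_all add: \<omega>_def numeral_2_eq_2)
    have Q'': "(\<lambda>m. c * (\<Sum>k<m. \<omega> k * ((real m - real k) ^ 2 / 2)) - (real m powr (2 - \<alpha>) / Gamma (3 - \<alpha>) - s * real m powr (1 - \<alpha>) / Gamma (2 - \<alpha>)))
      \<in> O(\<lambda>m. real m powr (- \<alpha>))"
      by (rule iffD2[OF landau_o.big.in_cong Q'])
         (use eventually_gt_at_top[of "0 :: nat"] in \<open>eventually_elim, simp only: s2\<close>)
    show ?thesis
      by (rule approximates_caputo_order_2[OF \<alpha> T W' Q'']) (assumption | unfold \<omega>_def, rule w)+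
  qed
qed

section \<open>Regularized power sums and their antidifferences\<close>

lemma bigo_cmult:
  fixes f :: "nat \<Rightarrow> real"
  assumes "f \<in> O(g)"
  shows "(\<lambda>x. c * f x) \<in> O(g)"
  using assms by (cases "c = 0") auto

definition zeta_error :: "real \<Rightarrow> nat \<Rightarrow> real" where
  "zeta_error p m = zeta_remainder p m - real m powr (1 - p) / (1 - p)"

lemma zeta_error_bigo:
  assumes p: "p > -1" "p \<noteq> 1" and q: "real j - p - 1 \<le> q"
  shows "(\<lambda>m. real m ^ j * zeta_error p m) \<in> O(\<lambda>m. real m powr q)"
    and "(\<lambda>m. real m ^ j * zeta_error p (2 * m)) \<in> O(\<lambda>m. real m powr q)"
proof -
  have *: "(\<lambda>m. real m ^ j * real m powr (-p - 1)) \<in> O(\<lambda>m. real m powr q)"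
  proof (rule bigoI[of _ 1])
    show "\<forall>\<^sub>F m in sequentially. norm (real m ^ j * real m powr (-p - 1)) \<le> 1 * norm (real m powr q)"
      using eventually_ge_at_top[of "1 :: nat"]
    proof eventually_elim
      case (elim m)
      then have "real m ^ j * real m powr (-p - 1) = real m powr (real j - p - 1)"
        by (simp add: powr_realpow[symmetric] powr_add[symmetric] algebra_simps)
      also have "\<dots> \<le> real m powr q" using elim q by (intro powr_mono) auto
      finally show ?case by simp
    qed
  qed
  have e: "zeta_error p \<in> O(\<lambda>m. real m powr (-p - 1))"
    using zeta_remainder_bigo[OF p] by (simp add: zeta_error_def[abs_def])
  show "(\<lambda>m. real m ^ j * zeta_error p m) \<in> O(\<lambda>m. real m powr q)"
    by (rule landau_o.big_trans[OF landau_o.big.mult[OF landau_o.big_refl e] *])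
  have "filterlim (\<lambda>m :: nat. 2 * m) at_top at_top"
    by (rule filterlim_subseq) (auto simp: strict_mono_def)
  from landau_o.big.compose[OF e this]
  have "(\<lambda>m. zeta_error p (2 * m)) \<in> O(\<lambda>m. 2 powr (-p - 1) * real m powr (-p - 1))"
    by (simp add: powr_mult)
  then have "(\<lambda>m. zeta_error p (2 * m)) \<in> O(\<lambda>m. real m powr (-p - 1))"
    by simp
  then show "(\<lambda>m. real m ^ j * zeta_error p (2 * m)) \<in> O(\<lambda>m. real m powr q)"
    by (rule landau_o.big_trans[OF landau_o.big.mult[OF landau_o.big_refl] *])
qed

lemma powr_minus_pred:
  assumes "x \<ge> 0"
  shows "x powr (- (p - 1)) = x * x powr (- p :: real)"
  using assms powr_add[of x 1 "-p"] by simp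

text \<open>The halved last terms cancel: this is the sum of (m - k) * k^-p over k \<le> m, minus m
  * \<zeta>(p), plus \<zeta>(p - 1). It is a second antidifference of k^-p with the linear and
  constant terms of its expansion removed.\<close>

definition zeta_moment :: "real \<Rightarrow> nat \<Rightarrow> real" where
  "zeta_moment p m = real m * zeta_remainder p m - zeta_remainder (p - 1) m"

lemma zeta_moment_Suc:
  assumes "m > 0"
  shows "zeta_moment p (Suc m) = zeta_moment p m + zeta_remainder p (Suc m) - real (Suc m) powr (- p) / 2"
proof -
  have e: "real k powr (- (p - 1)) = real k * real k powr (- p)" for k
    by (rule powr_minus_pred) simp
  show ?thesis
    unfolding zeta_moment_def zeta_remainder_Suc[OF assms] e
    by (simp add: algebra_simps add_divide_distrib del: of_nat_Suc) (simp add: algebra_simps)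
qed

text \<open>The increment of \<open>zeta_moment\<close> is the right end value of the remainder less
  (m + 1)^-p / 2, rather than the mean of both end values; the two differ by the increment of m^-p /
  4.\<close>

lemma zeta_moment_trapezoid:
  assumes "m > 0"
  shows "zeta_moment p (Suc m) + real (Suc m) powr (- p) / 4 =
     zeta_moment p m + real m powr (- p) / 4 + (zeta_remainder p m + zeta_remainder p (Suc m)) / 2"
  unfolding zeta_moment_Suc[OF assms] zeta_remainder_Suc[OF assms] by (simp add: field_simps)

text \<open>The regularized sum of (m - k)^2 / 2 * k^-p; the halved last terms cancel again.\<close>

definition zeta_moment2 :: "real \<Rightarrow> nat \<Rightarrow> real" where
  "zeta_moment2 p m = real m ^ 2 / 2 * zeta_remainder p m - real m * zeta_remainder (p - 1) m
     + zeta_remainder (p - 2) m / 2"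

lemma zeta_moment2_trapezoid:
  assumes "m > 0"
  shows "zeta_moment2 p (Suc m) = zeta_moment2 p m + (zeta_moment p m + zeta_moment p (Suc m)) / 2"
proof -
  have e: "real k powr (- (p - 1)) = real k * real k powr (- p)" for k p
    by (rule powr_minus_pred) simp
  have p2: "p - 2 = p - 1 - 1" by simp
  define A B where "A = real m powr (- p)" and "B = real (Suc m) powr (- p)"
  show ?thesis
    unfolding zeta_moment2_def zeta_moment_def p2 zeta_remainder_Suc[OF assms] e A_def[symmetric] B_def[symmetric]
    by (simp add: power2_eq_square algebra_simps add_divide_distrib diff_divide_distrib)
qed

text \<open>The even terms of the longer sum cancel the shorter sum, and the halved last terms
  cancel as well. What remains is the midpoint sum of (j - 1/2)^-p over j = 1, ..., m, minus (2^p -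
  1) * \<zeta>(p).\<close>

definition zeta_midpoint :: "real \<Rightarrow> nat \<Rightarrow> real" where
  "zeta_midpoint p m = 2 powr p * zeta_remainder p (2 * m) - zeta_remainder p m"

lemma zeta_midpoint_Suc:
  assumes "m > 0"
  shows "zeta_midpoint p (Suc m) = zeta_midpoint p m + 2 powr p * (2 * real m + 1) powr (- p)"
proof -
  have "zeta_remainder p (2 * Suc m) = zeta_remainder p (2 * m)
      + (real (2 * m) powr (- p) + real (Suc (2 * m)) powr (- p)) / 2
      + (real (Suc (2 * m)) powr (- p) + real (2 * Suc m) powr (- p)) / 2"
    using zeta_remainder_Suc[of "2 * m" p] zeta_remainder_Suc[of "Suc (2 * m)" p] assms by simp
  moreover have "2 powr p * real (2 * k) powr (- p) = real k powr (- p)" for k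
    by (simp add: powr_mult powr_minus)
  ultimately have "2 powr p * zeta_remainder p (2 * Suc m) = 2 powr p * zeta_remainder p (2 * m)
      + real m powr (- p) / 2 + 2 powr p * real (Suc (2 * m)) powr (- p) + real (Suc m) powr (- p) / 2"
    by (simp add: distrib_left add_divide_distrib del: of_nat_Suc mult_Suc_right)
  then show ?thesis
    unfolding zeta_midpoint_def zeta_remainder_Suc[OF assms] by (simp add: add_divide_distrib add.commute)
qed

text \<open>The new node m + 1/2 lies half a step before m + 1, so it contributes half of the
  increment of \<open>zeta_midpoint\<close>. This is exactly the trapezoidal mean, and no correction
  term appears.\<close>

lemma zeta_midpoint_trapezoid:
  assumes "m > 0"
  shows "real (Suc m) * zeta_midpoint p (Suc m) - zeta_midpoint (p - 1) (Suc m) =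
     real m * zeta_midpoint p m - zeta_midpoint (p - 1) m + (zeta_midpoint p m + zeta_midpoint p (Suc m)) / 2"
proof -
  have e1: "(2 * real m + 1) powr (- (p - 1)) = (2 * real m + 1) * (2 * real m + 1) powr (- p)"
    by (intro powr_minus_pred) simp
  have e2: "(2 :: real) powr (p - 1) = 2 powr p / 2"
    by (simp add: powr_diff)
  show ?thesis
    unfolding zeta_midpoint_Suc[OF assms] e1 e2
    by (simp add: algebra_simps add_divide_distrib)
qed

lemma zeta_remainder_1: "zeta_remainder p 1 = 1 / 2 - zeta p"
  by (simp add: zeta_remainder_def)

lemma zeta_midpoint_1: "zeta_midpoint p 1 = 2 powr p - (2 powr p - 1) * zeta p"
  using zeta_remainder_Suc[of 1 p]
  by (simp add: zeta_midpoint_def zeta_remainder_1[unfolded One_nat_def] numeral_2_eq_2[symmetric] field_simps powr_minus)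

text \<open>All main terms become rational in m times the single power P, which reduces the later
  cancellations to identities between rational expressions.\<close>

lemma zeta_remainder_expansions:
  fixes \<alpha> :: real
  assumes "m > 0"
  defines "P \<equiv> real m powr (- \<alpha>)"
  shows "zeta_remainder \<alpha> m = zeta_error \<alpha> m + real m * P / (1 - \<alpha>)"
    and "zeta_remainder (\<alpha> + 1) m = zeta_error (\<alpha> + 1) m - P / \<alpha>"
    and "zeta_remainder (\<alpha> - 1) m = zeta_error (\<alpha> - 1) m + real m ^ 2 * P / (2 - \<alpha>)"
    and "zeta_remainder (\<alpha> + 2) m = zeta_error (\<alpha> + 2) m - P / real m / (\<alpha> + 1)"
    and "real m powr (1 - \<alpha>) = real m * P" and "real m powr (2 - \<alpha>) = real m ^ 2 * P"
proof -
  show *: "real m powr (1 - \<alpha>) = real m * P" "real m powr (2 - \<alpha>) = real m ^ 2 * P"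
    using assms powr_add[of "real m" 1 "- \<alpha>"] powr_add[of "real m" 2 "- \<alpha>"] by auto
  have "real m powr (- \<alpha> - 1) = P / real m"
    using assms powr_diff[of "real m" "- \<alpha>" 1] by simp
  moreover have "1 - (\<alpha> + 2) = - \<alpha> - 1" by simp
  ultimately have "real m powr (1 - (\<alpha> + 2)) = P / real m"
    by (simp only:)
  moreover have "P / real m / (1 - (\<alpha> + 2)) = - (P / real m / (\<alpha> + 1))"
    by (subst minus_divide_right) (simp add: algebra_simps)
  ultimately show "zeta_remainder (\<alpha> + 2) m = zeta_error (\<alpha> + 2) m - P / real m / (\<alpha> + 1)"
    unfolding zeta_error_def by simp
  show "zeta_remainder \<alpha> m = zeta_error \<alpha> m + real m * P / (1 - \<alpha>)"
    "zeta_remainder (\<alpha> + 1) m = zeta_error (\<alpha> + 1) m - P / \<alpha>"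
    "zeta_remainder (\<alpha> - 1) m = zeta_error (\<alpha> - 1) m + real m ^ 2 * P / (2 - \<alpha>)"
    unfolding zeta_error_def using * by (simp_all add: P_def)
qed

lemma zeta_remainder_second_difference:
  assumes "k > 0"
  shows "zeta_remainder p (Suc (Suc k)) - 2 * zeta_remainder p (Suc k) + zeta_remainder p k
     = (real (Suc (Suc k)) powr (- p) - real k powr (- p)) / 2"
  using zeta_remainder_Suc[of k p] zeta_remainder_Suc[of "Suc k" p] assms
  by (simp add: field_simps del: of_nat_Suc)

lemma zeta_moment_second_difference:
  assumes "k > 0"
  shows "zeta_moment p (Suc (Suc k)) - 2 * zeta_moment p (Suc k) + zeta_moment p k = real (Suc k) powr (- p)"
  using zeta_moment_Suc[of k p] zeta_moment_Suc[of "Suc k" p] zeta_remainder_Suc[of "Suc k" p] assms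
  by (simp add: field_simps del: of_nat_Suc)

lemma zeta_midpoint_second_difference:
  assumes "k > 0"
  shows "zeta_midpoint p (Suc (Suc k)) - 2 * zeta_midpoint p (Suc k) + zeta_midpoint p k
     = 2 powr p * ((2 * real (Suc k) + 1) powr (- p) - (2 * real k + 1) powr (- p))"
  using zeta_midpoint_Suc[of k p] zeta_midpoint_Suc[of "Suc k" p] assms
  by (simp add: right_diff_distrib del: of_nat_Suc)

lemma zeta_remainder_2: "zeta_remainder p 2 = 1 + 2 powr (- p) / 2 - zeta p"
  using zeta_remainder_Suc[of 1 p] by (simp add: zeta_remainder_1[unfolded One_nat_def] numeral_2_eq_2[symmetric] add_divide_distrib)

lemma zeta_moment_1: "zeta_moment p 1 = zeta (p - 1) - zeta p"
  by (simp add: zeta_moment_def zeta_remainder_1[unfolded One_nat_def])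

lemma zeta_moment_2: "zeta_moment p 2 = zeta (p - 1) - 2 * zeta p + 1"
  using zeta_moment_Suc[of 1 p]
  by (simp add: zeta_moment_1[unfolded One_nat_def] zeta_remainder_2 numeral_2_eq_2[symmetric])

lemma zeta_midpoint_2: "zeta_midpoint p 2 = 2 powr p * (1 + 3 powr (- p)) - (2 powr p - 1) * zeta p"
  using zeta_midpoint_Suc[of 1 p]
  by (simp add: zeta_midpoint_1[unfolded One_nat_def] numeral_2_eq_2[symmetric] distrib_left)

section \<open>The four weight sequences as second differences\<close>

lemma L1_weights:
  fixes \<alpha> s :: real
  defines "W \<equiv> \<lambda>m. real m powr (1 - \<alpha>) + s * (\<alpha> - 1) * real m powr (- \<alpha>)"
  shows "w_L1 \<alpha> s 1 0 = W 1" "w_L1 \<alpha> s 2 1 = W 2 - 2 * W 1"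
    and "k > 0 \<Longrightarrow> w_L1 \<alpha> s (Suc (Suc k)) (Suc k) = W (Suc (Suc k)) - 2 * W (Suc k) + W k"
    and "i < n \<Longrightarrow> w_L1 \<alpha> s n i = w_L1 \<alpha> s (Suc i) i"
  by (simp_all add: W_def w_L1_def algebra_simps)

lemma central_weights:
  fixes \<alpha> s :: real
  defines "W \<equiv> \<lambda>m. 2 * zeta_remainder \<alpha> m + 2 * \<alpha> * s * zeta_remainder (\<alpha> + 1) m"
  shows "w_central \<alpha> s 1 0 = W 1" "w_central \<alpha> s 2 1 = W 2 - 2 * W 1"
    and "k > 0 \<Longrightarrow> w_central \<alpha> s (Suc (Suc k)) (Suc k) = W (Suc (Suc k)) - 2 * W (Suc k) + W k"
    and "i < n \<Longrightarrow> w_central \<alpha> s n i = w_central \<alpha> s (Suc i) i"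
proof -
  have inv: "1 / x powr a = x powr (- a)" "b / x powr a = b * x powr (- a)" for a b x :: real
    by (simp_all add: powr_minus_divide)
  show "w_central \<alpha> s 1 0 = W 1" "w_central \<alpha> s 2 1 = W 2 - 2 * W 1"
    unfolding W_def zeta_remainder_1 zeta_remainder_2 w_central_def inv
    by (simp_all add: algebra_simps)
  show "w_central \<alpha> s (Suc (Suc k)) (Suc k) = W (Suc (Suc k)) - 2 * W (Suc k) + W k" if "k > 0"
  proof -
    have "W (Suc (Suc k)) - 2 * W (Suc k) + W k =
      2 * (zeta_remainder \<alpha> (Suc (Suc k)) - 2 * zeta_remainder \<alpha> (Suc k) + zeta_remainder \<alpha> k)
      + 2 * \<alpha> * s * (zeta_remainder (\<alpha> + 1) (Suc (Suc k)) - 2 * zeta_remainder (\<alpha> + 1) (Suc k) + zeta_remainder (\<alpha> + 1) k)"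
      by (simp add: W_def algebra_simps)
    then show ?thesis
      unfolding zeta_remainder_second_difference[OF that] w_central_def inv
      using that by (simp add: algebra_simps add_divide_distrib diff_divide_distrib)
  qed
qed (simp add: w_central_def)

lemma trapezoid_weights:
  fixes \<alpha> s :: real
  defines "W \<equiv> \<lambda>m. zeta_moment (\<alpha> + 1) m + (\<alpha> + 1) * s * zeta_moment (\<alpha> + 2) m"
  shows "w_trapezoid \<alpha> s 1 0 = W 1" "w_trapezoid \<alpha> s 2 1 = W 2 - 2 * W 1"
    and "k > 0 \<Longrightarrow> w_trapezoid \<alpha> s (Suc (Suc k)) (Suc k) = W (Suc (Suc k)) - 2 * W (Suc k) + W k"
    and "i < n \<Longrightarrow> w_trapezoid \<alpha> s n i = w_trapezoid \<alpha> s (Suc i) i"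
proof -
  have inv: "1 / x powr a = x powr (- a)" "b / x powr a = b * x powr (- a)" for a b x :: real
    by (simp_all add: powr_minus_divide)
  have e: "\<alpha> + 1 - 1 = \<alpha>" "\<alpha> + 2 - 1 = \<alpha> + 1" by auto
  show "w_trapezoid \<alpha> s 1 0 = W 1" "w_trapezoid \<alpha> s 2 1 = W 2 - 2 * W 1"
    unfolding W_def zeta_moment_1 zeta_moment_2 w_trapezoid_def e
    by (simp_all add: algebra_simps)
  show "w_trapezoid \<alpha> s (Suc (Suc k)) (Suc k) = W (Suc (Suc k)) - 2 * W (Suc k) + W k" if "k > 0"
  proof -
    have "W (Suc (Suc k)) - 2 * W (Suc k) + W k =
      zeta_moment (\<alpha> + 1) (Suc (Suc k)) - 2 * zeta_moment (\<alpha> + 1) (Suc k) + zeta_moment (\<alpha> + 1) k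
      + (\<alpha> + 1) * s * (zeta_moment (\<alpha> + 2) (Suc (Suc k)) - 2 * zeta_moment (\<alpha> + 2) (Suc k) + zeta_moment (\<alpha> + 2) k)"
      by (simp add: W_def algebra_simps)
    then show ?thesis
      unfolding zeta_moment_second_difference[OF that] w_trapezoid_def inv
      using that by (simp add: algebra_simps)
  qed
qed (simp add: w_trapezoid_def)

lemma midpoint_weights:
  fixes \<alpha> s :: real
  defines "W \<equiv> \<lambda>m. zeta_midpoint \<alpha> m + \<alpha> * s * zeta_midpoint (\<alpha> + 1) m"
  shows "w_midpoint \<alpha> s 1 0 = W 1" "w_midpoint \<alpha> s 2 1 = W 2 - 2 * W 1"
    and "k > 0 \<Longrightarrow> w_midpoint \<alpha> s (Suc (Suc k)) (Suc k) = W (Suc (Suc k)) - 2 * W (Suc k) + W k"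
    and "i < n \<Longrightarrow> w_midpoint \<alpha> s n i = w_midpoint \<alpha> s (Suc i) i"
proof -
  have inv: "1 / x powr a = x powr (- a)" "b / x powr a = b * x powr (- a)" for a b x :: real
    by (simp_all add: powr_minus_divide)
  have two: "(2 :: real) powr (\<alpha> + 1) = 2 * 2 powr \<alpha>" by (simp add: powr_add)
  show "w_midpoint \<alpha> s 1 0 = W 1" "w_midpoint \<alpha> s 2 1 = W 2 - 2 * W 1"
    unfolding W_def zeta_midpoint_1 zeta_midpoint_2 w_midpoint_def two minus_diff_commute[of \<alpha> 1]
    by (simp_all add: algebra_simps)
  show "w_midpoint \<alpha> s (Suc (Suc k)) (Suc k) = W (Suc (Suc k)) - 2 * W (Suc k) + W k" if "k > 0"
  proof -
    have k: "2 * real (Suc k) - 1 = 2 * real k + 1" by simp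
    have "W (Suc (Suc k)) - 2 * W (Suc k) + W k =
      zeta_midpoint \<alpha> (Suc (Suc k)) - 2 * zeta_midpoint \<alpha> (Suc k) + zeta_midpoint \<alpha> k
      + \<alpha> * s * (zeta_midpoint (\<alpha> + 1) (Suc (Suc k)) - 2 * zeta_midpoint (\<alpha> + 1) (Suc k) + zeta_midpoint (\<alpha> + 1) k)"
      by (simp add: W_def algebra_simps)
    then show ?thesis
      unfolding zeta_midpoint_second_difference[OF that] w_midpoint_def inv two k
      using that by (simp add: algebra_simps)
  qed
qed (simp add: w_midpoint_def)

section \<open>Asymptotic expansions of the antidifferences W and Q\<close>

lemma zeta_error_bigo_shifts:
  assumes "0 < \<alpha>" "\<alpha> < 1"
  shows "zeta_error \<alpha> \<in> O(\<lambda>m. real m powr (-1 - \<alpha>))" "zeta_error (\<alpha> + 1) \<in> O(\<lambda>m. real m powr (-1 - \<alpha>))"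
    and "(\<lambda>m. real m * zeta_error (\<alpha> + 1) m) \<in> O(\<lambda>m. real m powr (-1 - \<alpha>))"
    and "(\<lambda>m. real m * zeta_error (\<alpha> + 2) m) \<in> O(\<lambda>m. real m powr (-1 - \<alpha>))"
    and "(\<lambda>m. zeta_error \<alpha> (2 * m)) \<in> O(\<lambda>m. real m powr (-1 - \<alpha>))"
    and "(\<lambda>m. zeta_error (\<alpha> + 1) (2 * m)) \<in> O(\<lambda>m. real m powr (-1 - \<alpha>))"
    and "zeta_error (\<alpha> - 1) \<in> O(\<lambda>m. real m powr (- \<alpha>))" "zeta_error \<alpha> \<in> O(\<lambda>m. real m powr (- \<alpha>))"
    and "(\<lambda>m. real m * zeta_error \<alpha> m) \<in> O(\<lambda>m. real m powr (- \<alpha>))"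
    and "(\<lambda>m. real m * zeta_error (\<alpha> + 1) m) \<in> O(\<lambda>m. real m powr (- \<alpha>))"
    and "(\<lambda>m. real m ^ 2 * zeta_error (\<alpha> + 1) m) \<in> O(\<lambda>m. real m powr (- \<alpha>))"
    and "(\<lambda>m. real m ^ 2 * zeta_error (\<alpha> + 2) m) \<in> O(\<lambda>m. real m powr (- \<alpha>))"
    and "(\<lambda>m. real m * zeta_error \<alpha> (2 * m)) \<in> O(\<lambda>m. real m powr (- \<alpha>))"
    and "(\<lambda>m. real m * zeta_error (\<alpha> + 1) (2 * m)) \<in> O(\<lambda>m. real m powr (- \<alpha>))"
    and "(\<lambda>m. zeta_error (\<alpha> - 1) (2 * m)) \<in> O(\<lambda>m. real m powr (- \<alpha>))"
    and "(\<lambda>m. zeta_error \<alpha> (2 * m)) \<in> O(\<lambda>m. real m powr (- \<alpha>))"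
    and "(\<lambda>m. real m powr (- \<alpha>)) \<in> O(\<lambda>m. real m powr (- \<alpha>))"
    and "(\<lambda>m. real m powr (-1 - \<alpha>)) \<in> O(\<lambda>m. real m powr (- \<alpha>))"
proof -
  show "(\<lambda>m. real m powr (-1 - \<alpha>)) \<in> O(\<lambda>m. real m powr (- \<alpha>))" by real_asymp
qed (use assms in \<open>auto intro!: zeta_error_bigo(1)[of _ 0, simplified] zeta_error_bigo(1)[of _ 1, simplified]
      zeta_error_bigo(1)[of _ 2, simplified] zeta_error_bigo(2)[of _ 0, simplified] zeta_error_bigo(2)[of _ 1, simplified]\<close>)

lemma zeta_midpoint_expansions:
  fixes \<alpha> :: real
  assumes "m > 0"
  defines "P \<equiv> real m powr (- \<alpha>)"
  shows "zeta_midpoint \<alpha> m = 2 powr \<alpha> * zeta_error \<alpha> (2 * m) - zeta_error \<alpha> m + real m * P / (1 - \<alpha>)"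
    and "zeta_midpoint (\<alpha> + 1) m =
      2 * 2 powr \<alpha> * zeta_error (\<alpha> + 1) (2 * m) - zeta_error (\<alpha> + 1) m - P / \<alpha>"
    and "zeta_midpoint (\<alpha> - 1) m =
      2 powr \<alpha> / 2 * zeta_error (\<alpha> - 1) (2 * m) - zeta_error (\<alpha> - 1) m + real m ^ 2 * P / (2 - \<alpha>)"
proof -
  have P2: "2 powr \<alpha> * real (2 * m) powr (- \<alpha>) = P"
    by (simp add: P_def powr_mult powr_minus)
  have two: "(2 :: real) powr (\<alpha> + 1) = 2 * 2 powr \<alpha>" "(2 :: real) powr (\<alpha> - 1) = 2 powr \<alpha> / 2"
    by (simp_all add: powr_add powr_diff)
  have m2: "2 * m > 0" using assms by simp
  have k1: "2 powr \<alpha> * (real (2 * m) * real (2 * m) powr (- \<alpha>) / (1 - \<alpha>)) = 2 * (real m * P / (1 - \<alpha>))"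
    by (subst P2[symmetric]) simp
  show "zeta_midpoint \<alpha> m = 2 powr \<alpha> * zeta_error \<alpha> (2 * m) - zeta_error \<alpha> m + real m * P / (1 - \<alpha>)"
    unfolding zeta_midpoint_def zeta_remainder_expansions(1)[where \<alpha> = \<alpha>, OF assms(1), folded P_def] zeta_remainder_expansions(1)[where \<alpha> = \<alpha>, OF m2]
      distrib_left k1 by simp
  have k2: "2 * 2 powr \<alpha> * (real (2 * m) powr (- \<alpha>) / \<alpha>) = 2 * (P / \<alpha>)"
    by (subst P2[symmetric]) simp
  show "zeta_midpoint (\<alpha> + 1) m =
      2 * 2 powr \<alpha> * zeta_error (\<alpha> + 1) (2 * m) - zeta_error (\<alpha> + 1) m - P / \<alpha>"
    unfolding zeta_midpoint_def zeta_remainder_expansions(2)[where \<alpha> = \<alpha>, OF assms(1), folded P_def] zeta_remainder_expansions(2)[where \<alpha> = \<alpha>, OF m2]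
      right_diff_distrib two k2 by simp
  have k3: "2 powr \<alpha> / 2 * (real (2 * m) ^ 2 * real (2 * m) powr (- \<alpha>) / (2 - \<alpha>)) = 2 * (real m ^ 2 * P / (2 - \<alpha>))"
    by (subst P2[symmetric]) (simp add: power2_eq_square)
  show "zeta_midpoint (\<alpha> - 1) m =
      2 powr \<alpha> / 2 * zeta_error (\<alpha> - 1) (2 * m) - zeta_error (\<alpha> - 1) m + real m ^ 2 * P / (2 - \<alpha>)"
    unfolding zeta_midpoint_def zeta_remainder_expansions(3)[where \<alpha> = \<alpha>, OF assms(1), folded P_def] zeta_remainder_expansions(3)[where \<alpha> = \<alpha>, OF m2]
      distrib_left two k3 by simp
qed

lemma bigo_cong_pos:
  fixes f g :: "nat \<Rightarrow> real"
  assumes "g \<in> O(h)" "\<And>m. m > 0 \<Longrightarrow> f m = g m"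
  shows "f \<in> O(h)"
  by (rule iffD2[OF landau_o.big.in_cong assms(1)])
     (rule eventually_mono[OF eventually_gt_at_top[of 0] assms(2)])

context
  fixes \<alpha> s :: real
  assumes \<alpha>: "0 < \<alpha>" "\<alpha> < 1"
begin

private lemma nz: "Gamma (1 - \<alpha>) \<noteq> 0" "\<alpha> \<noteq> 0" "1 - \<alpha> \<noteq> 0" "2 - \<alpha> \<noteq> 0" "\<alpha> + 1 \<noteq> 0"
  using \<alpha> less_imp_neq[OF Gamma_shifts(1)[OF \<alpha>]] by auto

private lemma Gammas: "Gamma (2 - \<alpha>) = (1 - \<alpha>) * Gamma (1 - \<alpha>)"
  "Gamma (3 - \<alpha>) = (2 - \<alpha>) * ((1 - \<alpha>) * Gamma (1 - \<alpha>))"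
  "1 / Gamma (- \<alpha>) = - \<alpha> / Gamma (1 - \<alpha>)"
  using Gamma_shifts(3-5)[OF \<alpha>] nz by auto

private lemma partial_fractions: "X / (1 - \<alpha>) - X / (2 - \<alpha>) = X / ((2 - \<alpha>) * (1 - \<alpha>))"
  "\<alpha> * (X / \<alpha>) + \<alpha> * (X / (1 - \<alpha>)) = X / (1 - \<alpha>)"
  using nz by (simp_all add: divide_simps) (simp_all add: algebra_simps)

text \<open>For L1 the expansion of W is exact. As W is a combination of powers, its trapezoidal
  antidifference consists of zeta remainders themselves, with exponents lowered by one.\<close>

lemma L1_asymptotics:
  shows "(\<lambda>m. c_L1 \<alpha> * (real m powr (1 - \<alpha>) + s * (\<alpha> - 1) * real m powr (- \<alpha>))
      - (real m powr (1 - \<alpha>) / Gamma (2 - \<alpha>) - s * real m powr (- \<alpha>) / Gamma (1 - \<alpha>)))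
      \<in> O(\<lambda>m. real m powr (-1 - \<alpha>))" (is ?W)
    and "(\<lambda>m. c_L1 \<alpha> * (zeta_remainder (\<alpha> - 1) m + s * (\<alpha> - 1) * zeta_remainder \<alpha> m)
      - (real m powr (2 - \<alpha>) / Gamma (3 - \<alpha>) - s * real m powr (1 - \<alpha>) / Gamma (2 - \<alpha>)))
      \<in> O(\<lambda>m. real m powr (- \<alpha>))" (is ?Q)
proof -
  show ?W
  proof (rule bigo_cong_pos[of "\<lambda>_. 0"])
    have "1 / (a * g) * (A + s * (\<alpha> - 1) * P) - (A / (a * g) - s * P / g) = 0"
      if "g \<noteq> 0" "a \<noteq> 0" "\<alpha> - 1 = - a" for A P g a :: real
      unfolding that(3) using that(1,2) by (simp add: field_simps)
    from this[OF nz(1,3)] show "c_L1 \<alpha> * (real m powr (1 - \<alpha>) + s * (\<alpha> - 1) * real m powr (- \<alpha>))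
      - (real m powr (1 - \<alpha>) / Gamma (2 - \<alpha>) - s * real m powr (- \<alpha>) / Gamma (1 - \<alpha>)) = 0" for m
      unfolding c_L1_def Gammas by simp
  qed simp
  show ?Q
  proof (rule bigo_cong_pos)
    \<comment> \<open>The identity is proved for arbitrary reals: x stands for m, P for m^-\<alpha>,
      a and b for 1 - \<alpha> and 2 - \<alpha>, g for \<Gamma>(1 - \<alpha>), and e0 and em for the
      zeta errors at \<alpha> and \<alpha> - 1. The main terms cancel and only errors remain; the
      other schemes follow the same pattern.\<close>
    have "1 / (a * g) * (em + x ^ 2 * P / b + s * (\<alpha> - 1) * (e0 + x * P / a)) - (x ^ 2 * P / (b * (a * g)) - s * (x * P) / (a * g))
       = 1 / (a * g) * em + s * (\<alpha> - 1) / (a * g) * e0"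
      if "g \<noteq> 0" "a \<noteq> 0" "b \<noteq> 0" "\<alpha> - 1 = - a" for x P g a b em e0 :: real
      unfolding that(4) using that(1-3) by (simp add: field_simps)
    from this[OF nz(1,3,4)] show "c_L1 \<alpha> * (zeta_remainder (\<alpha> - 1) m + s * (\<alpha> - 1) * zeta_remainder \<alpha> m)
      - (real m powr (2 - \<alpha>) / Gamma (3 - \<alpha>) - s * real m powr (1 - \<alpha>) / Gamma (2 - \<alpha>))
      = 1 / ((1 - \<alpha>) * Gamma (1 - \<alpha>)) * zeta_error (\<alpha> - 1) m
        + s * (\<alpha> - 1) / ((1 - \<alpha>) * Gamma (1 - \<alpha>)) * zeta_error \<alpha> m" if "m > 0" for m
      unfolding c_L1_def Gammas zeta_remainder_expansions[where \<alpha> = \<alpha>, OF that] by simp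
    show "(\<lambda>m. 1 / ((1 - \<alpha>) * Gamma (1 - \<alpha>)) * zeta_error (\<alpha> - 1) m
        + s * (\<alpha> - 1) / ((1 - \<alpha>) * Gamma (1 - \<alpha>)) * zeta_error \<alpha> m) \<in> O(\<lambda>m. real m powr (- \<alpha>))"
      by (intro sum_in_bigo bigo_cmult zeta_error_bigo_shifts[OF \<alpha>])
  qed
qed

lemma central_asymptotics:
  shows "(\<lambda>m. c_central \<alpha> * (2 * zeta_remainder \<alpha> m + 2 * \<alpha> * s * zeta_remainder (\<alpha> + 1) m)
      - (real m powr (1 - \<alpha>) / Gamma (2 - \<alpha>) - s * real m powr (- \<alpha>) / Gamma (1 - \<alpha>)))
      \<in> O(\<lambda>m. real m powr (-1 - \<alpha>))" (is ?W)
    and "(\<lambda>m. c_central \<alpha> * (2 * (zeta_moment \<alpha> m + real m powr (- \<alpha>) / 4)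
        + 2 * \<alpha> * s * (zeta_moment (\<alpha> + 1) m + real m powr (- (\<alpha> + 1)) / 4))
      - (real m powr (2 - \<alpha>) / Gamma (3 - \<alpha>) - s * real m powr (1 - \<alpha>) / Gamma (2 - \<alpha>)))
      \<in> O(\<lambda>m. real m powr (- \<alpha>))" (is ?Q)
proof -
  define g where "g = Gamma (1 - \<alpha>)"
  show ?W
  proof (rule bigo_cong_pos)
    have "1 / (2 * g) * (2 * (e0 + x * P / a) + 2 * \<alpha> * s * (e1 - P / \<alpha>)) - (x * P / (a * g) - s * P / g)
        = 1 / g * e0 + \<alpha> * s / g * e1"
      if "g \<noteq> 0" "a \<noteq> 0" for x P g a e0 e1 :: real
      using that nz(2) by (simp add: field_simps)
    from this[OF nz(1,3)] show "c_central \<alpha> * (2 * zeta_remainder \<alpha> m + 2 * \<alpha> * s * zeta_remainder (\<alpha> + 1) m)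
      - (real m powr (1 - \<alpha>) / Gamma (2 - \<alpha>) - s * real m powr (- \<alpha>) / Gamma (1 - \<alpha>))
      = 1 / g * zeta_error \<alpha> m + \<alpha> * s / g * zeta_error (\<alpha> + 1) m" if "m > 0" for m
      unfolding c_central_def Gammas zeta_remainder_expansions[where \<alpha> = \<alpha>, OF that] g_def .
    show "(\<lambda>m. 1 / g * zeta_error \<alpha> m + \<alpha> * s / g * zeta_error (\<alpha> + 1) m) \<in> O(\<lambda>m. real m powr (-1 - \<alpha>))"
      by (intro sum_in_bigo bigo_cmult zeta_error_bigo_shifts[OF \<alpha>])
  qed
  show ?Q
  proof (rule bigo_cong_pos)
    have "1 / (2 * g) * (2 * (x * (e0 + x * P / a) - (em + x ^ 2 * P / b) + P / 4)
        + 2 * \<alpha> * s * (x * (e1 - P / \<alpha>) - (e0 + x * P / a) + P' / 4))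
      - (x ^ 2 * P / (b * (a * g)) - s * (x * P) / (a * g))
      = 1 / g * (x * e0 - em + 1 / 4 * P) + \<alpha> * s / g * (x * e1 - e0 + 1 / 4 * P')"
      if "g \<noteq> 0" "a \<noteq> 0" "b \<noteq> 0" "a = 1 - \<alpha>" "b = 2 - \<alpha>" for x P P' g a b e0 e1 em :: real
    proof -
      \<comment> \<open>The main terms are matched separately: this equation settles those of order
        m^(2 - \<alpha>), the next one those of order m^(1 - \<alpha>).\<close>
      have 1: "x * (x * P / a) - x ^ 2 * P / b = x ^ 2 * P / (b * a)"
        using partial_fractions(1)[of "x ^ 2 * P"] that by (simp add: power2_eq_square mult_ac)
      have 2: "\<alpha> * s * (x * (P / \<alpha>) + x * P / a) = s * (x * P) / a"
        using partial_fractions(2)[of "s * (x * P)"] unfolding \<open>a = 1 - \<alpha>\<close> by (simp add: algebra_simps)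
      have "1 / (2 * g) * (2 * (x * (e0 + x * P / a) - (em + x ^ 2 * P / b) + P / 4)
        + 2 * \<alpha> * s * (x * (e1 - P / \<alpha>) - (e0 + x * P / a) + P' / 4))
        = 1 / g * (x * e0 - em + 1 / 4 * P) + \<alpha> * s / g * (x * e1 - e0 + 1 / 4 * P')
         + 1 / g * ((x * (x * P / a) - x ^ 2 * P / b) - \<alpha> * s * (x * (P / \<alpha>) + x * P / a))"
        using \<open>g \<noteq> 0\<close> by (simp add: divide_simps) (simp add: algebra_simps)
      then show ?thesis unfolding 1 2 using that(1-3) by (simp add: diff_divide_distrib)
    qed
    from this[OF nz(1,3,4) refl refl] show "c_central \<alpha> * (2 * (zeta_moment \<alpha> m + real m powr (- \<alpha>) / 4)
        + 2 * \<alpha> * s * (zeta_moment (\<alpha> + 1) m + real m powr (- (\<alpha> + 1)) / 4))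
      - (real m powr (2 - \<alpha>) / Gamma (3 - \<alpha>) - s * real m powr (1 - \<alpha>) / Gamma (2 - \<alpha>))
      = 1 / g * (real m * zeta_error \<alpha> m - zeta_error (\<alpha> - 1) m + 1 / 4 * real m powr (- \<alpha>))
       + \<alpha> * s / g * (real m * zeta_error (\<alpha> + 1) m - zeta_error \<alpha> m + 1 / 4 * real m powr (- (\<alpha> + 1)))" if "m > 0" for m
      unfolding c_central_def Gammas zeta_moment_def add_diff_cancel_right' zeta_remainder_expansions[where \<alpha> = \<alpha>, OF that] g_def .
    have e: "- (\<alpha> + 1) = -1 - \<alpha>" by simp
    show "(\<lambda>m. 1 / g * (real m * zeta_error \<alpha> m - zeta_error (\<alpha> - 1) m + 1 / 4 * real m powr (- \<alpha>))
       + \<alpha> * s / g * (real m * zeta_error (\<alpha> + 1) m - zeta_error \<alpha> m + 1 / 4 * real m powr (- (\<alpha> + 1))))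
       \<in> O(\<lambda>m. real m powr (- \<alpha>))"
      unfolding e by (intro sum_in_bigo bigo_cmult zeta_error_bigo_shifts[OF \<alpha>])
  qed
qed

lemma trapezoid_asymptotics:
  shows "(\<lambda>m. c_trapezoid \<alpha> * (zeta_moment (\<alpha> + 1) m + (\<alpha> + 1) * s * zeta_moment (\<alpha> + 2) m)
      - (real m powr (1 - \<alpha>) / Gamma (2 - \<alpha>) - s * real m powr (- \<alpha>) / Gamma (1 - \<alpha>)))
      \<in> O(\<lambda>m. real m powr (-1 - \<alpha>))" (is ?W)
    and "(\<lambda>m. c_trapezoid \<alpha> * (zeta_moment2 (\<alpha> + 1) m + (\<alpha> + 1) * s * zeta_moment2 (\<alpha> + 2) m)
      - (real m powr (2 - \<alpha>) / Gamma (3 - \<alpha>) - s * real m powr (1 - \<alpha>) / Gamma (2 - \<alpha>)))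
      \<in> O(\<lambda>m. real m powr (- \<alpha>))" (is ?Q)
proof -
  define g where "g = Gamma (1 - \<alpha>)"
  have e: "\<alpha> + 1 - 1 = \<alpha>" "\<alpha> + 2 - 1 = \<alpha> + 1" "\<alpha> + 1 - 2 = \<alpha> - 1" "\<alpha> + 2 - 2 = \<alpha>" by auto
  show ?W
  proof (rule bigo_cong_pos)
    \<comment> \<open>The factor -\<alpha> / g is 1 / \<Gamma>(-\<alpha>), b stands for \<alpha> +
      1, and e2 for the zeta error at \<alpha> + 2.\<close>
    have key: "- \<alpha> / g * (x * (e1 - P / \<alpha>) - (e0 + x * P / a) + b * s * (x * (e2 - P / x / b) - (e1 - P / \<alpha>)))
        - (x * P / (a * g) - s * P / g)
        = - \<alpha> / g * (x * e1 - e0 + b * s * (x * e2 - e1))"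
      if "x \<noteq> 0" "g \<noteq> 0" "a \<noteq> 0" "b \<noteq> 0" "a = 1 - \<alpha>" "b = \<alpha> + 1" for x P g a b e0 e1 e2 :: real
    proof -
      have 1: "\<alpha> * (x * (P / \<alpha>) + x * P / a) = x * P / a"
        using partial_fractions(2)[of "x * P"] unfolding \<open>a = 1 - \<alpha>\<close> by (simp add: algebra_simps)
      have 2: "\<alpha> * (b * s * (x * (P / x / b) - P / \<alpha>)) = - s * P"
      proof -
        have "x * (P / x / b) = P / b" using that(1) by simp
        moreover have "\<alpha> * (b * s * (P / b - P / \<alpha>)) = s * P * (\<alpha> - b)"
          using that(4) nz(2) by (simp add: field_simps)
        ultimately show ?thesis using that(6) by simp
      qed
      have "- \<alpha> / g * (x * (e1 - P / \<alpha>) - (e0 + x * P / a) + b * s * (x * (e2 - P / x / b) - (e1 - P / \<alpha>)))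
        = - \<alpha> / g * (x * e1 - e0 + b * s * (x * e2 - e1))
          + 1 / g * (\<alpha> * (x * (P / \<alpha>) + x * P / a) + \<alpha> * (b * s * (x * (P / x / b) - P / \<alpha>)))"
        by (simp add: ring_distribs diff_divide_distrib add_divide_distrib)
      then show ?thesis unfolding 1 2 using that(1-4) by (simp add: diff_divide_distrib)
    qed
    show "c_trapezoid \<alpha> * (zeta_moment (\<alpha> + 1) m + (\<alpha> + 1) * s * zeta_moment (\<alpha> + 2) m)
      - (real m powr (1 - \<alpha>) / Gamma (2 - \<alpha>) - s * real m powr (- \<alpha>) / Gamma (1 - \<alpha>))
      = - \<alpha> / g * (real m * zeta_error (\<alpha> + 1) m - zeta_error \<alpha> m
          + (\<alpha> + 1) * s * (real m * zeta_error (\<alpha> + 2) m - zeta_error (\<alpha> + 1) m))" if "m > 0" for m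
      unfolding c_trapezoid_def Gammas zeta_moment_def e zeta_remainder_expansions[where \<alpha> = \<alpha>, OF that] g_def
      by (rule key[OF _ nz(1,3,5) refl refl]) (use that in simp)
    show "(\<lambda>m. - \<alpha> / g * (real m * zeta_error (\<alpha> + 1) m - zeta_error \<alpha> m
          + (\<alpha> + 1) * s * (real m * zeta_error (\<alpha> + 2) m - zeta_error (\<alpha> + 1) m))) \<in> O(\<lambda>m. real m powr (-1 - \<alpha>))"
      by (intro sum_in_bigo bigo_cmult zeta_error_bigo_shifts[OF \<alpha>])
  qed
  show ?Q
  proof (rule bigo_cong_pos)
    have key: "- \<alpha> / g * (x ^ 2 / 2 * (e1 - P / \<alpha>) - x * (e0 + x * P / a) + (em + x ^ 2 * P / d) / 2
          + b * s * (x ^ 2 / 2 * (e2 - P / x / b) - x * (e1 - P / \<alpha>) + (e0 + x * P / a) / 2))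
        - (x ^ 2 * P / (d * (a * g)) - s * (x * P) / (a * g))
        = - \<alpha> / g * (1 / 2 * (x ^ 2 * e1) - x * e0 + 1 / 2 * em + b * s * (1 / 2 * (x ^ 2 * e2) - x * e1 + 1 / 2 * e0))"
      if "x \<noteq> 0" "g \<noteq> 0" "a \<noteq> 0" "d \<noteq> 0" "b \<noteq> 0" "a = 1 - \<alpha>" "b = \<alpha> + 1" "d = 2 - \<alpha>"
      for x P g a b d em e0 e1 e2 :: real
    proof -
      have 1: "\<alpha> * (x ^ 2 / 2 * (P / \<alpha>) + x * (x * P / a) - x ^ 2 * P / d / 2) = x ^ 2 * P / (d * a)"
      proof -
        have *: "\<alpha> * (1 / (2 * \<alpha>) + 1 / a - 1 / (2 * d)) = 1 / (d * a)"
          using nz(2) that(3,4) unfolding that(6,8) by (simp add: divide_simps) (simp add: algebra_simps)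
        have "\<alpha> * (x ^ 2 / 2 * (P / \<alpha>) + x * (x * P / a) - x ^ 2 * P / d / 2) =
           x ^ 2 * P * (\<alpha> * (1 / (2 * \<alpha>) + 1 / a - 1 / (2 * d)))"
          by (simp add: power2_eq_square algebra_simps)
        then show ?thesis unfolding * by simp
      qed
      have 2: "\<alpha> * (b * s * (x ^ 2 / 2 * (P / x / b) - x * (P / \<alpha>) - x * P / a / 2)) = - s * (x * P) / a"
      proof -
        have *: "\<alpha> * (b * (1 / (2 * b) - 1 / \<alpha> - 1 / (2 * a))) = - 1 / a"
          using nz(2) that(3,5) unfolding that(6,7) by (simp add: divide_simps) (simp add: algebra_simps)
        have "\<alpha> * (b * s * (x ^ 2 / 2 * (P / x / b) - x * (P / \<alpha>) - x * P / a / 2)) =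
            s * (x * P) * (\<alpha> * (b * (1 / (2 * b) - 1 / \<alpha> - 1 / (2 * a))))"
          using that(1) by (simp add: power2_eq_square algebra_simps)
        then show ?thesis unfolding * by simp
      qed
      have "- \<alpha> / g * (x ^ 2 / 2 * (e1 - P / \<alpha>) - x * (e0 + x * P / a) + (em + x ^ 2 * P / d) / 2
          + b * s * (x ^ 2 / 2 * (e2 - P / x / b) - x * (e1 - P / \<alpha>) + (e0 + x * P / a) / 2))
        = - \<alpha> / g * (1 / 2 * (x ^ 2 * e1) - x * e0 + 1 / 2 * em + b * s * (1 / 2 * (x ^ 2 * e2) - x * e1 + 1 / 2 * e0))
          + 1 / g * (\<alpha> * (x ^ 2 / 2 * (P / \<alpha>) + x * (x * P / a) - x ^ 2 * P / d / 2)
             + \<alpha> * (b * s * (x ^ 2 / 2 * (P / x / b) - x * (P / \<alpha>) - x * P / a / 2)))"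
        by (simp add: ring_distribs diff_divide_distrib add_divide_distrib)
      then show ?thesis unfolding 1 2 using that(2-4) by (simp add: diff_divide_distrib)
    qed
    show "c_trapezoid \<alpha> * (zeta_moment2 (\<alpha> + 1) m + (\<alpha> + 1) * s * zeta_moment2 (\<alpha> + 2) m)
      - (real m powr (2 - \<alpha>) / Gamma (3 - \<alpha>) - s * real m powr (1 - \<alpha>) / Gamma (2 - \<alpha>))
      = - \<alpha> / g * (1 / 2 * (real m ^ 2 * zeta_error (\<alpha> + 1) m) - real m * zeta_error \<alpha> m + 1 / 2 * zeta_error (\<alpha> - 1) m
        + (\<alpha> + 1) * s * (1 / 2 * (real m ^ 2 * zeta_error (\<alpha> + 2) m) - real m * zeta_error (\<alpha> + 1) m + 1 / 2 * zeta_error \<alpha> m))"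
      if "m > 0" for m
      unfolding c_trapezoid_def Gammas zeta_moment2_def e zeta_remainder_expansions[where \<alpha> = \<alpha>, OF that] g_def
      by (rule key[OF _ nz(1,3,4,5) refl refl refl]) (use that in simp)
    show "(\<lambda>m. - \<alpha> / g * (1 / 2 * (real m ^ 2 * zeta_error (\<alpha> + 1) m) - real m * zeta_error \<alpha> m + 1 / 2 * zeta_error (\<alpha> - 1) m
        + (\<alpha> + 1) * s * (1 / 2 * (real m ^ 2 * zeta_error (\<alpha> + 2) m) - real m * zeta_error (\<alpha> + 1) m + 1 / 2 * zeta_error \<alpha> m)))
        \<in> O(\<lambda>m. real m powr (- \<alpha>))"
      by (intro sum_in_bigo bigo_cmult zeta_error_bigo_shifts[OF \<alpha>])
  qed
qed

lemma midpoint_asymptotics: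
  shows "(\<lambda>m. c_midpoint \<alpha> * (zeta_midpoint \<alpha> m + \<alpha> * s * zeta_midpoint (\<alpha> + 1) m)
      - (real m powr (1 - \<alpha>) / Gamma (2 - \<alpha>) - s * real m powr (- \<alpha>) / Gamma (1 - \<alpha>)))
      \<in> O(\<lambda>m. real m powr (-1 - \<alpha>))" (is ?W)
    and "(\<lambda>m. c_midpoint \<alpha> * (real m * zeta_midpoint \<alpha> m - zeta_midpoint (\<alpha> - 1) m
        + \<alpha> * s * (real m * zeta_midpoint (\<alpha> + 1) m - zeta_midpoint \<alpha> m))
      - (real m powr (2 - \<alpha>) / Gamma (3 - \<alpha>) - s * real m powr (1 - \<alpha>) / Gamma (2 - \<alpha>)))
      \<in> O(\<lambda>m. real m powr (- \<alpha>))" (is ?Q)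
proof -
  define g where "g = Gamma (1 - \<alpha>)"
  show ?W
  proof (rule bigo_cong_pos)
    have "1 / g * ((e0 + x * P / a) + \<alpha> * s * (e1 - P / \<alpha>)) - (x * P / (a * g) - s * P / g)
        = 1 / g * (e0 + \<alpha> * s * e1)"
      if "g \<noteq> 0" "a \<noteq> 0" for x P g a e0 e1 :: real
      using that nz(2) by (simp add: field_simps)
    from this[OF nz(1,3)] show "c_midpoint \<alpha> * (zeta_midpoint \<alpha> m + \<alpha> * s * zeta_midpoint (\<alpha> + 1) m)
      - (real m powr (1 - \<alpha>) / Gamma (2 - \<alpha>) - s * real m powr (- \<alpha>) / Gamma (1 - \<alpha>))
      = 1 / g * (2 powr \<alpha> * zeta_error \<alpha> (2 * m) - zeta_error \<alpha> m
         + \<alpha> * s * (2 * 2 powr \<alpha> * zeta_error (\<alpha> + 1) (2 * m) - zeta_error (\<alpha> + 1) m))" if "m > 0" for m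
      unfolding c_midpoint_def Gammas zeta_midpoint_expansions[where \<alpha> = \<alpha>, OF that] zeta_remainder_expansions(5)[where \<alpha> = \<alpha>, OF that] g_def .
    show "(\<lambda>m. 1 / g * (2 powr \<alpha> * zeta_error \<alpha> (2 * m) - zeta_error \<alpha> m
         + \<alpha> * s * (2 * 2 powr \<alpha> * zeta_error (\<alpha> + 1) (2 * m) - zeta_error (\<alpha> + 1) m))) \<in> O(\<lambda>m. real m powr (-1 - \<alpha>))"
      by (intro sum_in_bigo bigo_cmult zeta_error_bigo_shifts[OF \<alpha>])
  qed
  show ?Q
  proof (rule bigo_cong_pos)
    \<comment> \<open>A0, A1 and Am stand for the zeta errors at the doubled argument 2 m, including
      their powers of 2; e0, e1 and em are the errors at m.\<close>
    have "1 / g * (x * (A0 - e0 + x * P / a) - (Am - em + x ^ 2 * P / b)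
        + \<alpha> * s * (x * (A1 - e1 - P / \<alpha>) - (A0 - e0 + x * P / a)))
      - (x ^ 2 * P / (b * (a * g)) - s * (x * P) / (a * g))
      = 1 / g * (x * A0 - x * e0 - (Am - em) + \<alpha> * s * (x * A1 - x * e1 - (A0 - e0)))"
      if "g \<noteq> 0" "a \<noteq> 0" "b \<noteq> 0" "a = 1 - \<alpha>" "b = 2 - \<alpha>" for x P g a b A0 A1 Am e0 e1 em :: real
    proof -
      have 1: "x * (x * P / a) - x ^ 2 * P / b = x ^ 2 * P / (b * a)"
        using partial_fractions(1)[of "x ^ 2 * P"] that by (simp add: power2_eq_square mult_ac)
      have 2: "\<alpha> * s * (x * (P / \<alpha>) + x * P / a) = s * (x * P) / a"
        using partial_fractions(2)[of "s * (x * P)"] unfolding \<open>a = 1 - \<alpha>\<close> by (simp add: algebra_simps)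
      have "1 / g * (x * (A0 - e0 + x * P / a) - (Am - em + x ^ 2 * P / b)
        + \<alpha> * s * (x * (A1 - e1 - P / \<alpha>) - (A0 - e0 + x * P / a)))
        = 1 / g * (x * A0 - x * e0 - (Am - em) + \<alpha> * s * (x * A1 - x * e1 - (A0 - e0)))
         + 1 / g * ((x * (x * P / a) - x ^ 2 * P / b) - \<alpha> * s * (x * (P / \<alpha>) + x * P / a))"
        by (simp add: ring_distribs diff_divide_distrib add_divide_distrib)
      then show ?thesis unfolding 1 2 using that(1-3) by (simp add: diff_divide_distrib)
    qed
    from this[OF nz(1,3,4) refl refl] show "c_midpoint \<alpha> * (real m * zeta_midpoint \<alpha> m - zeta_midpoint (\<alpha> - 1) m
        + \<alpha> * s * (real m * zeta_midpoint (\<alpha> + 1) m - zeta_midpoint \<alpha> m))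
      - (real m powr (2 - \<alpha>) / Gamma (3 - \<alpha>) - s * real m powr (1 - \<alpha>) / Gamma (2 - \<alpha>))
      = 1 / g * (real m * (2 powr \<alpha> * zeta_error \<alpha> (2 * m)) - real m * zeta_error \<alpha> m
         - (2 powr \<alpha> / 2 * zeta_error (\<alpha> - 1) (2 * m) - zeta_error (\<alpha> - 1) m)
         + \<alpha> * s * (real m * (2 * 2 powr \<alpha> * zeta_error (\<alpha> + 1) (2 * m)) - real m * zeta_error (\<alpha> + 1) m
           - (2 powr \<alpha> * zeta_error \<alpha> (2 * m) - zeta_error \<alpha> m)))" if "m > 0" for m
      unfolding c_midpoint_def Gammas zeta_midpoint_expansions[where \<alpha> = \<alpha>, OF that] zeta_remainder_expansions(5,6)[where \<alpha> = \<alpha>, OF that] g_def .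
    have comm: "real m * (c * z) = c * (real m * z)" for m c z by simp
    show "(\<lambda>m. 1 / g * (real m * (2 powr \<alpha> * zeta_error \<alpha> (2 * m)) - real m * zeta_error \<alpha> m
         - (2 powr \<alpha> / 2 * zeta_error (\<alpha> - 1) (2 * m) - zeta_error (\<alpha> - 1) m)
         + \<alpha> * s * (real m * (2 * 2 powr \<alpha> * zeta_error (\<alpha> + 1) (2 * m)) - real m * zeta_error (\<alpha> + 1) m
           - (2 powr \<alpha> * zeta_error \<alpha> (2 * m) - zeta_error \<alpha> m)))) \<in> O(\<lambda>m. real m powr (- \<alpha>))"
      unfolding comm by (intro sum_in_bigo bigo_cmult zeta_error_bigo_shifts[OF \<alpha>])
  qed
qed

end

section \<open>Signs of zeta values and the optimal shifts\<close>

lemma zeta_signs: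
  assumes "0 < \<alpha>" "\<alpha> < 1"
  shows "zeta (\<alpha> - 1) < 0" "zeta \<alpha> < 2 * zeta (\<alpha> - 1)" "zeta \<alpha> < 0" "zeta (\<alpha> + 1) > 0"
proof -
  have "1 / 2 < 1 / (1 - (\<alpha> - 1))"
    using assms by (simp add: field_simps)
  moreover have "zeta (\<alpha> - 1) \<le> 1 / 2 - 1 / (1 - (\<alpha> - 1))"
    using assms by (intro zeta_bounds(3)) auto
  ultimately show 1: "zeta (\<alpha> - 1) < 0" by linarith
  \<comment> \<open>The upper bound for \<zeta>(\<alpha>) and the lower bound for \<zeta>(\<alpha> -
    1) give 16 \<zeta>(\<alpha> - 1) - 8 \<zeta>(\<alpha>) \<ge> 2 + \<alpha> + 8 (A - 2 B), so it
    is enough to compare the pole terms A and 2 B.\<close>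
  define A B where "A = 1 / (1 - \<alpha>)" and "B = 1 / (2 - \<alpha>)"
  have "A - 2 * B = \<alpha> / ((1 - \<alpha>) * (2 - \<alpha>))"
    using assms unfolding A_def B_def by (simp add: divide_simps)
  also have "\<alpha> / ((1 - \<alpha>) * (2 - \<alpha>)) > 0" using assms by simp
  finally have "A - 2 * B > 0" .
  moreover have "zeta \<alpha> \<le> 1 / 2 - A + \<alpha> / 8"
    using zeta_bounds(2)[of \<alpha>] assms by (simp add: A_def)
  then have "8 * zeta \<alpha> \<le> 4 - 8 * A + \<alpha>" by simp
  moreover have "zeta (\<alpha> - 1) \<ge> 1 / 2 - B + (\<alpha> - 1) / 8"
    using zeta_bounds(4)[of "\<alpha> - 1"] assms by (simp add: B_def)
  then have "8 * zeta (\<alpha> - 1) \<ge> 4 - 8 * B + (\<alpha> - 1)" by (simp add: field_simps)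
  ultimately show 2: "zeta \<alpha> < 2 * zeta (\<alpha> - 1)"
    using assms by linarith
  show "zeta \<alpha> < 0" using 1 2 by linarith
  have "1 / (1 - (\<alpha> + 1)) < 0" using assms by simp
  moreover have "zeta (\<alpha> + 1) \<ge> 1 / 2 - 1 / (1 - (\<alpha> + 1))"
    using assms by (intro zeta_bounds(1)) auto
  ultimately show "zeta (\<alpha> + 1) > 0" by linarith
qed

text \<open>In each quotient numerator and denominator are nonzero and have the same sign.
  Nonnegativity keeps the shifted point from passing t; the product forms are the equations into
  which the initial condition on \<open>Q\<close> will turn.\<close>

lemma optimal_shifts:
  assumes \<alpha>: "0 < \<alpha>" "\<alpha> < 1"
  shows "shift_trapezoid \<alpha> \<ge> 0" "shift_L1 \<alpha> \<ge> 0" "shift_central \<alpha> \<ge> 0" "shift_midpoint \<alpha> \<ge> 0"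
    and "(\<alpha> + 1) * shift_trapezoid \<alpha> * (zeta \<alpha> - zeta (\<alpha> + 1)) = zeta \<alpha> - zeta (\<alpha> - 1)"
    and "shift_L1 \<alpha> * (1 - \<alpha>) * zeta \<alpha> = zeta (\<alpha> - 1)"
    and "\<alpha> * shift_central \<alpha> * (zeta (\<alpha> + 1) - 2 * zeta \<alpha>) = 2 * zeta (\<alpha> - 1) - zeta \<alpha>"
    and "\<alpha> * shift_midpoint \<alpha> * ((2 powr (\<alpha> + 1) - 2) * zeta \<alpha> - (2 powr (\<alpha> + 1) - 1) * zeta (\<alpha> + 1))
      = (2 powr \<alpha> - 1) * zeta \<alpha> - (2 powr \<alpha> - 2) * zeta (\<alpha> - 1)"
proof -
  note z = zeta_signs[OF \<alpha>]
  have p: "2 powr \<alpha> > (1 :: real)" "2 powr \<alpha> < (2 :: real)" "2 powr (\<alpha> + 1) > (2 :: real)"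
    using \<alpha> powr_less_mono[of 0 \<alpha> "2 :: real"] powr_less_mono[of \<alpha> 1 "2 :: real"] powr_less_mono[of 1 "\<alpha> + 1" "2 :: real"]
    by auto
  have d1: "(1 + \<alpha>) * (zeta \<alpha> - zeta (1 + \<alpha>)) < 0"
    using \<alpha> z by (intro mult_pos_neg) (auto simp: add.commute)
  have n1: "zeta \<alpha> - zeta (\<alpha> - 1) \<le> 0" using z by linarith
  show "shift_trapezoid \<alpha> \<ge> 0"
    unfolding shift_trapezoid_def using n1 d1 by (intro divide_nonpos_neg)
  show "(\<alpha> + 1) * shift_trapezoid \<alpha> * (zeta \<alpha> - zeta (\<alpha> + 1)) = zeta \<alpha> - zeta (\<alpha> - 1)"
  proof -
    have "\<alpha> + 1 \<noteq> 0" "zeta \<alpha> - zeta (\<alpha> + 1) \<noteq> 0" using \<alpha> z by linarith+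
    then show ?thesis unfolding shift_trapezoid_def add.commute[of 1 \<alpha>] by simp
  qed
  show "shift_L1 \<alpha> \<ge> 0"
    unfolding shift_L1_def using \<alpha> z by (intro divide_nonpos_neg mult_pos_neg) auto
  show "shift_L1 \<alpha> * (1 - \<alpha>) * zeta \<alpha> = zeta (\<alpha> - 1)"
    unfolding shift_L1_def using \<alpha> z by simp
  have d3: "\<alpha> * (zeta (\<alpha> + 1) - 2 * zeta \<alpha>) > 0"
    using \<alpha> z by (intro mult_pos_pos) linarith+
  show "shift_central \<alpha> \<ge> 0"
    unfolding shift_central_def using z d3 by (intro divide_nonneg_pos) linarith+
  show "\<alpha> * shift_central \<alpha> * (zeta (\<alpha> + 1) - 2 * zeta \<alpha>) = 2 * zeta (\<alpha> - 1) - zeta \<alpha>"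
  proof -
    have "\<alpha> \<noteq> 0" "zeta (\<alpha> + 1) - 2 * zeta \<alpha> \<noteq> 0" using \<alpha> z by linarith+
    then show ?thesis unfolding shift_central_def by simp
  qed
  have "(2 powr (\<alpha> + 1) - 2) * zeta \<alpha> < 0" "(2 powr (\<alpha> + 1) - 1) * zeta (\<alpha> + 1) > 0"
    using p z by (auto intro!: mult_pos_neg mult_pos_pos)
  then have d4: "\<alpha> * ((2 powr (\<alpha> + 1) - 2) * zeta \<alpha> - (2 powr (\<alpha> + 1) - 1) * zeta (\<alpha> + 1)) < 0"
    using \<alpha> by (intro mult_pos_neg) linarith+
  have "(2 powr \<alpha> - 1) * zeta \<alpha> < 0" "(2 powr \<alpha> - 2) * zeta (\<alpha> - 1) > 0"
    using p z by (auto intro!: mult_pos_neg mult_neg_neg)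
  then show "shift_midpoint \<alpha> \<ge> 0"
    unfolding shift_midpoint_def using d4 by (intro divide_nonpos_neg) linarith+
  show "\<alpha> * shift_midpoint \<alpha> * ((2 powr (\<alpha> + 1) - 2) * zeta \<alpha> - (2 powr (\<alpha> + 1) - 1) * zeta (\<alpha> + 1))
      = (2 powr \<alpha> - 1) * zeta \<alpha> - (2 powr \<alpha> - 2) * zeta (\<alpha> - 1)"
  proof -
    have "\<alpha> * X \<noteq> 0 \<Longrightarrow> \<alpha> * (Y / (\<alpha> * X)) * X = Y" for X Y by simp
    from this[OF less_imp_neq[OF d4]] show ?thesis unfolding shift_midpoint_def .
  qed
qed

section \<open>The four schemes and their optimal shifts\<close>

context vanishing_C2
begin

lemma schemes_order_2_minus_alpha:
  assumes \<alpha>: "0 < \<alpha>" "\<alpha> < 1" and t: "0 < t" "t \<le> T" "s < 0 \<longrightarrow> t < T"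
  shows "approximates_caputo_with_order (c_trapezoid \<alpha>) (w_trapezoid \<alpha> s) \<alpha> s y t (2 - \<alpha>)"
    and "approximates_caputo_with_order (c_L1 \<alpha>) (w_L1 \<alpha> s) \<alpha> s y t (2 - \<alpha>)"
    and "approximates_caputo_with_order (c_central \<alpha>) (w_central \<alpha> s) \<alpha> s y t (2 - \<alpha>)"
    and "approximates_caputo_with_order (c_midpoint \<alpha>) (w_midpoint \<alpha> s) \<alpha> s y t (2 - \<alpha>)"
  using second_difference_scheme_order_2_minus_alpha[OF \<alpha> trapezoid_weights trapezoid_asymptotics(1)[OF \<alpha>] t]
    second_difference_scheme_order_2_minus_alpha[OF \<alpha> L1_weights L1_asymptotics(1)[OF \<alpha>] t]
    second_difference_scheme_order_2_minus_alpha[OF \<alpha> central_weights central_asymptotics(1)[OF \<alpha>] t]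
    second_difference_scheme_order_2_minus_alpha[OF \<alpha> midpoint_weights midpoint_asymptotics(1)[OF \<alpha>] t]
  by blast+

lemma schemes_order_2:
  assumes \<alpha>: "0 < \<alpha>" "\<alpha> < 1" and T: "0 < T"
    and y2_deriv: "\<And>x. x \<in> {0..T} \<Longrightarrow> (y2 has_real_derivative y3 x) (at x within {0..T})"
    and y3_cont: "continuous_on {0..T} y3"
  shows "approximates_caputo_with_order (c_trapezoid \<alpha>) (w_trapezoid \<alpha> (shift_trapezoid \<alpha>)) \<alpha> (shift_trapezoid \<alpha>) y T 2"
    and "approximates_caputo_with_order (c_L1 \<alpha>) (w_L1 \<alpha> (shift_L1 \<alpha>)) \<alpha> (shift_L1 \<alpha>) y T 2"
    and "approximates_caputo_with_order (c_central \<alpha>) (w_central \<alpha> (shift_central \<alpha>)) \<alpha> (shift_central \<alpha>) y T 2"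
    and "approximates_caputo_with_order (c_midpoint \<alpha>) (w_midpoint \<alpha> (shift_midpoint \<alpha>)) \<alpha> (shift_midpoint \<alpha>) y T 2"
proof -
  note opt = optimal_shifts[OF \<alpha>]
  show "approximates_caputo_with_order (c_trapezoid \<alpha>) (w_trapezoid \<alpha> (shift_trapezoid \<alpha>)) \<alpha> (shift_trapezoid \<alpha>) y T 2"
  proof (rule second_difference_scheme_order_2[OF \<alpha> trapezoid_weights trapezoid_asymptotics(1)[OF \<alpha>] T opt(1) y2_deriv y3_cont _ _ trapezoid_asymptotics(2)[OF \<alpha>]])
    have e: "\<alpha> + 1 - 1 = \<alpha>" "\<alpha> + 2 - 1 = \<alpha> + 1" "\<alpha> + 1 - 2 = \<alpha> - 1" "\<alpha> + 2 - 2 = \<alpha>" by auto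
    have z2: "zeta_moment2 p 1 = zeta_moment p 1 / 2 + (zeta (p - 1) - zeta (p - 2)) / 2" for p
      unfolding zeta_moment2_def zeta_moment_def zeta_remainder_1 by (simp add: field_simps)
    show "zeta_moment2 (\<alpha> + 1) 1 + (\<alpha> + 1) * shift_trapezoid \<alpha> * zeta_moment2 (\<alpha> + 2) 1
        = (zeta_moment (\<alpha> + 1) 1 + (\<alpha> + 1) * shift_trapezoid \<alpha> * zeta_moment (\<alpha> + 2) 1) / 2"
    proof -
      \<comment> \<open>The deviation of \<open>Q 1\<close> from \<open>W 1 / 2\<close> is isolated
        as an affine function of X, which is 0 by the defining equation of the optimal shift. The
        other three schemes are treated in the same way.\<close>
      have "zeta_moment2 (\<alpha> + 1) 1 + X * zeta_moment2 (\<alpha> + 2) 1 =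
        (zeta_moment (\<alpha> + 1) 1 + X * zeta_moment (\<alpha> + 2) 1) / 2
        + (zeta \<alpha> - zeta (\<alpha> - 1) - X * (zeta \<alpha> - zeta (\<alpha> + 1))) / 2" for X
        unfolding z2 e by (simp add: algebra_simps add_divide_distrib diff_divide_distrib)
      from this[of "(\<alpha> + 1) * shift_trapezoid \<alpha>"] show ?thesis unfolding opt(5) by simp
    qed
    show "zeta_moment2 (\<alpha> + 1) (Suc m) + (\<alpha> + 1) * shift_trapezoid \<alpha> * zeta_moment2 (\<alpha> + 2) (Suc m)
      = zeta_moment2 (\<alpha> + 1) m + (\<alpha> + 1) * shift_trapezoid \<alpha> * zeta_moment2 (\<alpha> + 2) m
       + (zeta_moment (\<alpha> + 1) m + (\<alpha> + 1) * shift_trapezoid \<alpha> * zeta_moment (\<alpha> + 2) m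
         + (zeta_moment (\<alpha> + 1) (Suc m) + (\<alpha> + 1) * shift_trapezoid \<alpha> * zeta_moment (\<alpha> + 2) (Suc m))) / 2" if "m > 0" for m
      unfolding zeta_moment2_trapezoid[OF that] by (simp add: algebra_simps add_divide_distrib)
  qed
  show "approximates_caputo_with_order (c_L1 \<alpha>) (w_L1 \<alpha> (shift_L1 \<alpha>)) \<alpha> (shift_L1 \<alpha>) y T 2"
  proof (rule second_difference_scheme_order_2[OF \<alpha> L1_weights L1_asymptotics(1)[OF \<alpha>] T opt(2) y2_deriv y3_cont _ _ L1_asymptotics(2)[OF \<alpha>]])
    show "zeta_remainder (\<alpha> - 1) 1 + shift_L1 \<alpha> * (\<alpha> - 1) * zeta_remainder \<alpha> 1
      = (real 1 powr (1 - \<alpha>) + shift_L1 \<alpha> * (\<alpha> - 1) * real 1 powr - \<alpha>) / 2"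
    proof -
      have "1 / 2 - a + S * (\<alpha> - 1) * (1 / 2 - b) = (1 + S * (\<alpha> - 1) * 1) / 2 + (S * (1 - \<alpha>) * b - a)" for a b S
        by (simp add: field_simps)
      from this[where a = "zeta (\<alpha> - 1)" and S = "shift_L1 \<alpha>" and b = "zeta \<alpha>"] show ?thesis
        unfolding zeta_remainder_1 opt(6) by simp
    qed
    show "zeta_remainder (\<alpha> - 1) (Suc m) + shift_L1 \<alpha> * (\<alpha> - 1) * zeta_remainder \<alpha> (Suc m)
      = zeta_remainder (\<alpha> - 1) m + shift_L1 \<alpha> * (\<alpha> - 1) * zeta_remainder \<alpha> m
       + (real m powr (1 - \<alpha>) + shift_L1 \<alpha> * (\<alpha> - 1) * real m powr - \<alpha>
         + (real (Suc m) powr (1 - \<alpha>) + shift_L1 \<alpha> * (\<alpha> - 1) * real (Suc m) powr - \<alpha>)) / 2" if "m > 0" for m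
      unfolding zeta_remainder_Suc[OF that] by (simp add: algebra_simps add_divide_distrib diff_divide_distrib)
  qed
  show "approximates_caputo_with_order (c_central \<alpha>) (w_central \<alpha> (shift_central \<alpha>)) \<alpha> (shift_central \<alpha>) y T 2"
  proof (rule second_difference_scheme_order_2[OF \<alpha> central_weights central_asymptotics(1)[OF \<alpha>] T opt(3) y2_deriv y3_cont _ _ central_asymptotics(2)[OF \<alpha>]])
    show "2 * (zeta_moment \<alpha> 1 + real 1 powr (- \<alpha>) / 4)
        + 2 * \<alpha> * shift_central \<alpha> * (zeta_moment (\<alpha> + 1) 1 + real 1 powr (- (\<alpha> + 1)) / 4)
      = (2 * zeta_remainder \<alpha> 1 + 2 * \<alpha> * shift_central \<alpha> * zeta_remainder (\<alpha> + 1) 1) / 2"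
    proof -
      have "2 * (c - a + 1 / 4) + 2 * \<alpha> * S * (a - b + 1 / 4)
        = (2 * (1 / 2 - a) + 2 * \<alpha> * S * (1 / 2 - b)) / 2 + (2 * c - a - \<alpha> * S * (b - 2 * a))" for a b c S :: real
        by (simp add: field_simps)
      from this[of "zeta (\<alpha> - 1)" "zeta \<alpha>" "shift_central \<alpha>" "zeta (\<alpha> + 1)"] show ?thesis
        unfolding zeta_moment_1 zeta_remainder_1 opt(7) by simp
    qed
    show "2 * (zeta_moment \<alpha> (Suc m) + real (Suc m) powr (- \<alpha>) / 4)
        + 2 * \<alpha> * shift_central \<alpha> * (zeta_moment (\<alpha> + 1) (Suc m) + real (Suc m) powr (- (\<alpha> + 1)) / 4)
      = 2 * (zeta_moment \<alpha> m + real m powr (- \<alpha>) / 4)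
        + 2 * \<alpha> * shift_central \<alpha> * (zeta_moment (\<alpha> + 1) m + real m powr (- (\<alpha> + 1)) / 4)
       + (2 * zeta_remainder \<alpha> m + 2 * \<alpha> * shift_central \<alpha> * zeta_remainder (\<alpha> + 1) m
         + (2 * zeta_remainder \<alpha> (Suc m) + 2 * \<alpha> * shift_central \<alpha> * zeta_remainder (\<alpha> + 1) (Suc m))) / 2" if "m > 0" for m
      unfolding zeta_moment_trapezoid[OF that] by (simp add: algebra_simps add_divide_distrib)
  qed
  show "approximates_caputo_with_order (c_midpoint \<alpha>) (w_midpoint \<alpha> (shift_midpoint \<alpha>)) \<alpha> (shift_midpoint \<alpha>) y T 2"
  proof (rule second_difference_scheme_order_2[OF \<alpha> midpoint_weights midpoint_asymptotics(1)[OF \<alpha>] T opt(4) y2_deriv y3_cont _ _ midpoint_asymptotics(2)[OF \<alpha>]])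
    have two: "(2 :: real) powr (\<alpha> + 1) = 2 * 2 powr \<alpha>" "(2 :: real) powr (\<alpha> - 1) = 2 powr \<alpha> / 2"
      by (simp_all add: powr_add powr_diff)
    show "real 1 * zeta_midpoint \<alpha> 1 - zeta_midpoint (\<alpha> - 1) 1
        + \<alpha> * shift_midpoint \<alpha> * (real 1 * zeta_midpoint (\<alpha> + 1) 1 - zeta_midpoint \<alpha> 1)
      = (zeta_midpoint \<alpha> 1 + \<alpha> * shift_midpoint \<alpha> * zeta_midpoint (\<alpha> + 1) 1) / 2"
    proof -
      have "1 * (w - (w - 1) * a) - (w / 2 - (w / 2 - 1) * c) + X * (1 * (2 * w - (2 * w - 1) * b) - (w - (w - 1) * a))
        = ((w - (w - 1) * a) + X * (2 * w - (2 * w - 1) * b)) / 2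
         + (X * ((2 * w - 2) * a - (2 * w - 1) * b) - ((w - 1) * a - (w - 2) * c)) / 2" for a b c X w :: real
        by (simp add: field_simps)
      from this[of "2 powr \<alpha>" "zeta \<alpha>" "zeta (\<alpha> - 1)" "\<alpha> * shift_midpoint \<alpha>" "zeta (\<alpha> + 1)"] show ?thesis
        unfolding zeta_midpoint_1 two opt(8)[unfolded two] by simp
    qed
    show "real (Suc m) * zeta_midpoint \<alpha> (Suc m) - zeta_midpoint (\<alpha> - 1) (Suc m)
        + \<alpha> * shift_midpoint \<alpha> * (real (Suc m) * zeta_midpoint (\<alpha> + 1) (Suc m) - zeta_midpoint \<alpha> (Suc m))
      = real m * zeta_midpoint \<alpha> m - zeta_midpoint (\<alpha> - 1) m
        + \<alpha> * shift_midpoint \<alpha> * (real m * zeta_midpoint (\<alpha> + 1) m - zeta_midpoint \<alpha> m)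
       + (zeta_midpoint \<alpha> m + \<alpha> * shift_midpoint \<alpha> * zeta_midpoint (\<alpha> + 1) m
         + (zeta_midpoint \<alpha> (Suc m) + \<alpha> * shift_midpoint \<alpha> * zeta_midpoint (\<alpha> + 1) (Suc m))) / 2" if "m > 0" for m
      using zeta_midpoint_trapezoid[OF that, of "\<alpha> + 1"]
      unfolding zeta_midpoint_trapezoid[OF that, of \<alpha>] add_diff_cancel_right'
      by (simp only:) (simp add: algebra_simps add_divide_distrib)
  qed
qed

end

text \<open>The initial condition concerns y, the locale the witness D. The two derivatives at 0
  agree because 0 is a limit point of [0, T], so that one-sided derivatives there are
  unique.\<close>

lemma vanishing_C2I:
  assumes T: "0 < T"
    and D0: "\<And>x. x \<in> {0..T} \<Longrightarrow> D 0 x = y x"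
    and D: "\<And>i x. i < 2 \<Longrightarrow> x \<in> {0..T} \<Longrightarrow> (D i has_real_derivative D (Suc i) x) (at x within {0..T})"
    and D2: "continuous_on {0..T} (D 2)"
    and y0: "y 0 = 0" and y'0: "(y has_real_derivative 0) (at 0 within {0..T})"
  shows "vanishing_C2 y (D 1) (D 2) T"
proof
  show y: "(y has_real_derivative D 1 x) (at x within {0..T})" if "x \<in> {0..T}" for x
    using D[of 0 x] D0 that by (intro has_field_derivative_transform_within[of "D 0" _ _ _ 1 y]) auto
  show "(D 1 has_real_derivative D 2 x) (at x within {0..T})" if "x \<in> {0..T}" for x
    using D[of 1 x] that by (simp add: numeral_2_eq_2)
  have "at 0 within {0..T} \<noteq> bot"
    using T by (simp add: at_within_Icc_at_right)
  then show "D 1 0 = 0"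
    using y[of 0] y'0 T vector_derivative_unique_within[of 0 "{0..T}" y "D 1 0" 0]
    by (simp add: has_real_derivative_iff_has_vector_derivative)
qed (use D2 y0 in auto)

text \<open>Second order rests on Lipschitz continuity of y'', supplied by a continuous third
  derivative. It is required on [0, t] only, because the optimal shifts are nonnegative, whereas a
  negative s in the first four claims looks beyond t.\<close>

theorem mainTheorem14:
  fixes \<alpha> s t T :: real and y :: "real \<Rightarrow> real"
  assumes "0 < \<alpha>" and "\<alpha> < 1" and "0 < t"
    and "t \<le> T" and "s < 0 \<longrightarrow> t < T"
    and "C_k_on 2 y {0..T}"
    and "y 0 = 0" and "(y has_real_derivative 0) (at 0 within {0..T})"
  shows "approximates_caputo_with_order (c_trapezoid \<alpha>) (w_trapezoid \<alpha> s) \<alpha> s y t (2 - \<alpha>)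
    \<and> approximates_caputo_with_order (c_L1 \<alpha>) (w_L1 \<alpha> s) \<alpha> s y t (2 - \<alpha>)
    \<and> approximates_caputo_with_order (c_central \<alpha>) (w_central \<alpha> s) \<alpha> s y t (2 - \<alpha>)
    \<and> approximates_caputo_with_order (c_midpoint \<alpha>) (w_midpoint \<alpha> s) \<alpha> s y t (2 - \<alpha>)
    \<and> (C_k_on 3 y {0..t} \<longrightarrow>
         approximates_caputo_with_order (c_trapezoid \<alpha>) (w_trapezoid \<alpha> (shift_trapezoid \<alpha>))
           \<alpha> (shift_trapezoid \<alpha>) y t 2
       \<and> approximates_caputo_with_order (c_L1 \<alpha>) (w_L1 \<alpha> (shift_L1 \<alpha>))
           \<alpha> (shift_L1 \<alpha>) y t 2
       \<and> approximates_caputo_with_order (c_central \<alpha>) (w_central \<alpha> (shift_central \<alpha>))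
           \<alpha> (shift_central \<alpha>) y t 2
       \<and> approximates_caputo_with_order (c_midpoint \<alpha>) (w_midpoint \<alpha> (shift_midpoint \<alpha>))
           \<alpha> (shift_midpoint \<alpha>) y t 2)"
proof (intro conjI impI)
  obtain D where D: "\<And>x. x \<in> {0..T} \<Longrightarrow> D 0 x = y x"
      "\<And>i x. i < 2 \<Longrightarrow> x \<in> {0..T} \<Longrightarrow> (D i has_real_derivative D (Suc i) x) (at x within {0..T})"
      "continuous_on {0..T} (D 2)"
    using assms(6) unfolding C_k_on_def by blast
  interpret vanishing_C2 y "D 1" "D 2" T
    using assms D by (intro vanishing_C2I) auto
  note schemes = schemes_order_2_minus_alpha[OF assms(1-5)]
  show "approximates_caputo_with_order (c_trapezoid \<alpha>) (w_trapezoid \<alpha> s) \<alpha> s y t (2 - \<alpha>)"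
    and "approximates_caputo_with_order (c_L1 \<alpha>) (w_L1 \<alpha> s) \<alpha> s y t (2 - \<alpha>)"
    and "approximates_caputo_with_order (c_central \<alpha>) (w_central \<alpha> s) \<alpha> s y t (2 - \<alpha>)"
    and "approximates_caputo_with_order (c_midpoint \<alpha>) (w_midpoint \<alpha> s) \<alpha> s y t (2 - \<alpha>)"
    by (rule schemes)+
next
  \<comment> \<open>The third derivative belongs to a new witness D, so the locale is interpreted
    again, now on [0, t].\<close>
  assume "C_k_on 3 y {0..t}"
  then obtain D where D: "\<And>x. x \<in> {0..t} \<Longrightarrow> D 0 x = y x"
      "\<And>i x. i < 3 \<Longrightarrow> x \<in> {0..t} \<Longrightarrow> (D i has_real_derivative D (Suc i) x) (at x within {0..t})"
      "continuous_on {0..t} (D 3)"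
    unfolding C_k_on_def by blast
  have D2: "(D 2 has_real_derivative D 3 x) (at x within {0..t})" if "x \<in> {0..t}" for x
    using D(2)[of 2 x] that by (simp add: numeral_3_eq_3 numeral_2_eq_2)
  then have "continuous_on {0..t} (D 2)"
    by (rule DERIV_continuous_on)
  moreover have "(y has_real_derivative 0) (at 0 within {0..t})"
    using assms by (intro DERIV_subset[OF assms(8)]) auto
  ultimately interpret vanishing_C2 y "D 1" "D 2" t
    using assms D by (intro vanishing_C2I) auto
  show "approximates_caputo_with_order (c_trapezoid \<alpha>) (w_trapezoid \<alpha> (shift_trapezoid \<alpha>))
           \<alpha> (shift_trapezoid \<alpha>) y t 2"
    and "approximates_caputo_with_order (c_L1 \<alpha>) (w_L1 \<alpha> (shift_L1 \<alpha>)) \<alpha> (shift_L1 \<alpha>) y t 2"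
    and "approximates_caputo_with_order (c_central \<alpha>) (w_central \<alpha> (shift_central \<alpha>))
           \<alpha> (shift_central \<alpha>) y t 2"
    and "approximates_caputo_with_order (c_midpoint \<alpha>) (w_midpoint \<alpha> (shift_midpoint \<alpha>))
           \<alpha> (shift_midpoint \<alpha>) y t 2"
    by (rule schemes_order_2[OF assms(1-3) D2 D(3)]; assumption)+
qed

end
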